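(* Let $I$ be an inverse semigroup with a scale $N\colon I^\times\to\mathbb R_+^\times$, and let $I_c$ be the crystal of $(I,N)$. Then the crystal of $(C^*_0(I),\sigma^N)$ is canonically isomorphic to $C^*_0(I_c)$.
   Context: Inverse semigroups. $I^\times$ is the set of nonzero elements of $I$ ($I^\times=I$ if $I$ has no zero), $E$ is the semigroup of idempotents of $I$, $E^\times=E\setminus\{0\}$. A scale is a map $N\colon I^\times\to\mathbb R^\times_+=(0,\infty)$ with $N(gh)=N(g)N(h)$ whenever $gh\ne0$. Define $E_c^\times=\{p\in E^\times:\text{ whenever }p=g^{-1}g\text{ with }g\in I,\text{ then }N(g)\ge1\}$ and $I_c^\times=\{g\in I^\times: g^{-1}g\in E_c^\times,\ gg^{-1}\in E_c^\times\}$. The crystal $I_c$ of $(I,N)$ is the inverse semigroup obtained from $I_c^\times$ by adding a zero $0$ if necessary, with product $g\cdot h=gh$ if $gh\in I_c^\times$ and $g\cdot h=0$ otherwise; if $E_c^\times=\emptyset$, then $I_c=\{0\}$. C$^*$-algebras. $C_0^*(I)$ is the universal C$^*$-algebra of representations of $I$ by partial isometries (with generators $v_g$), where, if $0\in I$, only representations mapping $0$ to $0$ are considered; in particular $C^*_0(\{0\})=0$. The dynamics $\sigma^N$ on $C^*_0(I)$ is given by $\sigma^N_t(v_g)=N(g)^{it}v_g$, $g\in I^\times$. Crystal of a C$^*$-dynamical system. For a C$^*$-algebra $A$ with a one-parameter group of automorphisms $\sigma=(\sigma_t)_{t\in\mathbb R}$, put $A_\lambda=\{a\in A:\sigma_t(a)=e^{it\lambda}a\text{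 for all }t\in\mathbb R\}$ and assume that the linear span of these spaces is dense in $A$ (which holds for $\sigma^N$). The crystal of $(A,\sigma)$ is $A_0/J$, where $J=\overline{\sum_{\lambda>0}A_\lambda A_\lambda^*}$ (closed linear span) is an ideal in $A_0$. *)

theory Defs
  imports "HOL-Analysis.Analysis"
begin

section \<open>Inverse semigroups, scales and crystals\<close>

record 'a sgrp =
  sg_carrier :: "'a set"
  sg_mult :: "'a \<Rightarrow> 'a \<Rightarrow> 'a"

locale inverse_semigroup =
  fixes I :: "'a sgrp"
  assumes mult_closed:
      "\<lbrakk>g \<in> sg_carrier I; h \<in> sg_carrier I\<rbrakk> \<Longrightarrow> sg_mult I g h \<in> sg_carrier I"
    and mult_assoc:
      "\<lbrakk>g \<in> sg_carrier I; h \<in> sg_carrier I; k \<in> sg_carrier I\<rbrakk>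
        \<Longrightarrow> sg_mult I (sg_mult I g h) k = sg_mult I g (sg_mult I h k)"
    and ex1_inverse:
      "g \<in> sg_carrier I \<Longrightarrow> \<exists>!h. h \<in> sg_carrier I \<and>
          sg_mult I (sg_mult I g h) g = g \<and> sg_mult I (sg_mult I h g) h = h"

definition sg_inv :: "'a sgrp \<Rightarrow> 'a \<Rightarrow> 'a" where
  "sg_inv I g = (THE h. h \<in> sg_carrier I \<and>
      sg_mult I (sg_mult I g h) g = g \<and> sg_mult I (sg_mult I h g) h = h)"

definition is_zero :: "'a sgrp \<Rightarrow> 'a \<Rightarrow> bool" where
  "is_zero I z \<longleftrightarrow> z \<in> sg_carrier I \<and>
     (\<forall>g \<in> sg_carrier I. sg_mult I z g = z \<and> sg_mult I g z = z)"

definition nonzero :: "'a sgrp \<Rightarrow> 'a set" where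
  "nonzero I = {g \<in> sg_carrier I. \<not> is_zero I g}"

definition nonzero_idempotents :: "'a sgrp \<Rightarrow> 'a set" where
  "nonzero_idempotents I = {p \<in> nonzero I. sg_mult I p p = p}"

definition is_scale :: "'a sgrp \<Rightarrow> ('a \<Rightarrow> real) \<Rightarrow> bool" where
  "is_scale I N \<longleftrightarrow>
     (\<forall>g \<in> nonzero I. 0 < N g) \<and>
     (\<forall>g \<in> nonzero I. \<forall>h \<in> nonzero I. sg_mult I g h \<in> nonzero I
        \<longrightarrow> N (sg_mult I g h) = N g * N h)"

definition crystal_idempotents :: "'a sgrp \<Rightarrow> ('a \<Rightarrow> real) \<Rightarrow> 'a set" where
  "crystal_idempotents I N = {p \<in> nonzero_idempotents I.
     \<forall>g \<in> sg_carrier I. p = sg_mult I (sg_inv I g) g \<longrightarrow> 1 \<le> N g}"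

definition crystal_nonzero :: "'a sgrp \<Rightarrow> ('a \<Rightarrow> real) \<Rightarrow> 'a set" where
  "crystal_nonzero I N = {g \<in> nonzero I.
     sg_mult I (sg_inv I g) g \<in> crystal_idempotents I N \<and>
     sg_mult I g (sg_inv I g) \<in> crystal_idempotents I N}"

text \<open>The zero of the crystal is \<^term>\<open>None\<close>. It is adjoined in all cases, so that the nonzero
  elements of the crystal are exactly the \<^term>\<open>Some g\<close> with \<^term>\<open>g \<in> crystal_nonzero I N\<close>.
  If it were left out whenever all products stay in \<^term>\<open>crystal_nonzero I N\<close>, an absorbing element
  of that set would be mistaken for a zero: for the bicyclic monoid with \<open>N(s) > 1\<close> for its isometry
  \<open>s\<close> this set is \<open>{1}\<close>, and the crystal has to be \<open>{1, 0}\<close>.\<close>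

definition sg_crystal :: "'a sgrp \<Rightarrow> ('a \<Rightarrow> real) \<Rightarrow> 'a option sgrp" where
  "sg_crystal I N =
    \<lparr> sg_carrier = insert None (Some ` crystal_nonzero I N),
      sg_mult = (\<lambda>x y. case (x, y) of
          (Some g, Some h) \<Rightarrow>
            (if sg_mult I g h \<in> crystal_nonzero I N then Some (sg_mult I g h) else None)
        | _ \<Rightarrow> None) \<rparr>"


section \<open>C*-algebras with explicit carriers\<close>

record 'b cstar =
  cs_carrier :: "'b set"
  cs_zero :: 'b
  cs_add :: "'b \<Rightarrow> 'b \<Rightarrow> 'b"
  cs_scale :: "complex \<Rightarrow> 'b \<Rightarrow> 'b"
  cs_mult :: "'b \<Rightarrow> 'b \<Rightarrow> 'b"
  cs_star :: "'b \<Rightarrow> 'b"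
  cs_norm :: "'b \<Rightarrow> real"

definition cs_minus :: "'b cstar \<Rightarrow> 'b \<Rightarrow> 'b \<Rightarrow> 'b" where
  "cs_minus A a b = cs_add A a (cs_scale A (-1) b)"

locale cstar_algebra =
  fixes A :: "'b cstar"
  assumes zero_closed: "cs_zero A \<in> cs_carrier A"
    and add_closed: "\<lbrakk>a \<in> cs_carrier A; b \<in> cs_carrier A\<rbrakk> \<Longrightarrow> cs_add A a b \<in> cs_carrier A"
    and scale_closed: "a \<in> cs_carrier A \<Longrightarrow> cs_scale A c a \<in> cs_carrier A"
    and mult_closed: "\<lbrakk>a \<in> cs_carrier A; b \<in> cs_carrier A\<rbrakk> \<Longrightarrow> cs_mult A a b \<in> cs_carrier A"
    and star_closed: "a \<in> cs_carrier A \<Longrightarrow> cs_star A a \<in> cs_carrier A"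
    and add_assoc: "\<lbrakk>a \<in> cs_carrier A; b \<in> cs_carrier A; d \<in> cs_carrier A\<rbrakk>
      \<Longrightarrow> cs_add A (cs_add A a b) d = cs_add A a (cs_add A b d)"
    and add_commute: "\<lbrakk>a \<in> cs_carrier A; b \<in> cs_carrier A\<rbrakk> \<Longrightarrow> cs_add A a b = cs_add A b a"
    and add_zero: "a \<in> cs_carrier A \<Longrightarrow> cs_add A (cs_zero A) a = a"
    and minus_self: "a \<in> cs_carrier A \<Longrightarrow> cs_minus A a a = cs_zero A"
    and scale_one: "a \<in> cs_carrier A \<Longrightarrow> cs_scale A 1 a = a"
    and scale_scale: "a \<in> cs_carrier A \<Longrightarrow> cs_scale A c (cs_scale A s a) = cs_scale A (c * s) a"
    and scale_add_left: "a \<in> cs_carrier A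
      \<Longrightarrow> cs_scale A (c + s) a = cs_add A (cs_scale A c a) (cs_scale A s a)"
    and scale_add_right: "\<lbrakk>a \<in> cs_carrier A; b \<in> cs_carrier A\<rbrakk>
      \<Longrightarrow> cs_scale A c (cs_add A a b) = cs_add A (cs_scale A c a) (cs_scale A c b)"
    and mult_assoc: "\<lbrakk>a \<in> cs_carrier A; b \<in> cs_carrier A; d \<in> cs_carrier A\<rbrakk>
      \<Longrightarrow> cs_mult A (cs_mult A a b) d = cs_mult A a (cs_mult A b d)"
    and mult_add_left: "\<lbrakk>a \<in> cs_carrier A; b \<in> cs_carrier A; d \<in> cs_carrier A\<rbrakk>
      \<Longrightarrow> cs_mult A (cs_add A a b) d = cs_add A (cs_mult A a d) (cs_mult A b d)"
    and mult_add_right: "\<lbrakk>a \<in> cs_carrier A; b \<in> cs_carrier A; d \<in> cs_carrier A\<rbrakk>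
      \<Longrightarrow> cs_mult A d (cs_add A a b) = cs_add A (cs_mult A d a) (cs_mult A d b)"
    and mult_scale_left: "\<lbrakk>a \<in> cs_carrier A; b \<in> cs_carrier A\<rbrakk>
      \<Longrightarrow> cs_mult A (cs_scale A c a) b = cs_scale A c (cs_mult A a b)"
    and mult_scale_right: "\<lbrakk>a \<in> cs_carrier A; b \<in> cs_carrier A\<rbrakk>
      \<Longrightarrow> cs_mult A a (cs_scale A c b) = cs_scale A c (cs_mult A a b)"
    and star_star: "a \<in> cs_carrier A \<Longrightarrow> cs_star A (cs_star A a) = a"
    and star_add: "\<lbrakk>a \<in> cs_carrier A; b \<in> cs_carrier A\<rbrakk>
      \<Longrightarrow> cs_star A (cs_add A a b) = cs_add A (cs_star A a) (cs_star A b)"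
    and star_scale: "a \<in> cs_carrier A \<Longrightarrow> cs_star A (cs_scale A c a) = cs_scale A (cnj c) (cs_star A a)"
    and star_mult: "\<lbrakk>a \<in> cs_carrier A; b \<in> cs_carrier A\<rbrakk>
      \<Longrightarrow> cs_star A (cs_mult A a b) = cs_mult A (cs_star A b) (cs_star A a)"
    and norm_nonneg: "a \<in> cs_carrier A \<Longrightarrow> 0 \<le> cs_norm A a"
    and norm_eq_zero: "a \<in> cs_carrier A \<Longrightarrow> cs_norm A a = 0 \<longleftrightarrow> a = cs_zero A"
    and norm_triangle: "\<lbrakk>a \<in> cs_carrier A; b \<in> cs_carrier A\<rbrakk>
      \<Longrightarrow> cs_norm A (cs_add A a b) \<le> cs_norm A a + cs_norm A b"
    and norm_scale: "a \<in> cs_carrier A \<Longrightarrow> cs_norm A (cs_scale A c a) = cmod c * cs_norm A a"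
    and norm_mult: "\<lbrakk>a \<in> cs_carrier A; b \<in> cs_carrier A\<rbrakk>
      \<Longrightarrow> cs_norm A (cs_mult A a b) \<le> cs_norm A a * cs_norm A b"
    and cstar_identity: "a \<in> cs_carrier A \<Longrightarrow> cs_norm A (cs_mult A (cs_star A a) a) = (cs_norm A a)\<^sup>2"
    and complete: "\<lbrakk>\<And>n. X n \<in> cs_carrier A;
        \<And>e. 0 < e \<Longrightarrow> \<exists>M. \<forall>m\<ge>M. \<forall>n\<ge>M. cs_norm A (cs_minus A (X m) (X n)) < e\<rbrakk>
      \<Longrightarrow> \<exists>a \<in> cs_carrier A. (\<lambda>n. cs_norm A (cs_minus A (X n) a)) \<longlonglongrightarrow> 0"

text \<open>A *-isomorphism of C*-algebras is automatically isometric; this is recorded in the definition.\<close>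

definition cstar_iso :: "'b cstar \<Rightarrow> 'c cstar \<Rightarrow> ('b \<Rightarrow> 'c) \<Rightarrow> bool" where
  "cstar_iso A B \<Phi> \<longleftrightarrow>
     cstar_algebra A \<and> cstar_algebra B \<and>
     bij_betw \<Phi> (cs_carrier A) (cs_carrier B) \<and>
     (\<forall>a \<in> cs_carrier A. \<forall>b \<in> cs_carrier A.
        \<Phi> (cs_add A a b) = cs_add B (\<Phi> a) (\<Phi> b) \<and>
        \<Phi> (cs_mult A a b) = cs_mult B (\<Phi> a) (\<Phi> b)) \<and>
     (\<forall>a \<in> cs_carrier A. \<forall>c. \<Phi> (cs_scale A c a) = cs_scale B c (\<Phi> a)) \<and>
     (\<forall>a \<in> cs_carrier A. \<Phi> (cs_star A a) = cs_star B (\<Phi> a)) \<and>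
     (\<forall>a \<in> cs_carrier A. cs_norm B (\<Phi> a) = cs_norm A a)"

inductive_set cs_span :: "'b cstar \<Rightarrow> 'b set \<Rightarrow> 'b set" for A X where
  zero: "cs_zero A \<in> cs_span A X"
| base: "x \<in> X \<Longrightarrow> x \<in> cs_span A X"
| add: "\<lbrakk>a \<in> cs_span A X; b \<in> cs_span A X\<rbrakk> \<Longrightarrow> cs_add A a b \<in> cs_span A X"
| scale: "a \<in> cs_span A X \<Longrightarrow> cs_scale A c a \<in> cs_span A X"

definition cs_closed_span :: "'b cstar \<Rightarrow> 'b set \<Rightarrow> 'b set" where
  "cs_closed_span A X =
     {a \<in> cs_carrier A. \<forall>e>0. \<exists>b \<in> cs_span A X. cs_norm A (cs_minus A a b) < e}"

definition cs_restrict :: "'b cstar \<Rightarrow> 'b set \<Rightarrow> 'b cstar" where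
  "cs_restrict A S = A\<lparr>cs_carrier := S\<rparr>"

definition cs_coset :: "'b cstar \<Rightarrow> 'b set \<Rightarrow> 'b \<Rightarrow> 'b set" where
  "cs_coset A J a = cs_add A a ` J"

text \<open>Each operation is the union, over all choices of representatives, of the resulting cosets;
  for a closed ideal \<open>J\<close> these all coincide.\<close>

definition cs_quotient :: "'b cstar \<Rightarrow> 'b set \<Rightarrow> 'b set cstar" where
  "cs_quotient A J =
    \<lparr> cs_carrier = cs_coset A J ` cs_carrier A,
      cs_zero = cs_coset A J (cs_zero A),
      cs_add = (\<lambda>X Y. \<Union>x\<in>X. \<Union>y\<in>Y. cs_coset A J (cs_add A x y)),
      cs_scale = (\<lambda>c X. \<Union>x\<in>X. cs_coset A J (cs_scale A c x)),
      cs_mult = (\<lambda>X Y. \<Union>x\<in>X. \<Union>y\<in>Y. cs_coset A J (cs_mult A x y)),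
      cs_star = (\<lambda>X. \<Union>x\<in>X. cs_coset A J (cs_star A x)),
      cs_norm = (\<lambda>X. Inf (cs_norm A ` X)) \<rparr>"


section \<open>The crystal of a C*-dynamical system\<close>

text \<open>These notions are meant for one-parameter automorphism groups whose spectral subspaces span a
  dense subspace. This holds for the dynamics defined by a scale, since \<open>v\<^sub>g\<close> lies in the spectral
  subspace of \<open>ln (N g)\<close>.\<close>

definition spectral_subspace :: "'b cstar \<Rightarrow> (real \<Rightarrow> 'b \<Rightarrow> 'b) \<Rightarrow> real \<Rightarrow> 'b set" where
  "spectral_subspace A \<sigma> l =
     {a \<in> cs_carrier A. \<forall>t. \<sigma> t a = cs_scale A (exp (\<i> * of_real t * of_real l)) a}"

definition crystal_ideal :: "'b cstar \<Rightarrow> (real \<Rightarrow> 'b \<Rightarrow> 'b) \<Rightarrow> 'b set" where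
  "crystal_ideal A \<sigma> = cs_closed_span A
     (\<Union>l\<in>{0<..}. {cs_mult A a (cs_star A b) | a b.
        a \<in> spectral_subspace A \<sigma> l \<and> b \<in> spectral_subspace A \<sigma> l})"

definition cstar_crystal :: "'b cstar \<Rightarrow> (real \<Rightarrow> 'b \<Rightarrow> 'b) \<Rightarrow> 'b set cstar" where
  "cstar_crystal A \<sigma> =
     cs_quotient (cs_restrict A (spectral_subspace A \<sigma> 0)) (crystal_ideal A \<sigma>)"


section \<open>Operators on Hilbert spaces of functions\<close>

text \<open>Vectors are functions \<open>'k \<Rightarrow> complex\<close> with the pointwise linear structure; the inner product
  (linear in the first variable) is arbitrary. Operators vanish outside the carrier, so that equal
  operators are equal as functions.\<close>

type_synonym 'k vec = "'k \<Rightarrow> complex"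
type_synonym 'k opr = "'k vec \<Rightarrow> 'k vec"

record 'k hilb =
  hvecs :: "'k vec set"
  hip :: "'k vec \<Rightarrow> 'k vec \<Rightarrow> complex"

definition vzero :: "'k vec" where
  "vzero = (\<lambda>k. 0)"

definition vadd :: "'k vec \<Rightarrow> 'k vec \<Rightarrow> 'k vec" where
  "vadd x y = (\<lambda>k. x k + y k)"

definition vscale :: "complex \<Rightarrow> 'k vec \<Rightarrow> 'k vec" where
  "vscale c x = (\<lambda>k. c * x k)"

definition hnorm :: "'k hilb \<Rightarrow> 'k vec \<Rightarrow> real" where
  "hnorm H x = sqrt (Re (hip H x x))"

locale hilbert_space =
  fixes H :: "'k hilb"
  assumes zero_closed: "vzero \<in> hvecs H"
    and add_closed: "\<lbrakk>x \<in> hvecs H; y \<in> hvecs H\<rbrakk> \<Longrightarrow> vadd x y \<in> hvecs H"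
    and scale_closed: "x \<in> hvecs H \<Longrightarrow> vscale c x \<in> hvecs H"
    and ip_add: "\<lbrakk>x \<in> hvecs H; y \<in> hvecs H; z \<in> hvecs H\<rbrakk>
      \<Longrightarrow> hip H (vadd x y) z = hip H x z + hip H y z"
    and ip_scale: "\<lbrakk>x \<in> hvecs H; y \<in> hvecs H\<rbrakk> \<Longrightarrow> hip H (vscale c x) y = c * hip H x y"
    and ip_cnj: "\<lbrakk>x \<in> hvecs H; y \<in> hvecs H\<rbrakk> \<Longrightarrow> hip H y x = cnj (hip H x y)"
    and ip_pos: "\<lbrakk>x \<in> hvecs H; x \<noteq> vzero\<rbrakk> \<Longrightarrow> 0 < Re (hip H x x)"
    and complete: "\<lbrakk>\<And>n. X n \<in> hvecs H;
        \<And>e. 0 < e \<Longrightarrow> \<exists>M. \<forall>m\<ge>M. \<forall>n\<ge>M. hnorm H (vadd (X m) (vscale (-1) (X n))) < e\<rbrakk>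
      \<Longrightarrow> \<exists>x \<in> hvecs H. (\<lambda>n. hnorm H (vadd (X n) (vscale (-1) x))) \<longlonglongrightarrow> 0"

definition ozero :: "'k opr" where
  "ozero = (\<lambda>x. vzero)"

definition bounded_opr :: "'k hilb \<Rightarrow> 'k opr \<Rightarrow> bool" where
  "bounded_opr H T \<longleftrightarrow>
     (\<forall>x \<in> hvecs H. T x \<in> hvecs H) \<and>
     (\<forall>x. x \<notin> hvecs H \<longrightarrow> T x = vzero) \<and>
     (\<forall>x \<in> hvecs H. \<forall>y \<in> hvecs H. T (vadd x y) = vadd (T x) (T y)) \<and>
     (\<forall>x \<in> hvecs H. \<forall>c. T (vscale c x) = vscale c (T x)) \<and>
     (\<exists>C. \<forall>x \<in> hvecs H. hnorm H (T x) \<le> C * hnorm H x)"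

definition opr_norm :: "'k hilb \<Rightarrow> 'k opr \<Rightarrow> real" where
  "opr_norm H T = Sup {hnorm H (T x) | x. x \<in> hvecs H \<and> hnorm H x \<le> 1}"

definition opr_adj :: "'k hilb \<Rightarrow> 'k opr \<Rightarrow> 'k opr" where
  "opr_adj H T = (THE S. bounded_opr H S \<and>
     (\<forall>x \<in> hvecs H. \<forall>y \<in> hvecs H. hip H (T x) y = hip H x (S y)))"

definition partial_isometry :: "'k hilb \<Rightarrow> 'k opr \<Rightarrow> bool" where
  "partial_isometry H T \<longleftrightarrow> bounded_opr H T \<and> T \<circ> opr_adj H T \<circ> T = T"


section \<open>The universal C*-algebra of an inverse semigroup\<close>

type_synonym ('a, 'k) rep = "'k hilb \<times> ('a \<Rightarrow> 'k opr)"

definition is_rep :: "'a sgrp \<Rightarrow> ('a, 'k) rep \<Rightarrow> bool" where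
  "is_rep I = (\<lambda>(H, \<pi>).
     hilbert_space H \<and>
     (\<forall>g \<in> sg_carrier I. partial_isometry H (\<pi> g)) \<and>
     (\<forall>g \<in> sg_carrier I. \<forall>h \<in> sg_carrier I. \<pi> (sg_mult I g h) = \<pi> g \<circ> \<pi> h) \<and>
     (\<forall>g \<in> sg_carrier I. \<pi> (sg_inv I g) = opr_adj H (\<pi> g)) \<and>
     (\<forall>z. is_zero I z \<longrightarrow> \<pi> z = ozero))"

text \<open>The C*-algebra of all bounded families of operators indexed by the representations of \<open>I\<close> on
  Hilbert spaces of functions on \<open>'a\<close> (the product of the algebras of bounded operators). These
  representations are enough to see the universal norm: every representation is a direct sum of
  cyclic ones and a zero one, and if \<open>\<xi>\<close> is a cyclic vector of \<open>(H, \<pi>)\<close>, then assigning to \<open>\<eta>\<close> the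
  function \<open>g \<mapsto> \<langle>\<eta>, \<pi>(g)\<xi>\<rangle>\<close> is linear and injective and identifies \<open>H\<close> with a space of functions
  on the semigroup.\<close>

definition rep_families :: "'a sgrp \<Rightarrow> (('a, 'a) rep \<Rightarrow> 'a opr) cstar" where
  "rep_families I =
    \<lparr> cs_carrier = {a.
        (\<forall>r. is_rep I r \<longrightarrow> bounded_opr (fst r) (a r)) \<and>
        (\<forall>r. \<not> is_rep I r \<longrightarrow> a r = ozero) \<and>
        (\<exists>C. \<forall>r. is_rep I r \<longrightarrow> opr_norm (fst r) (a r) \<le> C)},
      cs_zero = (\<lambda>r. ozero),
      cs_add = (\<lambda>a b r x. vadd (a r x) (b r x)),
      cs_scale = (\<lambda>c a r x. vscale c (a r x)),
      cs_mult = (\<lambda>a b r. a r \<circ> b r),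
      cs_star = (\<lambda>a r. if is_rep I r then opr_adj (fst r) (a r) else ozero),
      cs_norm = (\<lambda>a. Sup {opr_norm (fst r) (a r) | r. is_rep I r}) \<rparr>"

definition univ_gen :: "'a sgrp \<Rightarrow> 'a \<Rightarrow> ('a, 'a) rep \<Rightarrow> 'a opr" where
  "univ_gen I g = (\<lambda>r. if is_rep I r then snd r g else ozero)"

text \<open>The \<^term>\<open>univ_gen I g\<close> are the generators \<open>v\<^sub>g\<close>. Up to zero they form a family closed under
  products and adjoints, so their closed linear span is the C*-algebra they generate.\<close>

definition C0star :: "'a sgrp \<Rightarrow> (('a, 'a) rep \<Rightarrow> 'a opr) cstar" where
  "C0star I = cs_restrict (rep_families I)
     (cs_closed_span (rep_families I) (univ_gen I ` sg_carrier I))"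

text \<open>The automorphism \<open>\<sigma>\<^sub>t\<close> is determined by its values on the generators.\<close>

definition scale_dynamics ::
    "'a sgrp \<Rightarrow> ('a \<Rightarrow> real) \<Rightarrow> real \<Rightarrow> (('a, 'a) rep \<Rightarrow> 'a opr) \<Rightarrow> (('a, 'a) rep \<Rightarrow> 'a opr)" where
  "scale_dynamics I N t = (THE \<theta>.
     \<theta> \<in> extensional (cs_carrier (C0star I)) \<and>
     cstar_iso (C0star I) (C0star I) \<theta> \<and>
     (\<forall>g \<in> nonzero I. \<theta> (univ_gen I g) =
        cs_scale (C0star I) (of_real (N g) powr (\<i> * of_real t)) (univ_gen I g)))"

end

theory Submission
  imports Defs "HOL-Library.Function_Algebras"
begin

text \<open>
  The norm of \<open>a = \<Sum> c\<^sub>g v\<^sub>g\<close> in \<open>C\<^sub>0\<^sup>*(I)\<close> is the supremum of \<open>f(a\<^sup>* a)\<^bsup>1/2\<^esup>\<close> over the states \<open>f\<close>,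
  that is, the normalized positive definite functions on \<open>I\<close> that vanish at zero: vectors in
  representations give states, and the GNS representation of a state lives on the reproducing kernel
  Hilbert space of \<open>(g, h) \<mapsto> f(h\<^sup>-\<^sup>1 g)\<close>, hence on functions on \<open>I\<close>.

  Let \<open>I\<^sub>1\<close> consist of the elements of scale 1 and of zero. Then \<open>I\<^sub>c\<close> is \<open>I\<^sub>1\<close> modulo the ideal
  \<open>I\<^sub>1 - I\<^sub>c\<close>, the fixed point algebra \<open>A\<^sub>0\<close> is the closed span of the \<open>v\<^sub>g\<close> with \<open>g \<in> I\<^sub>1\<close>, and \<open>J\<close> is
  the closed span of the \<open>v\<^sub>g\<close> with \<open>g \<in> I\<^sub>1 - I\<^sub>c\<close>. Two facts show that the norm of \<open>C\<^sub>0\<^sup>*(I\<^sub>c)\<close> is the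
  quotient norm of \<open>A\<^sub>0/J\<close>. First, a state of \<open>I\<^sub>c\<close>, extended by zero, is a state of \<open>I\<close> (a ground
  state). Second, \<open>J\<close> is generated by the commuting projections \<open>v\<^sub>p\<close> with \<open>p \<in> I\<^sub>1 - I\<^sub>c\<close> idempotent, so
  that vectors annihilated by finitely many of them and almost attaining the quotient norm of \<open>a\<close> exist;
  by compactness their states have a cluster point, which is a state of \<open>I\<^sub>c\<close>.
  Therefore \<open>v\<^sub>g \<mapsto> v\<^sub>g\<close> for \<open>g \<in> I\<^sub>c\<close>, \<open>v\<^sub>g \<mapsto> 0\<close> for \<open>g \<in> I\<^sub>1 - I\<^sub>c\<close> induces an isometric isomorphism
  \<open>A\<^sub>0/J \<cong> C\<^sub>0\<^sup>*(I\<^sub>c)\<close>, along which the C*-algebra axioms are transported to the quotient.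
\<close>


text \<open>States are described by inequalities each of which involves finitely many values of
  \<open>f\<close>. Such conditions survive pointwise limits, as the compactness argument requires,
  and can be compared coefficient by coefficient between \<open>I\<close> and its crystal. The link
  between \<open>Ec\<close> and the products
  \<open>A\<^sub>\<lambda> A\<^sub>\<lambda>\<^sup>*\<close> is this: a nonzero \<open>g\<close> of
  scale 1 lies outside \<open>Ic\<close> exactly if its range projection lies below
  \<open>h h\<^sup>-\<^sup>1\<close> for some \<open>h\<close> with \<open>N h > 1\<close>. Then
  \<open>v\<^sub>g = v\<^sub>h (v\<^sub>h\<^sup>* v\<^sub>g)\<close> lies in
  \<open>A\<^sub>\<lambda> A\<^sub>\<lambda>\<^sup>*\<close> for
  \<open>\<lambda> = ln (N h)\<close>. The delicate point is that a state extended by zero stays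
  positive. The matrix \<open>f (h\<^sup>-\<^sup>1 g)\<close> splits into blocks of equal scale. A
  block cannot in general be carried into \<open>I\<^sub>1\<close> by a single translation, because
  its elements may have different range projections; these are split off one at a time, and on each
  piece the translates \<open>k\<^sup>-\<^sup>1 g\<close> do lie in
  \<open>I\<^sub>1\<close>.\<close>

text \<open>Higher-order unification produces eta-expanded terms, which the pointwise rules would rewrite
  below the abstraction.\<close>

lemmas fun_apply = plus_fun_apply zero_fun_apply minus_apply uminus_apply

declare fun_apply [simp del]

text \<open>Instances at operator type, so that evaluation stops at the vector and does not go on to
  its coordinates.\<close>

lemma opr_apply:
  fixes S T :: "'k opr"
  shows "(S + T) x = S x + T x" "(0 :: 'k opr) x = 0" "(S - T) x = S x - T x" "(- S) x = - S x"
  by (simp_all add: fun_apply)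

lemma sum_fun_apply: "(\<Sum>i\<in>S. F i) x = (\<Sum>i\<in>S. F i x)"
  for F :: "'i \<Rightarrow> 'x \<Rightarrow> 'y::comm_monoid_add"
  by (induction S rule: infinite_finite_induct) (auto simp: fun_apply)

lemma vadd_eq: "vadd x y = x + y" and vzero_eq: "vzero = 0"
  by (auto simp: vadd_def vzero_def fun_eq_iff fun_apply)

lemma vscale_apply: "vscale c x k = c * x k"
  by (simp add: vscale_def)

lemma vscale_simps [simp]:
  "vscale 1 x = x" "vscale 0 x = 0" "vscale c 0 = 0"
  "vscale c (vscale d x) = vscale (c * d) x" "vscale c (- x) = - vscale c x" "vscale (- c) x = - vscale c x"
  by (auto simp: vscale_def fun_eq_iff fun_apply)

lemma vscale_add: "vscale c (x + y) = vscale c x + vscale c y"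
  and vscale_diff: "vscale c (x - y) = vscale c x - vscale c y"
  by (auto simp: vscale_def fun_eq_iff fun_apply algebra_simps)


section \<open>Hilbert spaces of functions\<close>

text \<open>The inner product calculus is separated from completeness because the GNS space is
  reached through an incomplete space, the span of the kernel functions. The axioms are restated
  with the arithmetic of the function type.\<close>

locale prehilbert =
  fixes H :: "'k hilb"
  assumes zero_mem: "0 \<in> hvecs H"
    and add_mem: "\<lbrakk>x \<in> hvecs H; y \<in> hvecs H\<rbrakk> \<Longrightarrow> x + y \<in> hvecs H"
    and vscale_mem: "x \<in> hvecs H \<Longrightarrow> vscale c x \<in> hvecs H"
    and ip_add_left: "\<lbrakk>x \<in> hvecs H; y \<in> hvecs H; z \<in> hvecs H\<rbrakk>
      \<Longrightarrow> hip H (x + y) z = hip H x z + hip H y z"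
    and ip_vscale_left: "\<lbrakk>x \<in> hvecs H; y \<in> hvecs H\<rbrakk> \<Longrightarrow> hip H (vscale c x) y = c * hip H x y"
    and ip_commute: "\<lbrakk>x \<in> hvecs H; y \<in> hvecs H\<rbrakk> \<Longrightarrow> hip H y x = cnj (hip H x y)"
    and ip_self_pos: "\<lbrakk>x \<in> hvecs H; x \<noteq> 0\<rbrakk> \<Longrightarrow> 0 < Re (hip H x x)"
begin

abbreviation ip where "ip \<equiv> hip H"
abbreviation nrm where "nrm \<equiv> hnorm H"

lemma uminus_mem: "x \<in> hvecs H \<Longrightarrow> - x \<in> hvecs H"
  using vscale_mem[of x "-1"] by simp

lemma diff_mem: "\<lbrakk>x \<in> hvecs H; y \<in> hvecs H\<rbrakk> \<Longrightarrow> x - y \<in> hvecs H"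
  using add_mem[of x "- y"] uminus_mem by simp

lemma sum_mem: "(\<And>i. i \<in> S \<Longrightarrow> F i \<in> hvecs H) \<Longrightarrow> sum F S \<in> hvecs H"
  by (induction S rule: infinite_finite_induct) (auto intro: zero_mem add_mem)

lemmas mem = zero_mem add_mem vscale_mem uminus_mem diff_mem sum_mem

lemma ip_zero_left: "y \<in> hvecs H \<Longrightarrow> ip 0 y = 0"
  using ip_vscale_left[of y y 0] by simp

lemma ip_zero_right: "y \<in> hvecs H \<Longrightarrow> ip y 0 = 0"
  using ip_commute[of 0 y] ip_zero_left zero_mem by simp

lemma ip_add_right: "\<lbrakk>x \<in> hvecs H; y \<in> hvecs H; z \<in> hvecs H\<rbrakk> \<Longrightarrow> ip z (x + y) = ip z x + ip z y"
  by (metis add_mem complex_cnj_add ip_add_left ip_commute)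

lemma ip_vscale_right: "\<lbrakk>x \<in> hvecs H; y \<in> hvecs H\<rbrakk> \<Longrightarrow> ip y (vscale c x) = cnj c * ip y x"
  by (metis complex_cnj_mult ip_commute ip_vscale_left vscale_mem)

lemma ip_uminus_left: "\<lbrakk>x \<in> hvecs H; y \<in> hvecs H\<rbrakk> \<Longrightarrow> ip (- x) y = - ip x y"
  using ip_vscale_left[of x y "-1"] by simp

lemma ip_uminus_right: "\<lbrakk>x \<in> hvecs H; y \<in> hvecs H\<rbrakk> \<Longrightarrow> ip y (- x) = - ip y x"
  using ip_vscale_right[of x y "-1"] by simp

lemma ip_diff_left: "\<lbrakk>x \<in> hvecs H; y \<in> hvecs H; z \<in> hvecs H\<rbrakk> \<Longrightarrow> ip (x - y) z = ip x z - ip y z"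
  using ip_add_left[of x "- y" z] by (simp add: ip_uminus_left uminus_mem)

lemma ip_diff_right: "\<lbrakk>x \<in> hvecs H; y \<in> hvecs H; z \<in> hvecs H\<rbrakk> \<Longrightarrow> ip z (x - y) = ip z x - ip z y"
  using ip_add_right[of x "- y" z] by (simp add: ip_uminus_right uminus_mem)

lemma ip_sum_left:
  "\<lbrakk>\<And>i. i \<in> S \<Longrightarrow> F i \<in> hvecs H; y \<in> hvecs H\<rbrakk> \<Longrightarrow> ip (sum F S) y = (\<Sum>i\<in>S. ip (F i) y)"
  by (induction S rule: infinite_finite_induct) (auto simp: ip_zero_left ip_add_left sum_mem)

lemma ip_sum_right:
  "\<lbrakk>\<And>i. i \<in> S \<Longrightarrow> F i \<in> hvecs H; y \<in> hvecs H\<rbrakk> \<Longrightarrow> ip y (sum F S) = (\<Sum>i\<in>S. ip y (F i))"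
  by (induction S rule: infinite_finite_induct) (auto simp: ip_zero_right ip_add_right sum_mem)

lemma ip_sum_sum:
  assumes F: "\<And>i. i \<in> S \<Longrightarrow> F i \<in> hvecs H" and G: "\<And>j. j \<in> T \<Longrightarrow> G j \<in> hvecs H"
  shows "ip (\<Sum>i\<in>S. vscale (c i) (F i)) (\<Sum>j\<in>T. vscale (d j) (G j)) =
    (\<Sum>i\<in>S. \<Sum>j\<in>T. c i * cnj (d j) * ip (F i) (G j))"
proof -
  define w where "w = (\<Sum>j\<in>T. vscale (d j) (G j))"
  have w: "w \<in> hvecs H" unfolding w_def by (intro sum_mem vscale_mem G)
  have "ip (F i) w = (\<Sum>j\<in>T. cnj (d j) * ip (F i) (G j))" if "i \<in> S" for i
    using F[OF that] G unfolding w_def by (simp add: ip_sum_right vscale_mem ip_vscale_right)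
  thus ?thesis
    unfolding w_def[symmetric] using F w
    by (simp add: ip_sum_left vscale_mem ip_vscale_left sum_distrib_left mult.assoc)
qed

lemmas ip_simps = ip_zero_left ip_zero_right ip_add_left ip_add_right ip_diff_left ip_diff_right
  ip_vscale_left ip_vscale_right ip_uminus_left ip_uminus_right

lemma Im_ip_self: "x \<in> hvecs H \<Longrightarrow> Im (ip x x) = 0"
  using ip_commute[of x x] by (simp add: complex_eq_iff)

lemma Re_ip_self_nonneg: "x \<in> hvecs H \<Longrightarrow> 0 \<le> Re (ip x x)"
  using ip_self_pos[of x] ip_zero_left[of 0] zero_mem by (cases "x = 0") (auto simp: less_imp_le)

lemma hnorm_sq: "x \<in> hvecs H \<Longrightarrow> (nrm x)\<^sup>2 = Re (ip x x)"
  by (simp add: hnorm_def Re_ip_self_nonneg)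

lemma ip_self: "x \<in> hvecs H \<Longrightarrow> ip x x = of_real ((nrm x)\<^sup>2)"
  by (simp add: complex_eq_iff hnorm_sq Im_ip_self del: of_real_power)

lemma hnorm_nonneg: "x \<in> hvecs H \<Longrightarrow> 0 \<le> nrm x"
  by (simp add: hnorm_def Re_ip_self_nonneg)

lemma hnorm_zero: "nrm 0 = 0"
  by (simp add: hnorm_def ip_zero_left zero_mem)

lemma hnorm_eq_zero: "x \<in> hvecs H \<Longrightarrow> nrm x = 0 \<longleftrightarrow> x = 0"
  using ip_self_pos[of x] hnorm_zero by (cases "x = 0") (auto simp: hnorm_def)

lemma hnorm_vscale: assumes "x \<in> hvecs H" shows "nrm (vscale c x) = cmod c * nrm x"
proof -
  have "ip (vscale c x) (vscale c x) = of_real ((cmod c)\<^sup>2) * ip x x"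
    using assms complex_norm_square[of c] by (simp add: ip_simps vscale_mem mult_ac)
  hence "Re (ip (vscale c x) (vscale c x)) = (cmod c)\<^sup>2 * Re (ip x x)"
    using Im_ip_self[OF assms] by (simp del: of_real_power)
  thus ?thesis by (simp add: hnorm_def real_sqrt_mult)
qed

lemma hnorm_uminus: "x \<in> hvecs H \<Longrightarrow> nrm (- x) = nrm x"
  using hnorm_vscale[of x "-1"] by simp

lemma hnorm_minus_commute: "\<lbrakk>x \<in> hvecs H; y \<in> hvecs H\<rbrakk> \<Longrightarrow> nrm (x - y) = nrm (y - x)"
  using hnorm_uminus[of "x - y"] by (simp add: diff_mem)

lemma cauchy_schwarz:
  assumes x: "x \<in> hvecs H" and y: "y \<in> hvecs H"
  shows "cmod (ip x y) \<le> nrm x * nrm y"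
proof (cases "y = 0")
  case True thus ?thesis using x by (simp add: ip_zero_right hnorm_zero)
next
  case False
  let ?b = "(nrm y)\<^sup>2" and ?c = "ip x y"
  have b: "0 < ?b" using ip_self_pos[OF y False] hnorm_sq[OF y] by simp
  \<comment> \<open>Up to the factor \<open>?b\<close>, this is the component of \<open>x\<close>
    orthogonal to \<open>y\<close>; the factor clears the denominator.\<close>
  define z where "z = vscale (of_real ?b) x - vscale ?c y"
  have z: "z \<in> hvecs H" using x y by (simp add: z_def mem)
  have "ip z z = of_real ?b * of_real ?b * ip x x - of_real ?b * cnj ?c * ?c - ?c * of_real ?b * ip y x + ?c * cnj ?c * ip y y"
    unfolding z_def using x y by (simp add: ip_simps mem algebra_simps)
  also have "\<dots> = of_real (?b * (?b * (nrm x)\<^sup>2 - (cmod ?c)\<^sup>2))"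
    using ip_self[OF x] ip_self[OF y] ip_commute[OF x y] complex_norm_square[of ?c]
    by (simp add: algebra_simps)
  finally have "0 \<le> ?b * (?b * (nrm x)\<^sup>2 - (cmod ?c)\<^sup>2)"
    using Re_ip_self_nonneg[OF z] by (metis Re_complex_of_real)
  hence "(cmod ?c)\<^sup>2 \<le> (nrm x * nrm y)\<^sup>2"
    using b by (simp add: zero_le_mult_iff power_mult_distrib mult.commute)
  thus ?thesis
    by (rule power2_le_imp_le) (simp add: hnorm_nonneg x y)
qed

lemma hnorm_add_sq: "\<lbrakk>x \<in> hvecs H; y \<in> hvecs H\<rbrakk>
   \<Longrightarrow> (nrm (x + y))\<^sup>2 = (nrm x)\<^sup>2 + (nrm y)\<^sup>2 + 2 * Re (ip x y)"
  using ip_commute[of x y] by (simp add: hnorm_sq mem ip_simps)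

lemma hnorm_diff_sq: "\<lbrakk>x \<in> hvecs H; y \<in> hvecs H\<rbrakk>
   \<Longrightarrow> (nrm (x - y))\<^sup>2 = (nrm x)\<^sup>2 + (nrm y)\<^sup>2 - 2 * Re (ip x y)"
  using ip_commute[of x y] by (simp add: hnorm_sq mem ip_simps)

lemma hnorm_triangle:
  assumes "x \<in> hvecs H" "y \<in> hvecs H"
  shows "nrm (x + y) \<le> nrm x + nrm y"
proof (rule power2_le_imp_le)
  have "Re (ip x y) \<le> nrm x * nrm y"
    using cauchy_schwarz[OF assms] complex_Re_le_cmod order_trans by blast
  thus "(nrm (x + y))\<^sup>2 \<le> (nrm x + nrm y)\<^sup>2"
    using assms by (simp add: hnorm_add_sq power2_sum)
qed (simp add: assms hnorm_nonneg)

lemma hnorm_triangle_diff: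
  assumes "x \<in> hvecs H" "y \<in> hvecs H" "z \<in> hvecs H"
  shows "nrm (x - z) \<le> nrm (x - y) + nrm (y - z)"
  using hnorm_triangle[of "x - y" "y - z"] assms by (simp add: diff_mem)

lemma hnorm_reverse_triangle:
  assumes "x \<in> hvecs H" "y \<in> hvecs H"
  shows "\<bar>nrm x - nrm y\<bar> \<le> nrm (x - y)"
  using hnorm_triangle[of "x - y" y] hnorm_triangle[of "y - x" x] assms
  by (simp add: mem hnorm_minus_commute[of x y])

lemma ip_eq_zero_imp: "\<lbrakk>x \<in> hvecs H; \<And>y. y \<in> hvecs H \<Longrightarrow> ip x y = 0\<rbrakk> \<Longrightarrow> x = 0"
  using ip_self_pos[of x] by fastforce

lemma ip_left_cong_imp:
  assumes "x \<in> hvecs H" "x' \<in> hvecs H" "\<And>y. y \<in> hvecs H \<Longrightarrow> ip x y = ip x' y"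
  shows "x = x'"
  using ip_eq_zero_imp[of "x - x'"] assms by (simp add: ip_simps mem)

lemma ip_right_cong_imp:
  assumes "x \<in> hvecs H" "x' \<in> hvecs H" "\<And>y. y \<in> hvecs H \<Longrightarrow> ip y x = ip y x'"
  shows "x = x'"
  using assms ip_left_cong_imp[of x x'] by (metis ip_commute)

end

sublocale hilbert_space \<subseteq> prehilbert H
  by unfold_locales
    (fact zero_closed[unfolded vzero_eq] add_closed[unfolded vadd_eq] scale_closed
      ip_add[unfolded vadd_eq] ip_scale ip_cnj ip_pos[unfolded vzero_eq])+

context hilbert_space
begin

lemma cauchy_limit:
  assumes "\<And>n. X n \<in> hvecs H"
    and "\<And>e. 0 < e \<Longrightarrow> \<exists>M. \<forall>m\<ge>M. \<forall>n\<ge>M. nrm (X m - X n) < e"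
  shows "\<exists>x \<in> hvecs H. (\<lambda>n. nrm (X n - x)) \<longlonglongrightarrow> 0"
  using complete[of X] assms by (simp add: vadd_eq)

lemma hnorm_tendsto:
  assumes "\<And>n. X n \<in> hvecs H" "x \<in> hvecs H" "(\<lambda>n. nrm (X n - x)) \<longlonglongrightarrow> 0"
  shows "(\<lambda>n. nrm (X n)) \<longlonglongrightarrow> nrm x"
proof -
  have "(\<lambda>n. nrm (X n) - nrm x) \<longlonglongrightarrow> 0"
    by (rule Lim_null_comparison[OF _ assms(3)]) (simp add: hnorm_reverse_triangle assms)
  thus ?thesis by (simp add: LIM_zero_iff)
qed

text \<open>Variational proof: the representing vector minimizes \<open>\<parallel>x\<parallel>\<^sup>2 - 2 Re \<phi>(x)\<close>.\<close>

theorem riesz: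
  assumes add: "\<And>x y. \<lbrakk>x \<in> hvecs H; y \<in> hvecs H\<rbrakk> \<Longrightarrow> \<phi> (x + y) = \<phi> x + \<phi> y"
    and scale: "\<And>x c. x \<in> hvecs H \<Longrightarrow> \<phi> (vscale c x) = c * \<phi> x"
    and bound: "\<And>x. x \<in> hvecs H \<Longrightarrow> cmod (\<phi> x) \<le> C * nrm x"
  shows "\<exists>y \<in> hvecs H. \<forall>x \<in> hvecs H. \<phi> x = ip x y"
proof -
  define J where "J x = (nrm x)\<^sup>2 - 2 * Re (\<phi> x)" for x
  have Re_bound: "Re (\<phi> x) \<le> C * nrm x" if "x \<in> hvecs H" for x
    using bound[OF that] complex_Re_le_cmod order_trans by blast
  have J_lower: "- C\<^sup>2 \<le> J x" if "x \<in> hvecs H" for x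
    using Re_bound[OF that] zero_le_power2[of "nrm x - C"] by (simp add: J_def power2_diff algebra_simps)
  define m where "m = Inf (J ` hvecs H)"
  have bdd: "bdd_below (J ` hvecs H)" using J_lower by (auto intro!: bdd_belowI)
  have m_le: "m \<le> J x" if "x \<in> hvecs H" for x
    unfolding m_def using bdd that by (simp add: cInf_lower)
  have "\<exists>x \<in> hvecs H. J x < m + 1 / real (Suc n)" for n
    using cInf_lessD[of "J ` hvecs H" "m + 1 / real (Suc n)"] zero_mem by (auto simp: m_def)
  then obtain X where X: "\<And>n. X n \<in> hvecs H" and JX: "\<And>n. J (X n) < m + 1 / real (Suc n)"
    by metis
  \<comment> \<open>The parallelogram law, combined with \<open>J \<ge> m\<close> at the midpoint,
    shows that near-minimizers are close to each other, so that a minimizing sequence is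
    Cauchy.\<close>
  have par: "(nrm (x - y))\<^sup>2 \<le> 2 * (J x - m) + 2 * (J y - m)" if x: "x \<in> hvecs H" and y: "y \<in> hvecs H" for x y
  proof -
    have "4 * m \<le> 4 * J (vscale (1/2) (x + y))" using m_le x y by (simp add: mem)
    also have "\<dots> = (nrm (x + y))\<^sup>2 - 4 * Re (\<phi> x + \<phi> y)"
    proof -
      have "(nrm (vscale (1/2) (x + y)))\<^sup>2 = (nrm (x + y))\<^sup>2 / 4"
        by (subst hnorm_vscale) (use x y in \<open>auto simp: mem power_divide norm_divide\<close>)
      moreover have "\<phi> (vscale (1/2) (x + y)) = (\<phi> x + \<phi> y) / 2"
        using x y by (simp only: scale add mem) simp
      hence "Re (\<phi> (vscale (1/2) (x + y))) = (Re (\<phi> x) + Re (\<phi> y)) / 2"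
        by (metis Re_divide_numeral plus_complex.sel(1))
      ultimately show ?thesis unfolding J_def by simp
    qed
    finally have "4 * m \<le> (nrm (x + y))\<^sup>2 - 4 * (Re (\<phi> x) + Re (\<phi> y))" by simp
    thus ?thesis
      unfolding J_def hnorm_add_sq[OF x y] hnorm_diff_sq[OF x y] by (simp add: algebra_simps)
  qed
  have cauchy: "\<exists>M. \<forall>i\<ge>M. \<forall>j\<ge>M. nrm (X i - X j) < e" if e: "0 < e" for e
  proof -
    obtain M where "4 / e\<^sup>2 < real M" using reals_Archimedean2 by blast
    hence M: "4 / e\<^sup>2 < real (Suc M)" by simp
    have "nrm (X i - X j) < e" if "M \<le> i" "M \<le> j" for i j
    proof -
      have le: "1 / real (Suc k) \<le> 1 / real (Suc M)" if "M \<le> k" for k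
        using that by (simp add: frac_le)
      have "(nrm (X i - X j))\<^sup>2 < 2 * (1 / real (Suc i)) + 2 * (1 / real (Suc j))"
        using par[OF X[of i] X[of j]] JX[of i] JX[of j] by argo
      also have "\<dots> \<le> 4 * (1 / real (Suc M))" using le[OF that(1)] le[OF that(2)] by argo
      also have "\<dots> < e\<^sup>2" using M e by (simp add: field_simps)
      finally show ?thesis using e by (simp add: power_less_imp_less_base)
    qed
    thus ?thesis by blast
  qed
  obtain y where y: "y \<in> hvecs H" and lim: "(\<lambda>n. nrm (X n - y)) \<longlonglongrightarrow> 0"
    using cauchy_limit[of X, OF X cauchy] by blast
  have Jlim: "(\<lambda>n. J (X n)) \<longlonglongrightarrow> J y"
  proof -
    have "(\<lambda>n. \<phi> (X n) - \<phi> y) \<longlonglongrightarrow> 0"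
    proof (rule Lim_null_comparison[OF _ tendsto_mult_right_zero[OF lim, of C]])
      have "\<phi> (X n) - \<phi> y = \<phi> (X n - y)" for n
        using add[of "X n - y" y] X y by (simp add: mem)
      thus "\<forall>\<^sub>F n in sequentially. cmod (\<phi> (X n) - \<phi> y) \<le> C * nrm (X n - y)"
        using bound X y by (simp add: mem)
    qed
    hence "(\<lambda>n. \<phi> (X n)) \<longlonglongrightarrow> \<phi> y" by (simp add: LIM_zero_iff)
    thus ?thesis unfolding J_def
      by (intro tendsto_intros hnorm_tendsto[OF X y lim])
  qed
  have "(\<lambda>n. m + 1 / real (Suc n)) \<longlonglongrightarrow> m + 0"
    by (intro tendsto_intros LIMSEQ_Suc[OF lim_1_over_n])
  moreover have "\<exists>K. \<forall>n\<ge>K. J (X n) \<le> m + 1 / real (Suc n)"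
    using JX by (intro exI[of _ 0]) (auto intro: less_imp_le)
  ultimately have Jy: "J y \<le> m"
    using LIMSEQ_le[OF Jlim] by simp
  \<comment> \<open>At a minimum the first variation vanishes: the linear coefficient
    \<open>d\<close> of \<open>t\<close> in \<open>J (y + t h) - J y\<close> must be 0.\<close>
  have Re_zero: "Re (ip h y - \<phi> h) = 0" if h: "h \<in> hvecs H" for h
  proof -
    define d where "d = Re (ip h y - \<phi> h)"
    have q: "0 \<le> t\<^sup>2 * (nrm h)\<^sup>2 + 2 * t * d" for t
    proof -
      have "J y \<le> J (y + vscale (of_real t) h)" using Jy m_le[of "y + vscale (of_real t) h"] y h by (simp add: mem)
      thus ?thesis using y h ip_commute[OF y h]
        by (simp add: J_def hnorm_add_sq hnorm_vscale add scale mem ip_simps power_mult_distrib d_def algebra_simps)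
    qed
    show ?thesis
    proof (rule ccontr)
      assume "Re (ip h y - \<phi> h) \<noteq> 0"
      hence d: "d \<noteq> 0" by (simp add: d_def)
      \<comment> \<open>The parabola has its minimum at \<open>- d / (nrm h)\<^sup>2\<close>; adding
        1 makes the denominator positive even for \<open>h = 0\<close> and still gives a negative
        value.\<close>
      define s where "s = (nrm h)\<^sup>2 + 1"
      have s: "0 < s" by (simp add: s_def add_nonneg_pos)
      have "0 \<le> (d / s)\<^sup>2 * (nrm h)\<^sup>2 - 2 * (d / s) * d" using q[of "- d / s"] by simp
      also have "\<dots> \<le> (d / s)\<^sup>2 * s - 2 * (d / s) * d"
        by (intro diff_right_mono mult_left_mono) (auto simp: s_def)
      also have "\<dots> = - (d\<^sup>2 / s)" using s by (simp add: power2_eq_square field_simps)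
      finally show False using s d by (simp add: divide_le_0_iff)
    qed
  qed
  have "\<phi> x = ip x y" if x: "x \<in> hvecs H" for x
  proof -
    \<comment> \<open>The real part at \<open>\<i> x\<close> is, up to sign, the imaginary part at
      \<open>x\<close>.\<close>
    have "Re (ip x y - \<phi> x) = 0" "Re (ip (vscale \<i> x) y - \<phi> (vscale \<i> x)) = 0"
      using Re_zero x by (auto simp: mem)
    thus ?thesis using x y by (simp add: scale ip_simps complex_eq_iff)
  qed
  thus ?thesis using y by blast
qed

section \<open>Bounded operators and the operator norm\<close>

lemma bounded_oprD:
  assumes "bounded_opr H T"
  shows opr_mem: "x \<in> hvecs H \<Longrightarrow> T x \<in> hvecs H"
    and opr_outside: "x \<notin> hvecs H \<Longrightarrow> T x = 0"
    and opr_add: "\<lbrakk>x \<in> hvecs H; y \<in> hvecs H\<rbrakk> \<Longrightarrow> T (x + y) = T x + T y"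
    and opr_vscale: "x \<in> hvecs H \<Longrightarrow> T (vscale c x) = vscale c (T x)"
    and opr_zero: "T 0 = 0"
proof -
  show "x \<in> hvecs H \<Longrightarrow> T (vscale c x) = vscale c (T x)" for x c
    using assms by (simp add: bounded_opr_def)
  from this[of 0 0] show "T 0 = 0" by (simp add: zero_mem)
qed (use assms in \<open>auto simp: bounded_opr_def vadd_eq vzero_eq\<close>)

lemma opr_diff: "\<lbrakk>bounded_opr H T; x \<in> hvecs H; y \<in> hvecs H\<rbrakk> \<Longrightarrow> T (x - y) = T x - T y"
  using opr_add[of T x "- y"] opr_vscale[of T y "-1"] by (simp add: mem)

lemma opr_sum: "\<lbrakk>bounded_opr H T; \<And>i. i \<in> S \<Longrightarrow> F i \<in> hvecs H\<rbrakk> \<Longrightarrow> T (sum F S) = (\<Sum>i\<in>S. T (F i))"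
  by (induction S rule: infinite_finite_induct) (auto simp: opr_zero opr_add sum_mem)

lemma bounded_oprI:
  assumes "\<And>x. x \<in> hvecs H \<Longrightarrow> T x \<in> hvecs H"
    and "\<And>x. x \<notin> hvecs H \<Longrightarrow> T x = 0"
    and "\<And>x y. \<lbrakk>x \<in> hvecs H; y \<in> hvecs H\<rbrakk> \<Longrightarrow> T (x + y) = T x + T y"
    and "\<And>x c. x \<in> hvecs H \<Longrightarrow> T (vscale c x) = vscale c (T x)"
    and "\<And>x. x \<in> hvecs H \<Longrightarrow> nrm (T x) \<le> C * nrm x"
  shows "bounded_opr H T"
  using assms unfolding bounded_opr_def vadd_eq vzero_eq by blast

lemma opr_bound: "bounded_opr H T \<Longrightarrow> \<exists>C\<ge>0. \<forall>x \<in> hvecs H. nrm (T x) \<le> C * nrm x"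
proof -
  assume "bounded_opr H T"
  then obtain C where C: "\<forall>x \<in> hvecs H. nrm (T x) \<le> C * nrm x" by (auto simp: bounded_opr_def)
  have "nrm (T x) \<le> \<bar>C\<bar> * nrm x" if "x \<in> hvecs H" for x
    using C that by (meson abs_ge_self hnorm_nonneg mult_right_mono order_trans)
  thus ?thesis by (intro exI[of _ "\<bar>C\<bar>"]) auto
qed

lemma opr_norm_bdd:
  assumes "bounded_opr H T"
  shows "bdd_above {nrm (T x) | x. x \<in> hvecs H \<and> nrm x \<le> 1}"
proof -
  obtain C where "C \<ge> 0" "\<forall>x \<in> hvecs H. nrm (T x) \<le> C * nrm x" using opr_bound[OF assms] by blast
  hence "\<forall>x \<in> hvecs H. nrm x \<le> 1 \<longrightarrow> nrm (T x) \<le> C"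
    by (meson mult_left_le order_trans)
  thus ?thesis by (auto intro!: bdd_aboveI[of _ C])
qed

lemma opr_norm_nonneg: "bounded_opr H T \<Longrightarrow> 0 \<le> opr_norm H T"
  unfolding opr_norm_def
  by (rule cSup_upper2[OF _ _ opr_norm_bdd, of "nrm (T 0)"])
     (auto simp: opr_zero hnorm_zero intro!: exI[of _ 0] zero_mem)

lemma opr_norm_le:
  assumes "\<And>x. x \<in> hvecs H \<Longrightarrow> nrm x \<le> 1 \<Longrightarrow> nrm (T x) \<le> C"
  shows "opr_norm H T \<le> C"
  unfolding opr_norm_def
  by (rule cSup_least) (use assms zero_mem hnorm_zero in \<open>auto intro!: exI[of _ 0]\<close>)

lemma hnorm_opr_le_unit: "\<lbrakk>bounded_opr H T; x \<in> hvecs H; nrm x \<le> 1\<rbrakk> \<Longrightarrow> nrm (T x) \<le> opr_norm H T"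
  unfolding opr_norm_def by (rule cSup_upper[OF _ opr_norm_bdd]) auto

lemma hnorm_opr_le:
  assumes T: "bounded_opr H T" and x: "x \<in> hvecs H"
  shows "nrm (T x) \<le> opr_norm H T * nrm x"
proof (cases "x = 0")
  case True thus ?thesis by (simp add: opr_zero[OF T] hnorm_zero)
next
  case False
  hence pos: "0 < nrm x" using hnorm_nonneg[OF x] hnorm_eq_zero[OF x] by simp
  have "nrm (T (vscale (of_real (1 / nrm x)) x)) \<le> opr_norm H T"
    using hnorm_opr_le_unit[OF T, of "vscale (of_real (1 / nrm x)) x"] pos x
    by (simp add: mem hnorm_vscale norm_divide)
  thus ?thesis using pos x opr_mem[OF T x]
    by (simp add: opr_vscale[OF T] hnorm_vscale norm_divide field_simps)
qed

lemma bounded_opr_zero: "bounded_opr H 0"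
  by (rule bounded_oprI[of _ 0]) (auto simp: opr_apply mem hnorm_zero)

lemma bounded_opr_add: assumes "bounded_opr H S" "bounded_opr H T" shows "bounded_opr H (S + T)"
  by (rule bounded_oprI[of _ "opr_norm H S + opr_norm H T"])
     (use assms in \<open>auto simp: opr_apply opr_mem opr_outside opr_add opr_vscale vscale_add mem distrib_right
        intro!: order_trans[OF hnorm_triangle] add_mono hnorm_opr_le\<close>)

lemma bounded_opr_vscale: assumes "bounded_opr H T" shows "bounded_opr H (\<lambda>x. vscale c (T x))"
  by (rule bounded_oprI[of _ "cmod c * opr_norm H T"])
     (use assms in \<open>auto simp: opr_mem opr_outside opr_add opr_vscale vscale_add mem hnorm_vscale mult.assoc mult.commute[of c]
        intro!: mult_left_mono hnorm_opr_le\<close>)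

lemma hnorm_opr_comp_le:
  assumes "bounded_opr H S" "bounded_opr H T" "x \<in> hvecs H"
  shows "nrm (S (T x)) \<le> opr_norm H S * opr_norm H T * nrm x"
proof -
  have "nrm (S (T x)) \<le> opr_norm H S * nrm (T x)" using assms by (simp add: hnorm_opr_le opr_mem)
  also have "\<dots> \<le> opr_norm H S * (opr_norm H T * nrm x)"
    using assms by (simp add: hnorm_opr_le mult_left_mono opr_norm_nonneg)
  finally show ?thesis by (simp add: mult.assoc)
qed

lemma bounded_opr_comp: assumes "bounded_opr H S" "bounded_opr H T" shows "bounded_opr H (S \<circ> T)"
  by (rule bounded_oprI[of _ "opr_norm H S * opr_norm H T"])
     (use assms hnorm_opr_comp_le in \<open>auto simp: opr_mem opr_outside opr_add opr_vscale opr_zero\<close>)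

section \<open>Adjoints and the C*-identity\<close>

lemma opr_adj_unique:
  assumes "bounded_opr H S" "bounded_opr H S'"
    and "\<And>x y. \<lbrakk>x \<in> hvecs H; y \<in> hvecs H\<rbrakk> \<Longrightarrow> ip x (S y) = ip x (S' y)"
  shows "S = S'"
proof
  fix y show "S y = S' y"
    using assms by (cases "y \<in> hvecs H") (auto simp: opr_outside opr_mem intro: ip_right_cong_imp)
qed

text \<open>The value of the adjoint at \<open>y\<close> is the Riesz vector of the functional that
  takes \<open>x\<close> to \<open>ip (T x) y\<close>. Uniqueness of that vector gives linearity,
  and \<open>(nrm (S x))\<^sup>2 = ip (T (S x)) x\<close> gives the bound.\<close>

lemma opr_adj_exists:
  assumes T: "bounded_opr H T"
  shows "\<exists>!S. bounded_opr H S \<and> (\<forall>x \<in> hvecs H. \<forall>y \<in> hvecs H. ip (T x) y = ip x (S y))"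
proof (rule ex_ex1I)
  have "\<exists>z \<in> hvecs H. \<forall>x \<in> hvecs H. ip (T x) y = ip x z" if y: "y \<in> hvecs H" for y
  proof (rule riesz[where C = "opr_norm H T * nrm y"])
    fix x assume x: "x \<in> hvecs H"
    have "cmod (ip (T x) y) \<le> nrm (T x) * nrm y" using T x y by (simp add: opr_mem cauchy_schwarz)
    also have "\<dots> \<le> (opr_norm H T * nrm x) * nrm y" using T x y by (intro mult_right_mono hnorm_opr_le hnorm_nonneg)
    finally show "cmod (ip (T x) y) \<le> opr_norm H T * nrm y * nrm x" by (simp add: mult_ac)
  qed (use T y in \<open>auto simp: opr_add opr_vscale opr_mem ip_simps\<close>)
  then obtain S0 where S0: "\<And>y. y \<in> hvecs H \<Longrightarrow> S0 y \<in> hvecs H"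
      "\<And>x y. \<lbrakk>x \<in> hvecs H; y \<in> hvecs H\<rbrakk> \<Longrightarrow> ip (T x) y = ip x (S0 y)"
    by metis
  define S where "S y = (if y \<in> hvecs H then S0 y else 0)" for y
  have S: "\<And>y. y \<in> hvecs H \<Longrightarrow> S y \<in> hvecs H"
      "\<And>x y. \<lbrakk>x \<in> hvecs H; y \<in> hvecs H\<rbrakk> \<Longrightarrow> ip (T x) y = ip x (S y)"
    using S0 by (auto simp: S_def)
  have "bounded_opr H S"
  proof (rule bounded_oprI[of _ "opr_norm H T"])
    fix x y assume xy: "x \<in> hvecs H" "y \<in> hvecs H"
    show "S (x + y) = S x + S y"
    proof (rule ip_right_cong_imp)
      fix z assume z: "z \<in> hvecs H"
      have "ip z (S (x + y)) = ip (T z) (x + y)" using S(2)[OF z, of "x + y"] xy by (simp add: mem)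
      also have "\<dots> = ip z (S x + S y)" using xy z S T by (simp add: ip_simps opr_mem)
      finally show "ip z (S (x + y)) = ip z (S x + S y)" .
    qed (use xy S(1) in \<open>auto simp: mem\<close>)
  next
    fix x c assume x: "x \<in> hvecs H"
    show "S (vscale c x) = vscale c (S x)"
    proof (rule ip_right_cong_imp)
      fix z assume z: "z \<in> hvecs H"
      have "ip z (S (vscale c x)) = ip (T z) (vscale c x)" using S(2)[OF z, of "vscale c x"] x by (simp add: mem)
      also have "\<dots> = ip z (vscale c (S x))" using x z S T by (simp add: ip_simps opr_mem)
      finally show "ip z (S (vscale c x)) = ip z (vscale c (S x))" .
    qed (use x S(1) in \<open>auto simp: mem\<close>)
    show "nrm (S x) \<le> opr_norm H T * nrm x"
    proof (cases "nrm (S x) = 0")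
      case True thus ?thesis using T x by (simp add: opr_norm_nonneg hnorm_nonneg)
    next
      case False
      have "(nrm (S x))\<^sup>2 = Re (ip (T (S x)) x)" using S x by (simp add: hnorm_sq)
      also have "\<dots> \<le> cmod (ip (T (S x)) x)" by (rule complex_Re_le_cmod)
      also have "\<dots> \<le> nrm (T (S x)) * nrm x" by (intro cauchy_schwarz opr_mem[OF T] S x)
      also have "\<dots> \<le> opr_norm H T * nrm (S x) * nrm x"
        using S x T by (intro mult_right_mono hnorm_opr_le hnorm_nonneg)
      finally have "nrm (S x) * nrm (S x) \<le> (opr_norm H T * nrm x) * nrm (S x)"
        by (simp add: power2_eq_square mult_ac)
      moreover have "0 < nrm (S x)" using False hnorm_nonneg[OF S(1)[OF x]] by simp
      ultimately show ?thesis by simp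
    qed
  qed (use S in \<open>auto simp: S_def\<close>)
  thus "\<exists>S. bounded_opr H S \<and> (\<forall>x \<in> hvecs H. \<forall>y \<in> hvecs H. ip (T x) y = ip x (S y))"
    using S(2) by blast
qed (auto intro!: opr_adj_unique)

lemma
  assumes "bounded_opr H T"
  shows bounded_opr_adj: "bounded_opr H (opr_adj H T)"
    and ip_opr_adj: "\<lbrakk>x \<in> hvecs H; y \<in> hvecs H\<rbrakk> \<Longrightarrow> ip (T x) y = ip x (opr_adj H T y)"
  using theI'[OF opr_adj_exists[OF assms]] unfolding opr_adj_def by auto

lemma ip_opr_adj':
  "\<lbrakk>bounded_opr H T; x \<in> hvecs H; y \<in> hvecs H\<rbrakk> \<Longrightarrow> ip x (T y) = ip (opr_adj H T x) y"
  by (metis bounded_opr_adj ip_commute ip_opr_adj opr_mem)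

lemma opr_adj_eqI:
  assumes "bounded_opr H T" "bounded_opr H S"
    and "\<And>x y. \<lbrakk>x \<in> hvecs H; y \<in> hvecs H\<rbrakk> \<Longrightarrow> ip (T x) y = ip x (S y)"
  shows "opr_adj H T = S"
  by (rule opr_adj_unique) (use assms in \<open>auto simp: bounded_opr_adj ip_opr_adj[symmetric]\<close>)

lemma opr_adj_adj: "bounded_opr H T \<Longrightarrow> opr_adj H (opr_adj H T) = T"
  by (rule opr_adj_eqI) (auto simp: bounded_opr_adj ip_opr_adj')

lemma opr_adj_zero: "opr_adj H 0 = 0"
  by (rule opr_adj_eqI) (auto simp: opr_apply bounded_opr_zero ip_simps)

lemma opr_adj_add:
  "\<lbrakk>bounded_opr H S; bounded_opr H T\<rbrakk> \<Longrightarrow> opr_adj H (S + T) = opr_adj H S + opr_adj H T"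
  by (rule opr_adj_eqI)
     (auto simp: bounded_opr_adj opr_apply bounded_opr_add ip_simps opr_mem ip_opr_adj)

lemma opr_adj_vscale:
  "bounded_opr H T \<Longrightarrow> opr_adj H (\<lambda>x. vscale c (T x)) = (\<lambda>x. vscale (cnj c) (opr_adj H T x))"
  by (rule opr_adj_eqI)
     (auto simp: bounded_opr_adj bounded_opr_vscale ip_simps opr_mem ip_opr_adj)

lemma opr_adj_comp:
  "\<lbrakk>bounded_opr H S; bounded_opr H T\<rbrakk> \<Longrightarrow> opr_adj H (S \<circ> T) = opr_adj H T \<circ> opr_adj H S"
  by (rule opr_adj_eqI)
     (auto simp: bounded_opr_adj bounded_opr_comp opr_mem ip_opr_adj)

lemma opr_norm_add_le:
  assumes "bounded_opr H S" "bounded_opr H T"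
  shows "opr_norm H (S + T) \<le> opr_norm H S + opr_norm H T"
  by (rule opr_norm_le)
     (use assms in \<open>auto simp: opr_apply opr_mem intro!: order_trans[OF hnorm_triangle] add_mono hnorm_opr_le_unit\<close>)

lemma opr_norm_vscale:
  assumes T: "bounded_opr H T"
  shows "opr_norm H (\<lambda>x. vscale c (T x)) = cmod c * opr_norm H T"
proof -
  have le: "opr_norm H (\<lambda>x. vscale c (T x)) \<le> cmod c * opr_norm H T" if T: "bounded_opr H T" for c T
    by (rule opr_norm_le) (use T in \<open>auto simp: opr_mem hnorm_vscale intro!: mult_left_mono hnorm_opr_le_unit\<close>)
  show ?thesis
  proof (cases "c = 0")
    case True
    have "opr_norm H (\<lambda>x. 0) \<le> 0" by (rule opr_norm_le) (simp add: hnorm_zero)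
    moreover have "0 \<le> opr_norm H (\<lambda>x. 0)"
      using opr_norm_nonneg[OF bounded_opr_zero] by (simp add: zero_fun_def)
    ultimately show ?thesis using True by simp
  next
    case False
    have "opr_norm H T \<le> cmod (1 / c) * opr_norm H (\<lambda>x. vscale c (T x))"
      using le[OF bounded_opr_vscale[OF T, of c], of "1 / c"] False by simp
    thus ?thesis using le[OF T, of c] False by (simp add: norm_divide field_simps)
  qed
qed

lemma opr_norm_comp_le:
  assumes "bounded_opr H S" "bounded_opr H T"
  shows "opr_norm H (S \<circ> T) \<le> opr_norm H S * opr_norm H T"
proof (rule opr_norm_le)
  fix x assume x: "x \<in> hvecs H" "nrm x \<le> 1"
  have "nrm ((S \<circ> T) x) \<le> opr_norm H S * opr_norm H T * nrm x" using hnorm_opr_comp_le[OF assms x(1)] by simp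
  also have "\<dots> \<le> opr_norm H S * opr_norm H T * 1"
    using x assms by (intro mult_left_mono mult_nonneg_nonneg opr_norm_nonneg) auto
  finally show "nrm ((S \<circ> T) x) \<le> opr_norm H S * opr_norm H T" by simp
qed

lemma opr_norm_sq_le_adj_comp:
  assumes T: "bounded_opr H T"
  shows "(opr_norm H T)\<^sup>2 \<le> opr_norm H (opr_adj H T \<circ> T)"
proof -
  let ?D = "opr_adj H T \<circ> T"
  have D: "bounded_opr H ?D" using T by (simp add: bounded_opr_adj bounded_opr_comp)
  have "opr_norm H T \<le> sqrt (opr_norm H ?D)"
  proof (rule opr_norm_le)
    fix x assume x: "x \<in> hvecs H" "nrm x \<le> 1"
    have "(nrm (T x))\<^sup>2 = Re (ip x (?D x))" using T x by (simp add: hnorm_sq opr_mem ip_opr_adj)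
    also have "\<dots> \<le> nrm x * nrm (?D x)"
      using cauchy_schwarz[OF x(1) opr_mem[OF D x(1)]] complex_Re_le_cmod order_trans by blast
    also have "\<dots> \<le> 1 * opr_norm H ?D"
    proof (rule mult_mono)
      show "nrm (?D x) \<le> opr_norm H ?D" by (rule hnorm_opr_le_unit[OF D x])
      show "0 \<le> nrm (?D x)" by (rule hnorm_nonneg[OF opr_mem[OF D x(1)]])
    qed (use x in auto)
    finally show "nrm (T x) \<le> sqrt (opr_norm H ?D)" by (simp add: real_le_rsqrt)
  qed
  thus ?thesis by (metis opr_norm_nonneg[OF T] opr_norm_nonneg[OF D] real_sqrt_pow2 power_mono)
qed

lemma opr_norm_adj: assumes T: "bounded_opr H T" shows "opr_norm H (opr_adj H T) = opr_norm H T"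
proof -
  \<comment> \<open>This follows from \<open>\<parallel>T\<parallel>\<^sup>2 \<le>
    \<parallel>T\<^sup>* T\<parallel> \<le> \<parallel>T\<^sup>*\<parallel>
    \<parallel>T\<parallel>\<close>; applied to the adjoint it gives the other inequality.\<close>
  have le: "opr_norm H T \<le> opr_norm H (opr_adj H T)" if T: "bounded_opr H T" for T
  proof (cases "opr_norm H T = 0")
    case True thus ?thesis using opr_norm_nonneg[OF bounded_opr_adj[OF T]] by simp
  next
    case False
    have "(opr_norm H T)\<^sup>2 \<le> opr_norm H (opr_adj H T) * opr_norm H T"
      using opr_norm_sq_le_adj_comp[OF T] opr_norm_comp_le[OF bounded_opr_adj[OF T] T] by linarith
    thus ?thesis using False opr_norm_nonneg[OF T] by (simp add: power2_eq_square)
  qed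
  show ?thesis using le[OF T] le[OF bounded_opr_adj[OF T]] opr_adj_adj[OF T] by simp
qed

lemma opr_norm_adj_comp: assumes T: "bounded_opr H T" shows "opr_norm H (opr_adj H T \<circ> T) = (opr_norm H T)\<^sup>2"
  using opr_norm_sq_le_adj_comp[OF T] opr_norm_comp_le[OF bounded_opr_adj[OF T] T] opr_norm_adj[OF T]
  by (simp add: power2_eq_square)

lemma opr_norm_eq_zero: assumes T: "bounded_opr H T" shows "opr_norm H T = 0 \<longleftrightarrow> T = 0"
proof
  assume 0: "opr_norm H T = 0"
  show "T = 0"
  proof
    fix x show "T x = 0 x"
    proof (cases "x \<in> hvecs H")
      case True
      have "nrm (T x) \<le> 0" using hnorm_opr_le[OF T True] 0 by simp
      thus ?thesis using hnorm_nonneg[OF opr_mem[OF T True]] hnorm_eq_zero[OF opr_mem[OF T True]] by (simp add: opr_apply)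
    qed (simp add: opr_apply opr_outside[OF T])
  qed
next
  assume "T = 0"
  hence "opr_norm H T \<le> 0" by (auto intro!: opr_norm_le simp: opr_apply hnorm_zero)
  thus "opr_norm H T = 0" using opr_norm_nonneg[OF T] by simp
qed

lemma opr_norm_zero: "opr_norm H 0 = 0"
  using opr_norm_eq_zero[OF bounded_opr_zero] by simp

end


context hilbert_space
begin

lemma hlim_unique:
  assumes X: "\<And>n. X n \<in> hvecs H" and "x \<in> hvecs H" "y \<in> hvecs H"
    and "(\<lambda>n. nrm (X n - x)) \<longlonglongrightarrow> 0" "(\<lambda>n. nrm (X n - y)) \<longlonglongrightarrow> 0"
  shows "x = y"
proof -
  have "(\<lambda>n. nrm (X n - x) + nrm (X n - y)) \<longlonglongrightarrow> 0 + 0" by (intro tendsto_intros assms)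
  moreover have "nrm (x - y) \<le> nrm (X n - x) + nrm (X n - y)" for n
    using hnorm_triangle_diff[of x "X n" y] hnorm_minus_commute[of x "X n"] assms by simp
  ultimately have "nrm (x - y) \<le> 0" by (intro LIMSEQ_le_const) auto
  hence "nrm (x - y) = 0" using hnorm_nonneg[of "x - y"] assms by (simp add: mem)
  thus ?thesis using assms hnorm_eq_zero[of "x - y"] by (simp add: mem)
qed

lemma hlim_add:
  assumes X: "\<And>n. X n \<in> hvecs H" "\<And>n. Y n \<in> hvecs H" "x \<in> hvecs H" "y \<in> hvecs H"
    and lim: "(\<lambda>n. nrm (X n - x)) \<longlonglongrightarrow> 0" "(\<lambda>n. nrm (Y n - y)) \<longlonglongrightarrow> 0"
  shows "(\<lambda>n. nrm ((X n + Y n) - (x + y))) \<longlonglongrightarrow> 0"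
proof (rule Lim_null_comparison)
  have "nrm ((X n + Y n) - (x + y)) \<le> nrm (X n - x) + nrm (Y n - y)" for n
    using hnorm_triangle[of "X n - x" "Y n - y"] X by (simp add: mem algebra_simps)
  thus "\<forall>\<^sub>F n in sequentially. norm (nrm ((X n + Y n) - (x + y))) \<le> nrm (X n - x) + nrm (Y n - y)"
    using X by (simp add: hnorm_nonneg mem)
  show "(\<lambda>n. nrm (X n - x) + nrm (Y n - y)) \<longlonglongrightarrow> 0"
    using tendsto_add[OF lim] by simp
qed

lemma hlim_vscale:
  assumes X: "\<And>n. X n \<in> hvecs H" "x \<in> hvecs H"
    and lim: "(\<lambda>n. nrm (X n - x)) \<longlonglongrightarrow> 0"
  shows "(\<lambda>n. nrm (vscale c (X n) - vscale c x)) \<longlonglongrightarrow> 0"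
  using tendsto_mult_left[OF lim, of "cmod c"] X
  by (simp add: vscale_diff[symmetric] hnorm_vscale mem)

end


section \<open>The C*-algebra of families of operators\<close>

declare split_paired_All [simp del] split_paired_Ex [simp del]

lemma ozero_eq: "ozero = 0"
  by (simp add: ozero_def vzero_eq fun_eq_iff fun_apply)

text \<open>Scaling a family does not depend on the semigroup. One constant with its rules serves
  the algebras of \<open>I\<close> and of its crystal.\<close>

definition fscale :: "complex \<Rightarrow> ('r \<Rightarrow> 'k opr) \<Rightarrow> 'r \<Rightarrow> 'k opr" where
  "fscale c a = (\<lambda>r x. vscale c (a r x))"

lemma fscale_simps [simp]:
  "fscale 1 a = a" "fscale 0 a = 0" "fscale c 0 = 0"
  "fscale c (fscale d a) = fscale (c * d) a" "fscale c (- a) = - fscale c a" "fscale (- c) a = - fscale c a"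
  by (auto simp: fscale_def fun_eq_iff fun_apply vscale_apply)

lemma fscale_add: "fscale c (a + b) = fscale c a + fscale c b"
  and fscale_diff: "fscale c (a - b) = fscale c a - fscale c b"
  and fscale_add_left: "fscale (c + d) a = fscale c a + fscale d a"
  by (auto simp: fscale_def fun_eq_iff fun_apply vscale_apply algebra_simps)

lemma fscale_sum: "fscale c (\<Sum>i\<in>S. F i) = (\<Sum>i\<in>S. fscale c (F i))"
  for F :: "'i \<Rightarrow> 'r \<Rightarrow> 'k opr"
  by (induction S rule: infinite_finite_induct) (auto simp: fscale_add)

lemma fam_apply:
  fixes a b :: "'r \<Rightarrow> 'k opr"
  shows "(a + b) r = a r + b r" "(0 :: 'r \<Rightarrow> 'k opr) r = 0" "(a - b) r = a r - b r" "(- a) r = - a r"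
  by (simp_all add: fun_apply)

lemma rep_families_simps:
  "cs_zero (rep_families I) = 0"
  "cs_add (rep_families I) = (+)"
  "cs_scale (rep_families I) = fscale"
  "cs_mult (rep_families I) a b = (\<lambda>r. a r \<circ> b r)"
  "cs_star (rep_families I) a = (\<lambda>r. if is_rep I r then opr_adj (fst r) (a r) else 0)"
  by (auto simp: rep_families_def ozero_eq fscale_def fun_eq_iff fun_apply vadd_eq)

lemma fam_norm_def: "cs_norm (rep_families I) a = Sup {opr_norm (fst r) (a r) | r. is_rep I r}"
  by (simp add: rep_families_def)

lemma is_repD:
  assumes "is_rep I r"
  shows "hilbert_space (fst r)"
    and "g \<in> sg_carrier I \<Longrightarrow> bounded_opr (fst r) (snd r g)"
    and "\<lbrakk>g \<in> sg_carrier I; h \<in> sg_carrier I\<rbrakk> \<Longrightarrow> snd r (sg_mult I g h) = snd r g \<circ> snd r h"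
    and "g \<in> sg_carrier I \<Longrightarrow> snd r (sg_inv I g) = opr_adj (fst r) (snd r g)"
    and "is_zero I z \<Longrightarrow> snd r z = 0"
    and "g \<in> sg_carrier I \<Longrightarrow> snd r g \<circ> opr_adj (fst r) (snd r g) \<circ> snd r g = snd r g"
  using assms by (auto simp: is_rep_def partial_isometry_def ozero_eq split: prod.splits)

lemma is_repI:
  assumes "hilbert_space H"
    and "\<And>g. g \<in> sg_carrier I \<Longrightarrow> bounded_opr H (\<pi> g)"
    and "\<And>g h. \<lbrakk>g \<in> sg_carrier I; h \<in> sg_carrier I\<rbrakk> \<Longrightarrow> \<pi> (sg_mult I g h) = \<pi> g \<circ> \<pi> h"
    and "\<And>g. g \<in> sg_carrier I \<Longrightarrow> opr_adj H (\<pi> g) = \<pi> (sg_inv I g)"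
    and "\<And>g. g \<in> sg_carrier I \<Longrightarrow> \<pi> g \<circ> \<pi> (sg_inv I g) \<circ> \<pi> g = \<pi> g"
    and "\<And>z. is_zero I z \<Longrightarrow> \<pi> z = 0"
  shows "is_rep I (H, \<pi>)"
  using assms by (auto simp: is_rep_def partial_isometry_def ozero_eq)

definition triv_hilb :: "'k hilb" where
  "triv_hilb = \<lparr> hvecs = {0}, hip = (\<lambda>_ _. 0) \<rparr>"

lemma hilbert_space_triv: "hilbert_space triv_hilb"
  by unfold_locales (auto simp: triv_hilb_def vadd_eq vzero_eq hnorm_def)

text \<open>The zero representation keeps the supremum that defines the norm of a family from being
  taken over the empty set.\<close>

lemma is_rep_triv: "is_rep I (triv_hilb, \<lambda>_. 0)"
proof -
  interpret hilbert_space triv_hilb by (rule hilbert_space_triv)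
  show ?thesis
    by (rule is_repI)
      (auto simp: hilbert_space_axioms bounded_opr_zero opr_adj_zero, auto simp: fun_eq_iff opr_apply)
qed

lemma rep_families_carrier:
  "a \<in> cs_carrier (rep_families I) \<longleftrightarrow>
     (\<forall>r. is_rep I r \<longrightarrow> bounded_opr (fst r) (a r)) \<and> (\<forall>r. \<not> is_rep I r \<longrightarrow> a r = 0) \<and>
     (\<exists>C. \<forall>r. is_rep I r \<longrightarrow> opr_norm (fst r) (a r) \<le> C)"
  by (simp add: rep_families_def ozero_eq)

lemma rep_familiesI:
  assumes "\<And>r. is_rep I r \<Longrightarrow> bounded_opr (fst r) (a r)"
    and "\<And>r. \<not> is_rep I r \<Longrightarrow> a r = 0"
    and "\<And>r. is_rep I r \<Longrightarrow> opr_norm (fst r) (a r) \<le> C"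
  shows "a \<in> cs_carrier (rep_families I)"
  using assms unfolding rep_families_carrier by blast

lemma rep_families_bounded: "\<lbrakk>a \<in> cs_carrier (rep_families I); is_rep I r\<rbrakk> \<Longrightarrow> bounded_opr (fst r) (a r)"
  and rep_families_outside: "\<lbrakk>a \<in> cs_carrier (rep_families I); \<not> is_rep I r\<rbrakk> \<Longrightarrow> a r = 0"
  by (simp_all add: rep_families_carrier)

lemma fam_norm_le:
  assumes "\<And>r. is_rep I r \<Longrightarrow> opr_norm (fst r) (a r) \<le> C"
  shows "cs_norm (rep_families I) a \<le> C"
  unfolding fam_norm_def
proof (rule cSup_least)
  show "{opr_norm (fst r) (a r) | r. is_rep I r} \<noteq> {}" using is_rep_triv[of I] by blast
qed (use assms in blast)

lemma opr_norm_le_fam_norm: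
  "\<lbrakk>a \<in> cs_carrier (rep_families I); is_rep I r\<rbrakk> \<Longrightarrow> opr_norm (fst r) (a r) \<le> cs_norm (rep_families I) a"
  unfolding fam_norm_def rep_families_carrier bdd_above_def
  by (rule cSup_upper) (blast, unfold bdd_above_def, blast)

lemma less_fam_normD:
  assumes "C < cs_norm (rep_families I) a"
  shows "\<exists>r. is_rep I r \<and> C < opr_norm (fst r) (a r)"
  using assms fam_norm_le[of I a C] by (meson not_le)

text \<open>When the addition is that of the type, zero and subtraction are too, and group
  arithmetic can be left to the simplifier. The algebras of families and their products have this
  form. The quotient, whose elements are cosets, does not and is reached by
  \<open>cstar_transport\<close>.\<close>

locale cstar_plus = cstar_algebra A for A :: "'b::ab_group_add cstar" +
  assumes add_eq: "cs_add A = (+)"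
begin

lemma zero_eq: "cs_zero A = 0"
  using add_zero[OF zero_closed] by (simp add: add_eq)

lemma scale_minus_one: "a \<in> cs_carrier A \<Longrightarrow> cs_scale A (- 1) a = - a"
  using minus_self[of a] by (simp add: cs_minus_def add_eq zero_eq add_eq_0_iff)

lemma minus_eq: "b \<in> cs_carrier A \<Longrightarrow> cs_minus A a b = a - b"
  by (simp add: cs_minus_def add_eq scale_minus_one)

abbreviation carr where "carr \<equiv> cs_carrier A"
abbreviation nm where "nm \<equiv> cs_norm A"
abbreviation mul where "mul \<equiv> cs_mult A"
abbreviation str where "str \<equiv> cs_star A"
abbreviation scl where "scl \<equiv> cs_scale A"

lemma plus_closed: "\<lbrakk>a \<in> carr; b \<in> carr\<rbrakk> \<Longrightarrow> a + b \<in> carr"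
  using add_closed by (simp add: add_eq)

lemma uminus_closed: "a \<in> carr \<Longrightarrow> - a \<in> carr"
  using scale_closed[of a "-1"] by (simp add: scale_minus_one)

lemma diff_closed: "\<lbrakk>a \<in> carr; b \<in> carr\<rbrakk> \<Longrightarrow> a - b \<in> carr"
  using plus_closed[of a "- b"] uminus_closed by simp

lemma null_closed: "0 \<in> carr"
  using zero_closed by (simp add: zero_eq)

lemmas closed = null_closed plus_closed uminus_closed diff_closed scale_closed mult_closed star_closed

lemma nm_zero: "nm 0 = 0"
  using norm_eq_zero[OF null_closed] by (simp add: zero_eq)

lemma nm_eq_zero: "a \<in> carr \<Longrightarrow> nm a = 0 \<longleftrightarrow> a = 0"
  by (simp add: norm_eq_zero zero_eq)

lemma nm_triangle: "\<lbrakk>a \<in> carr; b \<in> carr\<rbrakk> \<Longrightarrow> nm (a + b) \<le> nm a + nm b"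
  using norm_triangle by (simp add: add_eq)

lemma nm_uminus: "a \<in> carr \<Longrightarrow> nm (- a) = nm a"
  using norm_scale[of a "-1"] by (simp add: scale_minus_one)

lemma nm_minus_commute: "\<lbrakk>a \<in> carr; b \<in> carr\<rbrakk> \<Longrightarrow> nm (a - b) = nm (b - a)"
  using nm_uminus[of "a - b"] by (simp add: diff_closed)

lemma nm_triangle_diff: "\<lbrakk>a \<in> carr; b \<in> carr; c \<in> carr\<rbrakk> \<Longrightarrow> nm (a - c) \<le> nm (a - b) + nm (b - c)"
  using nm_triangle[of "a - b" "b - c"] by (simp add: diff_closed)

lemma nm_diff_le: "\<lbrakk>a \<in> carr; b \<in> carr\<rbrakk> \<Longrightarrow> nm a \<le> nm (a - b) + nm b"
  using nm_triangle[of "a - b" b] by (simp add: diff_closed)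

lemma nm_diff_add_le:
  "\<lbrakk>a \<in> carr; b \<in> carr; a' \<in> carr; b' \<in> carr\<rbrakk> \<Longrightarrow> nm ((a + b) - (a' + b')) \<le> nm (a - a') + nm (b - b')"
  using nm_triangle[of "a - a'" "b - b'"] by (simp add: diff_closed algebra_simps)

lemma scl_add: "\<lbrakk>a \<in> carr; b \<in> carr\<rbrakk> \<Longrightarrow> scl c (a + b) = scl c a + scl c b"
  using scale_add_right by (simp add: add_eq)

lemma scl_uminus: "a \<in> carr \<Longrightarrow> scl c (- a) = - scl c a"
  using scale_scale[of a c "-1"] scale_scale[of a "-1" c] by (simp add: scale_minus_one scale_closed)

lemma scl_diff: "\<lbrakk>a \<in> carr; b \<in> carr\<rbrakk> \<Longrightarrow> scl c (a - b) = scl c a - scl c b"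
  using scl_add[of a "- b"] by (simp add: uminus_closed scl_uminus)

lemma nm_scl_diff: "\<lbrakk>a \<in> carr; b \<in> carr\<rbrakk> \<Longrightarrow> nm (scl c a - scl c b) = cmod c * nm (a - b)"
  using norm_scale[of "a - b" c] by (simp add: scl_diff diff_closed)

lemma mul_add_left: "\<lbrakk>a \<in> carr; b \<in> carr; d \<in> carr\<rbrakk> \<Longrightarrow> mul (a + b) d = mul a d + mul b d"
  using mult_add_left by (simp add: add_eq)

lemma mul_add_right: "\<lbrakk>a \<in> carr; b \<in> carr; d \<in> carr\<rbrakk> \<Longrightarrow> mul d (a + b) = mul d a + mul d b"
  using mult_add_right by (simp add: add_eq)

lemma mul_diff_left: "\<lbrakk>a \<in> carr; b \<in> carr; d \<in> carr\<rbrakk> \<Longrightarrow> mul (a - b) d = mul a d - mul b d"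
  using mul_add_left[of "a - b" b d] by (simp add: diff_closed algebra_simps)

lemma mul_diff_right: "\<lbrakk>a \<in> carr; b \<in> carr; d \<in> carr\<rbrakk> \<Longrightarrow> mul d (a - b) = mul d a - mul d b"
  using mul_add_right[of "a - b" b d] by (simp add: diff_closed algebra_simps)

lemma mul_zero: "a \<in> carr \<Longrightarrow> mul 0 a = 0" "a \<in> carr \<Longrightarrow> mul a 0 = 0"
  using mul_diff_left[of 0 0 a] mul_diff_right[of 0 0 a] by (auto simp: null_closed)

lemma str_add: "\<lbrakk>a \<in> carr; b \<in> carr\<rbrakk> \<Longrightarrow> str (a + b) = str a + str b"
  using star_add by (simp add: add_eq)

lemma str_zero: "str 0 = 0"
  using str_add[of 0 0] null_closed by simp

lemma str_diff: "\<lbrakk>a \<in> carr; b \<in> carr\<rbrakk> \<Longrightarrow> str (a - b) = str a - str b"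
  using str_add[of "a - b" b] by (simp add: diff_closed algebra_simps)

lemma nm_str: assumes "a \<in> carr" shows "nm (str a) = nm a"
proof -
  have le: "nm a \<le> nm (str a)" if a: "a \<in> carr" for a
  proof (cases "nm a = 0")
    case True thus ?thesis using norm_nonneg[OF star_closed[OF a]] by simp
  next
    case False
    have "(nm a)\<^sup>2 \<le> nm (str a) * nm a"
      using cstar_identity[OF a] norm_mult[OF star_closed[OF a] a] by simp
    thus ?thesis using False norm_nonneg[OF a] by (simp add: power2_eq_square)
  qed
  show ?thesis using le[OF assms] le[OF star_closed[OF assms]] star_star[OF assms] by simp
qed

lemma nm_mul_diff_le:
  assumes "a \<in> carr" "b \<in> carr" "a' \<in> carr" "b' \<in> carr"
  shows "nm (mul a b - mul a' b') \<le> nm (a - a') * nm b + nm a' * nm (b - b')"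
proof -
  have "mul a b - mul a' b' = mul (a - a') b + mul a' (b - b')"
    using assms by (simp add: mul_diff_left mul_diff_right)
  also have "nm \<dots> \<le> nm (mul (a - a') b) + nm (mul a' (b - b'))"
    using assms by (intro nm_triangle closed)
  also have "\<dots> \<le> nm (a - a') * nm b + nm a' * nm (b - b')"
    using assms by (intro add_mono norm_mult closed)
  finally show ?thesis .
qed

end

lemma cstar_plusI:
  assumes add: "cs_add A = (+)" and zero: "cs_zero A = 0" and scale1: "\<And>a. cs_scale A (- 1) a = - a"
    and closed: "0 \<in> cs_carrier A" "\<And>a b. \<lbrakk>a \<in> cs_carrier A; b \<in> cs_carrier A\<rbrakk> \<Longrightarrow> a + b \<in> cs_carrier A"
      "\<And>a c. a \<in> cs_carrier A \<Longrightarrow> cs_scale A c a \<in> cs_carrier A"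
      "\<And>a b. \<lbrakk>a \<in> cs_carrier A; b \<in> cs_carrier A\<rbrakk> \<Longrightarrow> cs_mult A a b \<in> cs_carrier A"
      "\<And>a. a \<in> cs_carrier A \<Longrightarrow> cs_star A a \<in> cs_carrier A"
    and module: "\<And>a. a \<in> cs_carrier A \<Longrightarrow> cs_scale A 1 a = a"
      "\<And>a c s. a \<in> cs_carrier A \<Longrightarrow> cs_scale A c (cs_scale A s a) = cs_scale A (c * s) a"
      "\<And>a c s. a \<in> cs_carrier A \<Longrightarrow> cs_scale A (c + s) a = cs_scale A c a + cs_scale A s a"
      "\<And>a b c. \<lbrakk>a \<in> cs_carrier A; b \<in> cs_carrier A\<rbrakk> \<Longrightarrow> cs_scale A c (a + b) = cs_scale A c a + cs_scale A c b"
    and mult: "\<And>a b d. \<lbrakk>a \<in> cs_carrier A; b \<in> cs_carrier A; d \<in> cs_carrier A\<rbrakk>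
        \<Longrightarrow> cs_mult A (cs_mult A a b) d = cs_mult A a (cs_mult A b d)"
      "\<And>a b d. \<lbrakk>a \<in> cs_carrier A; b \<in> cs_carrier A; d \<in> cs_carrier A\<rbrakk>
        \<Longrightarrow> cs_mult A (a + b) d = cs_mult A a d + cs_mult A b d"
      "\<And>a b d. \<lbrakk>a \<in> cs_carrier A; b \<in> cs_carrier A; d \<in> cs_carrier A\<rbrakk>
        \<Longrightarrow> cs_mult A d (a + b) = cs_mult A d a + cs_mult A d b"
      "\<And>a b c. \<lbrakk>a \<in> cs_carrier A; b \<in> cs_carrier A\<rbrakk> \<Longrightarrow> cs_mult A (cs_scale A c a) b = cs_scale A c (cs_mult A a b)"
      "\<And>a b c. \<lbrakk>a \<in> cs_carrier A; b \<in> cs_carrier A\<rbrakk> \<Longrightarrow> cs_mult A a (cs_scale A c b) = cs_scale A c (cs_mult A a b)"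
    and star: "\<And>a. a \<in> cs_carrier A \<Longrightarrow> cs_star A (cs_star A a) = a"
      "\<And>a b. \<lbrakk>a \<in> cs_carrier A; b \<in> cs_carrier A\<rbrakk> \<Longrightarrow> cs_star A (a + b) = cs_star A a + cs_star A b"
      "\<And>a c. a \<in> cs_carrier A \<Longrightarrow> cs_star A (cs_scale A c a) = cs_scale A (cnj c) (cs_star A a)"
      "\<And>a b. \<lbrakk>a \<in> cs_carrier A; b \<in> cs_carrier A\<rbrakk> \<Longrightarrow> cs_star A (cs_mult A a b) = cs_mult A (cs_star A b) (cs_star A a)"
    and norm: "\<And>a. a \<in> cs_carrier A \<Longrightarrow> 0 \<le> cs_norm A a"
      "\<And>a. a \<in> cs_carrier A \<Longrightarrow> cs_norm A a = 0 \<longleftrightarrow> a = 0"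
      "\<And>a b. \<lbrakk>a \<in> cs_carrier A; b \<in> cs_carrier A\<rbrakk> \<Longrightarrow> cs_norm A (a + b) \<le> cs_norm A a + cs_norm A b"
      "\<And>a c. a \<in> cs_carrier A \<Longrightarrow> cs_norm A (cs_scale A c a) = cmod c * cs_norm A a"
      "\<And>a b. \<lbrakk>a \<in> cs_carrier A; b \<in> cs_carrier A\<rbrakk> \<Longrightarrow> cs_norm A (cs_mult A a b) \<le> cs_norm A a * cs_norm A b"
      "\<And>a. a \<in> cs_carrier A \<Longrightarrow> cs_norm A (cs_mult A (cs_star A a) a) = (cs_norm A a)\<^sup>2"
    and complete: "\<And>X. \<lbrakk>\<And>n. X n \<in> cs_carrier A;
        \<And>e. 0 < e \<Longrightarrow> \<exists>M. \<forall>m\<ge>M. \<forall>n\<ge>M. cs_norm A (X m - X n) < e\<rbrakk>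
      \<Longrightarrow> \<exists>a \<in> cs_carrier A. (\<lambda>n. cs_norm A (X n - a)) \<longlonglongrightarrow> 0"
  shows "cstar_plus A"
proof -
  have minus: "cs_minus A a b = a - b" for a b by (simp add: cs_minus_def add scale1)
  show ?thesis
    by unfold_locales (simp_all add: add zero minus closed module mult star norm complete add.assoc add.commute)
qed

section \<open>The C*-algebra axioms for families of operators\<close>

context
  fixes I :: "'a sgrp"
begin

private abbreviation (input) "F \<equiv> rep_families I"
private abbreviation (input) "C \<equiv> cs_carrier (rep_families I)"

lemma fam_norm_nonneg: assumes "a \<in> C" shows "0 \<le> cs_norm F a"
proof -
  interpret hilbert_space "fst (triv_hilb, \<lambda>_. 0)" by (simp add: hilbert_space_triv)
  show ?thesis
    using opr_norm_nonneg[OF rep_families_bounded[OF assms is_rep_triv]] opr_norm_le_fam_norm[OF assms is_rep_triv]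
    by (rule order_trans)
qed

lemma fam_add_closed:
  assumes "a \<in> C" "b \<in> C" shows "a + b \<in> C" "cs_norm F (a + b) \<le> cs_norm F a + cs_norm F b"
proof -
  have bound: "opr_norm (fst r) ((a + b) r) \<le> cs_norm F a + cs_norm F b" if r: "is_rep I r" for r
  proof -
    interpret hilbert_space "fst r" by (rule is_repD[OF r])
    have "opr_norm (fst r) (a r + b r) \<le> opr_norm (fst r) (a r) + opr_norm (fst r) (b r)"
      using assms r by (intro opr_norm_add_le rep_families_bounded)
    also have "\<dots> \<le> cs_norm F a + cs_norm F b" using assms r by (intro add_mono opr_norm_le_fam_norm)
    finally show ?thesis by (simp add: fam_apply)
  qed
  show "a + b \<in> C"
    by (rule rep_familiesI[OF _ _ bound])
      (use assms in \<open>simp_all add: fam_apply rep_families_bounded rep_families_outside is_repD(1)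
         hilbert_space.bounded_opr_add\<close>)
  show "cs_norm F (a + b) \<le> cs_norm F a + cs_norm F b" by (rule fam_norm_le[OF bound])
qed

lemma fam_scale_closed:
  assumes "a \<in> C" shows "fscale c a \<in> C" "cs_norm F (fscale c a) \<le> cmod c * cs_norm F a"
proof -
  have bound: "opr_norm (fst r) (fscale c a r) \<le> cmod c * cs_norm F a" if r: "is_rep I r" for r
  proof -
    interpret hilbert_space "fst r" by (rule is_repD[OF r])
    show ?thesis unfolding fscale_def
      using assms r by (simp add: opr_norm_vscale rep_families_bounded opr_norm_le_fam_norm mult_left_mono)
  qed
  show "fscale c a \<in> C"
    by (rule rep_familiesI[OF _ _ bound])
      (use assms in \<open>simp_all add: fscale_def rep_families_bounded rep_families_outside is_repD(1) opr_apply
         hilbert_space.bounded_opr_vscale fun_eq_iff\<close>)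
  show "cs_norm F (fscale c a) \<le> cmod c * cs_norm F a" by (rule fam_norm_le[OF bound])
qed

lemma fam_norm_scale: assumes "a \<in> C" shows "cs_norm F (fscale c a) = cmod c * cs_norm F a"
proof (cases "c = 0")
  case True
  have "cs_norm F 0 \<le> 0"
    using fam_scale_closed(2)[OF assms, of 0] by simp
  moreover have "0 \<in> C" using fam_scale_closed(1)[OF assms, of 0] by simp
  then have "0 \<le> cs_norm F 0" by (rule fam_norm_nonneg)
  ultimately show ?thesis using True by simp
next
  case False
  have "cs_norm F a \<le> cmod (1 / c) * cs_norm F (fscale c a)"
    using fam_scale_closed(2)[OF fam_scale_closed(1)[OF assms, of c], of "1 / c"] False by simp
  thus ?thesis using fam_scale_closed(2)[OF assms, of c] False by (simp add: norm_divide field_simps)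
qed

lemma fam_mult_closed:
  assumes "a \<in> C" "b \<in> C" shows "cs_mult F a b \<in> C" "cs_norm F (cs_mult F a b) \<le> cs_norm F a * cs_norm F b"
proof -
  have bound: "opr_norm (fst r) (cs_mult F a b r) \<le> cs_norm F a * cs_norm F b" if r: "is_rep I r" for r
  proof -
    interpret hilbert_space "fst r" by (rule is_repD[OF r])
    have "opr_norm (fst r) (a r \<circ> b r) \<le> opr_norm (fst r) (a r) * opr_norm (fst r) (b r)"
      using assms r by (simp add: opr_norm_comp_le rep_families_bounded)
    also have "\<dots> \<le> cs_norm F a * cs_norm F b"
      using assms r by (intro mult_mono opr_norm_le_fam_norm opr_norm_nonneg fam_norm_nonneg rep_families_bounded)
    finally show ?thesis by (simp add: rep_families_simps)
  qed
  show "cs_mult F a b \<in> C"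
    by (rule rep_familiesI[OF _ _ bound])
      (use assms in \<open>simp_all add: rep_families_simps rep_families_bounded rep_families_outside is_repD(1)
         hilbert_space.bounded_opr_comp fun_eq_iff opr_apply\<close>)
  show "cs_norm F (cs_mult F a b) \<le> cs_norm F a * cs_norm F b" by (rule fam_norm_le[OF bound])
qed

lemma fam_star_closed:
  assumes "a \<in> C" shows "cs_star F a \<in> C"
proof -
  have "opr_norm (fst r) (cs_star F a r) \<le> cs_norm F a" if r: "is_rep I r" for r
    using assms r by (simp add: rep_families_simps hilbert_space.opr_norm_adj is_repD(1) rep_families_bounded opr_norm_le_fam_norm)
  thus ?thesis
    by (intro rep_familiesI)
      (use assms in \<open>simp_all add: rep_families_simps rep_families_bounded is_repD(1)
         hilbert_space.bounded_opr_adj\<close>)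
qed

lemma fam_norm_star_mult:
  assumes "a \<in> C" shows "cs_norm F (cs_mult F (cs_star F a) a) = (cs_norm F a)\<^sup>2"
proof (rule antisym)
  have eq: "opr_norm (fst r) (cs_mult F (cs_star F a) a r) = (opr_norm (fst r) (a r))\<^sup>2" if r: "is_rep I r"
    for r :: "('a, 'a) rep"
    using r assms by (simp add: rep_families_simps hilbert_space.opr_norm_adj_comp is_repD(1) rep_families_bounded)
  have nn: "0 \<le> opr_norm (fst r) (a r)" if r: "is_rep I r" for r :: "('a, 'a) rep"
    using hilbert_space.opr_norm_nonneg[OF is_repD(1)[OF r]] rep_families_bounded[OF assms r] by blast
  show "cs_norm F (cs_mult F (cs_star F a) a) \<le> (cs_norm F a)\<^sup>2"
    using nn by (intro fam_norm_le) (simp add: eq opr_norm_le_fam_norm assms power_mono)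
  have D: "cs_mult F (cs_star F a) a \<in> C" by (intro fam_mult_closed fam_star_closed assms)
  have "cs_norm F a \<le> sqrt (cs_norm F (cs_mult F (cs_star F a) a))"
  proof (rule fam_norm_le)
    fix r :: "('a, 'a) rep" assume r: "is_rep I r"
    have "(opr_norm (fst r) (a r))\<^sup>2 \<le> cs_norm F (cs_mult F (cs_star F a) a)"
      using opr_norm_le_fam_norm[OF D r] eq[OF r] by simp
    thus "opr_norm (fst r) (a r) \<le> sqrt (cs_norm F (cs_mult F (cs_star F a) a))"
      by (simp add: real_le_rsqrt)
  qed
  thus "(cs_norm F a)\<^sup>2 \<le> cs_norm F (cs_mult F (cs_star F a) a)"
    by (metis fam_norm_nonneg[OF D] fam_norm_nonneg[OF assms] real_sqrt_pow2 power_mono)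
qed

lemma fam_norm_eq_zero: assumes "a \<in> C" shows "cs_norm F a = 0 \<longleftrightarrow> a = 0"
proof
  assume 0: "cs_norm F a = 0"
  show "a = 0"
  proof
    fix r show "a r = 0 r"
    proof (cases "is_rep I r")
      case True
      interpret hilbert_space "fst r" by (rule is_repD[OF True])
      have b: "bounded_opr (fst r) (a r)" using assms True by (rule rep_families_bounded)
      have "opr_norm (fst r) (a r) = 0"
        using opr_norm_le_fam_norm[OF assms True] 0 opr_norm_nonneg[OF b] by simp
      thus ?thesis using opr_norm_eq_zero[OF b] by (simp add: fam_apply)
    qed (simp add: rep_families_outside[OF assms] fam_apply)
  qed
next
  assume "a = 0"
  hence "cs_norm F a = cs_norm F (fscale 0 a)" by simp
  thus "cs_norm F a = 0" using fam_norm_scale[OF assms, of 0] by simp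
qed

text \<open>The Cauchy condition is uniform over the representations. Hence the pointwise limits
  satisfy the same estimate in every representation, and this is convergence in norm.\<close>

lemma fam_complete:
  assumes X: "\<And>n. X n \<in> C"
    and cauchy: "\<And>e. 0 < e \<Longrightarrow> \<exists>M. \<forall>m\<ge>M. \<forall>n\<ge>M. cs_norm F (X m - X n) < e"
  shows "\<exists>a \<in> C. (\<lambda>n. cs_norm F (X n - a)) \<longlonglongrightarrow> 0"
proof -
  have diff: "a - b \<in> C" if "a \<in> C" "b \<in> C" for a b
    using fam_add_closed(1)[OF that(1) fam_scale_closed(1)[OF that(2), of "-1"]] by simp
  \<comment> \<open>The value 0 off the representations and off the Hilbert space is what membership
    in the carrier and \<open>bounded_opr\<close> prescribe there.\<close>
  define L where "L r x = (if is_rep I r \<and> x \<in> hvecs (fst r)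
      then SOME y. y \<in> hvecs (fst r) \<and> (\<lambda>n. hnorm (fst r) (X n r x - y)) \<longlonglongrightarrow> 0 else 0)" for r x
  have pt: "hnorm (fst r) (X m r x - X n r x) \<le> cs_norm F (X m - X n) * hnorm (fst r) x"
    if r: "is_rep I r" and x: "x \<in> hvecs (fst r)" for r x m n
  proof -
    interpret hilbert_space "fst r" by (rule is_repD[OF r])
    have b: "bounded_opr (fst r) ((X m - X n) r)" by (rule rep_families_bounded[OF diff[OF X X] r])
    have "nrm ((X m - X n) r x) \<le> opr_norm (fst r) ((X m - X n) r) * nrm x" by (rule hnorm_opr_le[OF b x])
    also have "\<dots> \<le> cs_norm F (X m - X n) * nrm x"
      by (intro mult_right_mono opr_norm_le_fam_norm diff X r hnorm_nonneg x)
    finally show ?thesis by (simp add: fam_apply opr_apply)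
  qed
  have Xmem: "X n r x \<in> hvecs (fst r)" if r: "is_rep I r" and x: "x \<in> hvecs (fst r)" for r x n
    using hilbert_space.opr_mem[OF is_repD(1)[OF r] rep_families_bounded[OF X r] x] .
  have L: "L r x \<in> hvecs (fst r) \<and> (\<lambda>n. hnorm (fst r) (X n r x - L r x)) \<longlonglongrightarrow> 0"
    if r: "is_rep I r" and x: "x \<in> hvecs (fst r)" for r x
  proof -
    interpret hilbert_space "fst r" by (rule is_repD[OF r])
    have "\<exists>y \<in> hvecs (fst r). (\<lambda>n. nrm (X n r x - y)) \<longlonglongrightarrow> 0"
    proof (rule cauchy_limit)
      fix e :: real assume e: "0 < e"
      have p: "0 < nrm x + 1" using hnorm_nonneg[OF x] by simp
      obtain M where M: "\<forall>m\<ge>M. \<forall>n\<ge>M. cs_norm F (X m - X n) < e / (nrm x + 1)"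
        using cauchy[of "e / (nrm x + 1)"] e p by auto
      have "nrm (X m r x - X n r x) < e" if "M \<le> m" "M \<le> n" for m n
      proof -
        have "nrm (X m r x - X n r x) \<le> cs_norm F (X m - X n) * nrm x" by (rule pt[OF r x])
        also have "\<dots> \<le> cs_norm F (X m - X n) * (nrm x + 1)"
          by (intro mult_left_mono fam_norm_nonneg diff X) auto
        also have "\<dots> < e" using M that p by (simp add: field_simps)
        finally show ?thesis .
      qed
      thus "\<exists>M. \<forall>m\<ge>M. \<forall>n\<ge>M. nrm (X m r x - X n r x) < e" by blast
    qed (rule Xmem[OF r x])
    hence "\<exists>y. y \<in> hvecs (fst r) \<and> (\<lambda>n. nrm (X n r x - y)) \<longlonglongrightarrow> 0" by blast
    from someI_ex[OF this] show ?thesis using r x by (simp add: L_def)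
  qed
  \<comment> \<open>The Cauchy estimate for \<open>X n - X m\<close>, with \<open>m\<close> tending
    to infinity.\<close>
  have close: "hnorm (fst r) (X n r x - L r x) \<le> e * hnorm (fst r) x"
    if M: "\<forall>m\<ge>M. \<forall>n\<ge>M. cs_norm F (X m - X n) < e" and n: "M \<le> n" and r: "is_rep I r" and x: "x \<in> hvecs (fst r)"
    for n M e r x
  proof -
    interpret hilbert_space "fst r" by (rule is_repD[OF r])
    have Lx: "L r x \<in> hvecs (fst r)" and lim: "(\<lambda>n. nrm (X n r x - L r x)) \<longlonglongrightarrow> 0" using L[OF r x] by auto
    have "nrm (X n r x - L r x) \<le> e * nrm x + nrm (X m r x - L r x)" if m: "M \<le> m" for m
    proof -
      have "nrm (X n r x - L r x) \<le> nrm (X n r x - X m r x) + nrm (X m r x - L r x)"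
        by (intro hnorm_triangle_diff Xmem r x Lx)
      also have "nrm (X n r x - X m r x) \<le> cs_norm F (X n - X m) * nrm x" by (rule pt[OF r x])
      also have "\<dots> \<le> e * nrm x" using M m n by (intro mult_right_mono hnorm_nonneg x) (simp add: less_imp_le)
      finally show ?thesis by simp
    qed
    moreover have "(\<lambda>m. e * nrm x + nrm (X m r x - L r x)) \<longlonglongrightarrow> e * nrm x + 0"
      by (intro tendsto_intros lim)
    ultimately show ?thesis using LIMSEQ_le_const by fastforce
  qed
  have Lbd: "bounded_opr (fst r) (L r)" if r: "is_rep I r" for r
  proof -
    interpret hilbert_space "fst r" by (rule is_repD[OF r])
    have XB: "bounded_opr (fst r) (X n r)" for n by (rule rep_families_bounded[OF X r])
    obtain M where M: "\<forall>m\<ge>M. \<forall>n\<ge>M. cs_norm F (X m - X n) < 1" using cauchy[of 1] by auto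
    show ?thesis
    proof (rule bounded_oprI[of _ "1 + opr_norm (fst r) (X M r)"])
      fix x y assume x: "x \<in> hvecs (fst r)" and y: "y \<in> hvecs (fst r)"
      have "(\<lambda>n. nrm (X n r (x + y) - (L r x + L r y))) \<longlonglongrightarrow> 0"
        unfolding opr_add[OF XB x y] using L[OF r x] L[OF r y] Xmem[OF r x] Xmem[OF r y] by (intro hlim_add) auto
      thus "L r (x + y) = L r x + L r y"
        using hlim_unique[of "\<lambda>n. X n r (x + y)"] L[OF r x] L[OF r y] L[OF r add_mem[OF x y]] Xmem[OF r add_mem[OF x y]]
        by (simp add: mem)
    next
      fix x c assume x: "x \<in> hvecs (fst r)"
      have "(\<lambda>n. nrm (X n r (vscale c x) - vscale c (L r x))) \<longlonglongrightarrow> 0"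
        unfolding opr_vscale[OF XB x] using L[OF r x] Xmem[OF r x] by (intro hlim_vscale) auto
      thus "L r (vscale c x) = vscale c (L r x)"
        using hlim_unique[of "\<lambda>n. X n r (vscale c x)"] L[OF r x] L[OF r vscale_mem[OF x]] Xmem[OF r vscale_mem[OF x]]
        by (simp add: mem)
      have Lx: "L r x \<in> hvecs (fst r)" using L[OF r x] by simp
      have "nrm (L r x) \<le> nrm (L r x - X M r x) + nrm (X M r x)"
        using hnorm_triangle[of "L r x - X M r x" "X M r x"] Lx Xmem[OF r x] by (simp add: mem)
      also have "nrm (L r x - X M r x) \<le> 1 * nrm x"
        using close[OF M order_refl r x] hnorm_minus_commute[OF Lx Xmem[OF r x]] by simp
      also have "nrm (X M r x) \<le> opr_norm (fst r) (X M r) * nrm x" by (rule hnorm_opr_le[OF XB x])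
      finally show "nrm (L r x) \<le> (1 + opr_norm (fst r) (X M r)) * nrm x" by (simp add: distrib_right)
    qed (use L[OF r] in \<open>auto simp: L_def\<close>)
  qed
  have Ldiff: "opr_norm (fst r) ((X n - L) r) \<le> e"
    if M: "\<forall>m\<ge>M. \<forall>n\<ge>M. cs_norm F (X m - X n) < e" and n: "M \<le> n" and r: "is_rep I r" for n M e r
  proof -
    interpret hilbert_space "fst r" by (rule is_repD[OF r])
    have e: "0 \<le> e" using M fam_norm_nonneg[OF diff[OF X X, of M M]] by fastforce
    show ?thesis
    proof (rule opr_norm_le)
      fix x assume x: "x \<in> hvecs (fst r)" "nrm x \<le> 1"
      have "nrm ((X n - L) r x) \<le> e * nrm x" using close[OF M n r x(1)] by (simp add: fam_apply opr_apply)
      also have "\<dots> \<le> e" using e x by (simp add: mult_left_le)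
      finally show "nrm ((X n - L) r x) \<le> e" .
    qed
  qed
  obtain M where M: "\<forall>m\<ge>M. \<forall>n\<ge>M. cs_norm F (X m - X n) < 1" using cauchy[of 1] by auto
  \<comment> \<open>The difference is bounded by 1 in every representation. Writing
    \<open>L = X M - (X M - L)\<close> then bounds \<open>L\<close> uniformly as well.\<close>
  have XL: "X M - L \<in> C"
  proof (rule rep_familiesI[of _ _ 1])
    fix r :: "('a, 'a) rep" assume r: "is_rep I r"
    interpret hilbert_space "fst r" by (rule is_repD[OF r])
    have "bounded_opr (fst r) (X M r + (\<lambda>x. vscale (-1) (L r x)))"
      by (intro bounded_opr_add bounded_opr_vscale Lbd r rep_families_bounded[OF X])
    thus "bounded_opr (fst r) ((X M - L) r)" by (simp add: fam_apply plus_fun_def fun_diff_def fun_apply fun_Compl_def)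
    show "opr_norm (fst r) ((X M - L) r) \<le> 1" by (rule Ldiff[OF M order_refl r])
  next
    fix r :: "('a, 'a) rep" assume r: "\<not> is_rep I r"
    have "L r = 0" using r by (auto simp: L_def fun_eq_iff opr_apply)
    thus "(X M - L) r = 0" using rep_families_outside[OF X r] by (simp add: fam_apply)
  qed
  have LC: "L \<in> C" using diff[OF X[of M] XL] by simp
  have "(\<lambda>n. cs_norm F (X n - L)) \<longlonglongrightarrow> 0"
  proof (rule LIMSEQ_I)
    fix e :: real assume e: "0 < e"
    obtain M where M: "\<forall>m\<ge>M. \<forall>n\<ge>M. cs_norm F (X m - X n) < e / 2" using cauchy[of "e / 2"] e by auto
    have "cs_norm F (X n - L) \<le> e / 2" if "M \<le> n" for n
      by (rule fam_norm_le) (rule Ldiff[OF M that])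
    thus "\<exists>M. \<forall>n\<ge>M. norm (cs_norm F (X n - L) - 0) < e"
      using e fam_norm_nonneg[OF diff[OF X LC]] by (intro exI[of _ M]) (fastforce)
  qed
  thus ?thesis using LC by blast
qed

lemma cstar_plus_rep_families: "cstar_plus F"
proof (rule cstar_plusI)
  show z: "0 \<in> C"
    by (rule rep_familiesI[of _ _ 0])
      (simp_all add: fam_apply is_repD(1) hilbert_space.bounded_opr_zero hilbert_space.opr_norm_zero)
  show "cs_mult F (cs_mult F a b) d = cs_mult F a (cs_mult F b d)" for a b d
    by (auto simp: rep_families_simps fun_eq_iff)
  show "cs_mult F (a + b) d = cs_mult F a d + cs_mult F b d" for a b d
    by (auto simp: rep_families_simps fun_eq_iff fun_apply)
  show "cs_mult F (cs_scale F c a) b = cs_scale F c (cs_mult F a b)" for a b c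
    by (auto simp: rep_families_simps fun_eq_iff fscale_def)
  \<comment> \<open>Unlike distributivity on the other side, this uses additivity of
    \<open>d r\<close>, hence the distinction between vectors in the Hilbert space and the
    others.\<close>
  show "cs_mult F d (a + b) = cs_mult F d a + cs_mult F d b" if "a \<in> C" "b \<in> C" "d \<in> C" for a b d
  proof (intro ext)
    fix r x y
    show "cs_mult F d (a + b) r x y = (cs_mult F d a + cs_mult F d b) r x y"
    proof (cases "is_rep I r")
      case True
      interpret hilbert_space "fst r" by (rule is_repD[OF True])
      have b: "bounded_opr (fst r) (a r)" "bounded_opr (fst r) (b r)" "bounded_opr (fst r) (d r)"
        using that True by (auto simp: rep_families_bounded)
      show ?thesis
        using b by (cases "x \<in> hvecs (fst r)")
          (auto simp: rep_families_simps fam_apply opr_apply opr_add opr_mem opr_outside opr_zero)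
    qed (use that in \<open>auto simp: rep_families_simps rep_families_outside fam_apply opr_apply\<close>)
  qed
  show "cs_mult F a (cs_scale F c b) = cs_scale F c (cs_mult F a b)" if "a \<in> C" "b \<in> C" for a b c
  proof (intro ext)
    fix r x y
    show "cs_mult F a (cs_scale F c b) r x y = cs_scale F c (cs_mult F a b) r x y"
    proof (cases "is_rep I r")
      case True
      interpret hilbert_space "fst r" by (rule is_repD[OF True])
      have b: "bounded_opr (fst r) (a r)" "bounded_opr (fst r) (b r)"
        using that True by (auto simp: rep_families_bounded)
      show ?thesis
        using b by (cases "x \<in> hvecs (fst r)")
          (auto simp: rep_families_simps fscale_def opr_vscale opr_mem opr_outside opr_zero)
    qed (use that in \<open>auto simp: rep_families_simps rep_families_outside fscale_def opr_apply\<close>)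
  qed
  show "cs_star F (cs_star F a) = a" if "a \<in> C" for a
    using that by (auto simp: rep_families_simps fun_eq_iff hilbert_space.opr_adj_adj is_repD(1) rep_families_bounded
        rep_families_outside)
  show "cs_star F (a + b) = cs_star F a + cs_star F b" if "a \<in> C" "b \<in> C" for a b
    using that by (auto simp: rep_families_simps fam_apply fun_eq_iff hilbert_space.opr_adj_add is_repD(1) rep_families_bounded
        )
  show "cs_star F (cs_scale F c a) = cs_scale F (cnj c) (cs_star F a)" if "a \<in> C" for a c
    using that by (auto simp: rep_families_simps fscale_def fun_eq_iff hilbert_space.opr_adj_vscale is_repD(1) rep_families_bounded
        opr_apply)
  show "cs_star F (cs_mult F a b) = cs_mult F (cs_star F b) (cs_star F a)" if "a \<in> C" "b \<in> C" for a b
    using that by (auto simp: rep_families_simps fun_eq_iff hilbert_space.opr_adj_comp is_repD(1) rep_families_bounded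
        opr_apply)
qed (auto simp: rep_families_simps(1-3) fam_add_closed fam_scale_closed fam_mult_closed fam_star_closed
    fscale_add fscale_add_left fam_norm_nonneg fam_norm_eq_zero fam_norm_scale fam_norm_star_mult fam_complete)

end


section \<open>Closed spans\<close>

context cstar_plus
begin

abbreviation spn where "spn \<equiv> cs_span A"
abbreviation cspn where "cspn \<equiv> cs_closed_span A"

lemma span_zero: "0 \<in> spn X"
  using cs_span.zero[of A X] by (simp add: zero_eq)

lemma span_add: "\<lbrakk>a \<in> spn X; b \<in> spn X\<rbrakk> \<Longrightarrow> a + b \<in> spn X"
  using cs_span.add[of a A X b] by (simp add: add_eq)

lemma span_closed: assumes "X \<subseteq> carr" shows "spn X \<subseteq> carr"
proof
  fix a assume "a \<in> spn X"
  thus "a \<in> carr" using assms by induction (auto simp: zero_closed add_closed scale_closed)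
qed

lemma span_diff: assumes "X \<subseteq> carr" "a \<in> spn X" "b \<in> spn X" shows "a - b \<in> spn X"
  using span_add[OF assms(2) cs_span.scale[OF assms(3), of "-1"]] assms span_closed[OF assms(1)]
  by (auto simp: scale_minus_one)

lemma cspan_iff:
  assumes "X \<subseteq> carr"
  shows "a \<in> cspn X \<longleftrightarrow> a \<in> carr \<and> (\<forall>e>0. \<exists>b \<in> spn X. nm (a - b) < e)"
proof -
  have "cs_minus A a b = a - b" if "b \<in> spn X" for b
    using that span_closed[OF assms] by (auto simp: minus_eq)
  thus ?thesis by (simp add: cs_closed_span_def)
qed

lemma cspan_closed: "cspn X \<subseteq> carr"
  by (auto simp: cs_closed_span_def)

lemma cspan_approx: "\<lbrakk>X \<subseteq> carr; a \<in> cspn X; 0 < e\<rbrakk> \<Longrightarrow> \<exists>b \<in> spn X. nm (a - b) < e"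
  using cspan_iff[of X a] by blast

lemma span_subset_cspan: "X \<subseteq> carr \<Longrightarrow> spn X \<subseteq> cspn X"
proof
  fix a assume X: "X \<subseteq> carr" and a: "a \<in> spn X"
  have "\<exists>b \<in> spn X. nm (a - b) < e" if "0 < e" for e :: real
    using a that by (intro bexI[of _ a]) (simp_all add: nm_zero)
  thus "a \<in> cspn X" using a span_closed[OF X] unfolding cspan_iff[OF X] by blast
qed

lemma cspan_base: "\<lbrakk>X \<subseteq> carr; x \<in> X\<rbrakk> \<Longrightarrow> x \<in> cspn X"
  by (rule subsetD[OF span_subset_cspan cs_span.base])

text \<open>Closing twice gives nothing new. Through this rule closure properties of
  \<open>cspn X\<close> reduce to properties of the algebraic span.\<close>

lemma cspan_limit:
  assumes X: "X \<subseteq> carr" and a: "a \<in> carr" and approx: "\<And>e. 0 < e \<Longrightarrow> \<exists>b \<in> cspn X. nm (a - b) < e"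
  shows "a \<in> cspn X"
  unfolding cspan_iff[OF X]
proof (intro conjI allI impI a)
  fix e :: real assume e: "0 < e"
  obtain b where b: "b \<in> cspn X" "nm (a - b) < e / 2" using approx[of "e / 2"] e by auto
  obtain c where c: "c \<in> spn X" "nm (b - c) < e / 2" using cspan_approx[OF X b(1), of "e / 2"] e by auto
  have "b \<in> carr" "c \<in> carr" using b c cspan_closed span_closed[OF X] by auto
  hence "nm (a - c) < e" using nm_triangle_diff[OF a, of b c] b c by simp
  thus "\<exists>b \<in> spn X. nm (a - b) < e" using c by blast
qed

lemma cspan_zero: "X \<subseteq> carr \<Longrightarrow> 0 \<in> cspn X"
  by (rule subsetD[OF span_subset_cspan span_zero])

lemma cspan_add:
  assumes X: "X \<subseteq> carr" and a: "a \<in> cspn X" "b \<in> cspn X"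
  shows "a + b \<in> cspn X"
proof (rule cspan_limit[OF X])
  have c: "a \<in> carr" "b \<in> carr" using a cspan_closed by auto
  show "a + b \<in> carr" using c by (rule plus_closed)
  fix e :: real assume e: "0 < e"
  obtain a' where a': "a' \<in> spn X" "nm (a - a') < e / 2" using cspan_approx[OF X a(1), of "e / 2"] e by auto
  obtain b' where b': "b' \<in> spn X" "nm (b - b') < e / 2" using cspan_approx[OF X a(2), of "e / 2"] e by auto
  have "a' \<in> carr" "b' \<in> carr" using a' b' span_closed[OF X] by auto
  hence "nm ((a + b) - (a' + b')) < e" using nm_diff_add_le[OF c, of a' b'] a' b' by simp
  thus "\<exists>b'\<in>cspn X. nm (a + b - b') < e" using span_add[OF a'(1) b'(1)] span_subset_cspan[OF X] by blast
qed

lemma cspan_scale: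
  assumes X: "X \<subseteq> carr" and a: "a \<in> cspn X"
  shows "scl c a \<in> cspn X"
proof (rule cspan_limit[OF X])
  have ac: "a \<in> carr" using a cspan_closed by auto
  show "scl c a \<in> carr" using ac by (rule scale_closed)
  fix e :: real assume e: "0 < e"
  have p: "0 < cmod c + 1" by (simp add: add_nonneg_pos)
  obtain a' where a': "a' \<in> spn X" "nm (a - a') < e / (cmod c + 1)"
    using cspan_approx[OF X a, of "e / (cmod c + 1)"] e p by auto
  have a'c: "a' \<in> carr" using a' span_closed[OF X] by auto
  have "nm (scl c a - scl c a') = cmod c * nm (a - a')" by (rule nm_scl_diff[OF ac a'c])
  also have "\<dots> \<le> (cmod c + 1) * nm (a - a')"
    by (intro mult_right_mono norm_nonneg diff_closed ac a'c) simp
  also have "\<dots> < e" using a'(2) p by (simp add: field_simps)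
  finally show "\<exists>b'\<in>cspn X. nm (scl c a - b') < e"
    using cs_span.scale[OF a'(1)] span_subset_cspan[OF X] by blast
qed

lemma span_induct_subset:
  assumes "a \<in> spn X" "0 \<in> Z" "X \<subseteq> Z" "\<And>a b. \<lbrakk>a \<in> Z; b \<in> Z\<rbrakk> \<Longrightarrow> a + b \<in> Z" "\<And>a c. a \<in> Z \<Longrightarrow> scl c a \<in> Z"
  shows "a \<in> Z"
  using assms(1) by induction (use assms in \<open>auto simp: zero_eq add_eq\<close>)

lemma cspan_subset:
  assumes X: "X \<subseteq> carr" and Y: "Y \<subseteq> carr" and sub: "X \<subseteq> cspn Y"
  shows "cspn X \<subseteq> cspn Y"
proof
  fix a assume a: "a \<in> cspn X"
  have "b \<in> cspn Y" if "b \<in> spn X" for b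
    by (rule span_induct_subset[OF that])
      (use sub Y in \<open>auto intro: cspan_zero cspan_add cspan_scale\<close>)
  moreover have "a \<in> carr" using a cspan_closed by blast
  ultimately show "a \<in> cspn Y"
    using cspan_approx[OF X a] by (intro cspan_limit[OF Y]) blast+
qed

lemma span_mul:
  assumes X: "X \<subseteq> carr" and Y: "Y \<subseteq> carr" and Z: "Z \<subseteq> carr"
    and sub: "\<And>x y. \<lbrakk>x \<in> X; y \<in> Y\<rbrakk> \<Longrightarrow> mul x y \<in> cspn Z"
    and a: "a \<in> spn X" and b: "b \<in> spn Y"
  shows "mul a b \<in> cspn Z"
proof -
  note sX = span_closed[OF X] and sY = span_closed[OF Y]
  have 1: "mul x b \<in> cspn Z" if x: "x \<in> X" for x
  proof -
    have xc: "x \<in> carr" using x X by blast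
    have "b \<in> {b \<in> carr. mul x b \<in> cspn Z}"
      by (rule span_induct_subset[OF b])
        (use x xc Y Z sub in \<open>auto simp: mul_add_right mult_scale_right mul_zero intro: closed cspan_zero cspan_add cspan_scale\<close>)
    thus ?thesis by simp
  qed
  have bc: "b \<in> carr" using b sY by blast
  have "a \<in> {a \<in> carr. mul a b \<in> cspn Z}"
    by (rule span_induct_subset[OF a])
      (use bc X Y Z 1 in \<open>auto simp: mul_add_left mult_scale_left mul_zero intro: closed cspan_zero cspan_add cspan_scale\<close>)
  thus ?thesis by simp
qed

lemma cspan_mul:
  assumes X: "X \<subseteq> carr" and Y: "Y \<subseteq> carr" and Z: "Z \<subseteq> carr"
    and sub: "\<And>x y. \<lbrakk>x \<in> X; y \<in> Y\<rbrakk> \<Longrightarrow> mul x y \<in> cspn Z"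
    and a: "a \<in> cspn X" and b: "b \<in> cspn Y"
  shows "mul a b \<in> cspn Z"
proof (rule cspan_limit[OF Z])
  have c: "a \<in> carr" "b \<in> carr" using a b cspan_closed by auto
  show "mul a b \<in> carr" using c by (rule mult_closed)
  fix e :: real assume e: "0 < e"
  define K where "K = nm b + nm a + 1"
  have K: "0 < K" "nm b \<le> K" "nm a \<le> K - 1" using norm_nonneg[OF c(1)] norm_nonneg[OF c(2)] by (auto simp: K_def)
  \<comment> \<open>The bound \<open>d \<le> 1\<close> keeps \<open>nm a'\<close> below
    \<open>nm a + 1 \<le> K\<close>. Both error terms are then at most
    \<open>d * K \<le> e / 4\<close>.\<close>
  define d where "d = min 1 (e / (4 * K))"
  have d: "0 < d" "d \<le> 1" "d * K \<le> e / 4" using e K by (auto simp: d_def min_def field_simps)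
  obtain a' where a': "a' \<in> spn X" "nm (a - a') < d" using cspan_approx[OF X a d(1)] by auto
  obtain b' where b': "b' \<in> spn Y" "nm (b - b') < d" using cspan_approx[OF Y b d(1)] by auto
  have c': "a' \<in> carr" "b' \<in> carr" using a' b' span_closed[OF X] span_closed[OF Y] by auto
  have "nm a' \<le> nm (a' - a) + nm a" by (rule nm_diff_le[OF c'(1) c(1)])
  also have "\<dots> \<le> K" using a'(2) d(2) K(3) nm_minus_commute[OF c(1) c'(1)] by simp
  finally have na': "nm a' \<le> K" .
  have "nm (mul a b - mul a' b') \<le> nm (a - a') * nm b + nm a' * nm (b - b')"
    by (rule nm_mul_diff_le[OF c c'])
  also have "\<dots> \<le> d * K + K * d"
    using a'(2) b'(2) na' K d by (intro add_mono mult_mono norm_nonneg diff_closed c c') auto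
  also have "\<dots> < e" using d e by (simp add: mult.commute)
  finally show "\<exists>b'\<in>cspn Z. nm (mul a b - b') < e"
    using span_mul[OF X Y Z sub a'(1) b'(1)] by blast
qed

lemma cspan_str:
  assumes X: "X \<subseteq> carr" and Z: "Z \<subseteq> carr" and sub: "\<And>x. x \<in> X \<Longrightarrow> str x \<in> cspn Z" and a: "a \<in> cspn X"
  shows "str a \<in> cspn Z"
proof (rule cspan_limit[OF Z])
  have c: "a \<in> carr" using a cspan_closed by auto
  show "str a \<in> carr" using c by (rule star_closed)
  fix e :: real assume e: "0 < e"
  obtain a' where a': "a' \<in> spn X" "nm (a - a') < e" using cspan_approx[OF X a e] by auto
  have "a' \<in> {a' \<in> carr. str a' \<in> cspn Z}"
    by (rule span_induct_subset[OF a'(1)])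
      (use X Z sub in \<open>auto simp: str_add star_scale str_zero intro: closed cspan_zero cspan_add cspan_scale\<close>)
  thus "\<exists>b'\<in>cspn Z. nm (str a - b') < e"
    using a'(2) c nm_str[of "a - a'"] by (intro bexI[of _ "str a'"]) (auto simp: str_diff diff_closed)
qed

lemma cstar_plus_restrict:
  assumes X: "X \<subseteq> carr" and mult: "\<And>x y. \<lbrakk>x \<in> X; y \<in> X\<rbrakk> \<Longrightarrow> mul x y \<in> cspn X"
    and star: "\<And>x. x \<in> X \<Longrightarrow> str x \<in> cspn X"
  shows "cstar_plus (cs_restrict A (cspn X))"
proof -
  have c: "a \<in> cspn X \<Longrightarrow> a \<in> carr" for a using cspan_closed by blast
  have "\<exists>a\<in>cspn X. (\<lambda>n. nm (F n - a)) \<longlonglongrightarrow> 0"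
    if F: "\<And>n. F n \<in> cspn X" and cauchy: "\<And>e. 0 < e \<Longrightarrow> \<exists>M. \<forall>m\<ge>M. \<forall>n\<ge>M. nm (F m - F n) < e" for F
  proof -
    obtain a where a: "a \<in> carr" and lim: "(\<lambda>n. nm (F n - a)) \<longlonglongrightarrow> 0"
      using complete[of F] c[OF F] cauchy by (auto simp: minus_eq)
    have "a \<in> cspn X"
    proof (rule cspan_limit[OF X a])
      fix e :: real assume "0 < e"
      then obtain n where "nm (F n - a) < e"
        using LIMSEQ_D[OF lim] norm_nonneg[OF diff_closed[OF c[OF F] a]] by fastforce
      hence "nm (a - F n) < e" using nm_minus_commute[OF a c[OF F]] by simp
      thus "\<exists>b\<in>cspn X. nm (a - b) < e" using F by blast
    qed
    thus ?thesis using lim by blast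
  qed
  moreover have "cs_minus (cs_restrict A (cspn X)) = cs_minus A"
    by (simp add: cs_minus_def cs_restrict_def fun_eq_iff)
  moreover note cspan_zero[OF X] cspan_add[OF X] cspan_scale[OF X]
  ultimately show ?thesis
    by unfold_locales
      (auto simp: cs_restrict_def add_eq zero_eq minus_eq c X
        add_assoc[unfolded add_eq] add_commute[unfolded add_eq] scale_one scale_scale scale_add_left[unfolded add_eq]
        scl_add mult_assoc mul_add_left mul_add_right mult_scale_left mult_scale_right star_star str_add star_scale
        star_mult norm_nonneg nm_eq_zero nm_triangle norm_scale norm_mult cstar_identity
        intro: cspan_mul[OF X X X mult] cspan_str[OF X X star])
qed

end

lemma cs_restrict_simps [simp]:
  "cs_carrier (cs_restrict A S) = S" "cs_zero (cs_restrict A S) = cs_zero A" "cs_add (cs_restrict A S) = cs_add A"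
  "cs_scale (cs_restrict A S) = cs_scale A" "cs_mult (cs_restrict A S) = cs_mult A" "cs_star (cs_restrict A S) = cs_star A"
  "cs_norm (cs_restrict A S) = cs_norm A"
  by (simp_all add: cs_restrict_def)

lemma cs_minus_restrict [simp]: "cs_minus (cs_restrict A S) = cs_minus A"
  by (simp add: cs_minus_def fun_eq_iff)

lemma cs_span_restrict [simp]: "cs_span (cs_restrict A S) X = cs_span A X"
proof -
  have 1: "a \<in> cs_span A X" if "a \<in> cs_span (cs_restrict A S) X" for a
    using that by induction (auto intro: cs_span.intros)
  have 2: "a \<in> cs_span (cs_restrict A S) X" if "a \<in> cs_span A X" for a
    using that
  proof induction
    case zero thus ?case using cs_span.zero[of "cs_restrict A S" X] by simp
  next
    case base thus ?case by (rule cs_span.base)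
  next
    case (add a b) thus ?case using cs_span.add[of a "cs_restrict A S" X b] by simp
  next
    case (scale a c) thus ?case using cs_span.scale[of a "cs_restrict A S" X c] by simp
  qed
  show ?thesis using 1 2 by blast
qed


section \<open>Inverse semigroups\<close>

context inverse_semigroup
begin

abbreviation mlt (infixl "\<cdot>" 70) where "g \<cdot> h \<equiv> sg_mult I g h"
abbreviation iv where "iv \<equiv> sg_inv I"
abbreviation elts where "elts \<equiv> sg_carrier I"

lemma inv_props:
  assumes "g \<in> elts"
  shows inv_closed: "iv g \<in> elts" and mult_inv_mult: "g \<cdot> iv g \<cdot> g = g" and inv_mult_inv: "iv g \<cdot> g \<cdot> iv g = iv g"
  using theI'[OF ex1_inverse[OF assms]] unfolding sg_inv_def by auto

lemma inv_unique: "\<lbrakk>g \<in> elts; h \<in> elts; g \<cdot> h \<cdot> g = g; h \<cdot> g \<cdot> h = h\<rbrakk> \<Longrightarrow> iv g = h"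
  using ex1_inverse[of g] inv_props[of g] by blast

lemma inv_inv: "g \<in> elts \<Longrightarrow> iv (iv g) = g"
  by (rule inv_unique) (simp_all add: inv_props)

lemma inv_idem: "\<lbrakk>p \<in> elts; p \<cdot> p = p\<rbrakk> \<Longrightarrow> iv p = p"
  by (rule inv_unique) simp_all

text \<open>Let \<open>x\<close> be the inverse of \<open>e \<cdot> f\<close>. Then
  \<open>f \<cdot> x \<cdot> e\<close> is an inverse too, so it equals \<open>x\<close>; this form
  makes \<open>x\<close> idempotent. An idempotent is its own inverse, so
  \<open>e \<cdot> f = x\<close>.\<close>

lemma idem_mult_idem:
  assumes e: "e \<in> elts" "e \<cdot> e = e" and f: "f \<in> elts" "f \<cdot> f = f"
  shows "(e \<cdot> f) \<cdot> (e \<cdot> f) = e \<cdot> f"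
proof -
  define x where "x = iv (e \<cdot> f)"
  note cl = e(1) f(1) mult_closed
  have x: "x \<in> elts" unfolding x_def by (intro inv_closed cl)
  have efx: "e \<cdot> (f \<cdot> (x \<cdot> (e \<cdot> f))) = e \<cdot> f" "x \<cdot> (e \<cdot> (f \<cdot> x)) = x"
    using mult_inv_mult[of "e \<cdot> f"] inv_mult_inv[of "e \<cdot> f"] x by (simp_all add: x_def[symmetric] cl mult_assoc)
  have ee: "e \<cdot> (e \<cdot> k) = e \<cdot> k" "f \<cdot> (f \<cdot> k) = f \<cdot> k" if "k \<in> elts" for k
    using that e f mult_assoc[of e e k] mult_assoc[of f f k] by auto
  have "iv (e \<cdot> f) = f \<cdot> x \<cdot> e"
  proof (rule inv_unique)
    show "e \<cdot> f \<cdot> (f \<cdot> x \<cdot> e) \<cdot> (e \<cdot> f) = e \<cdot> f" by (simp add: cl x mult_assoc ee efx)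
    have "f \<cdot> x \<cdot> e \<cdot> (e \<cdot> f) \<cdot> (f \<cdot> x \<cdot> e) = f \<cdot> ((x \<cdot> (e \<cdot> (f \<cdot> x))) \<cdot> e)"
      by (simp add: cl x mult_assoc ee)
    thus "f \<cdot> x \<cdot> e \<cdot> (e \<cdot> f) \<cdot> (f \<cdot> x \<cdot> e) = f \<cdot> x \<cdot> e" by (simp add: efx cl x mult_assoc)
  qed (auto simp: cl x)
  hence xe: "x = f \<cdot> x \<cdot> e" by (simp add: x_def)
  have "x \<cdot> x = (f \<cdot> x \<cdot> e) \<cdot> (f \<cdot> x \<cdot> e)" using xe by simp
  also have "\<dots> = f \<cdot> ((x \<cdot> (e \<cdot> (f \<cdot> x))) \<cdot> e)" by (simp add: cl x mult_assoc)
  also have "\<dots> = x" using xe by (simp add: efx cl x mult_assoc)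
  finally have xx: "x \<cdot> x = x" .
  have "e \<cdot> f = iv x" unfolding x_def by (rule inv_inv[symmetric]) (intro cl)
  also have "\<dots> = x" by (rule inv_idem[OF x xx])
  finally show ?thesis using xx by simp
qed

text \<open>Both \<open>e \<cdot> f\<close> and \<open>f \<cdot> e\<close> are inverses of
  \<open>e \<cdot> f\<close>.\<close>

lemma idem_commute:
  assumes e: "e \<in> elts" "e \<cdot> e = e" and f: "f \<in> elts" "f \<cdot> f = f"
  shows "e \<cdot> f = f \<cdot> e"
proof -
  note cl = e(1) f(1) mult_closed
  have ee: "e \<cdot> (e \<cdot> k) = e \<cdot> k" "f \<cdot> (f \<cdot> k) = f \<cdot> k" if "k \<in> elts" for k
    using that e f mult_assoc[of e e k] mult_assoc[of f f k] by auto
  have ef: "e \<cdot> (f \<cdot> (e \<cdot> f)) = e \<cdot> f" and fe: "f \<cdot> (e \<cdot> (f \<cdot> e)) = f \<cdot> e"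
    using idem_mult_idem[OF e f] idem_mult_idem[OF f e] by (auto simp: cl mult_assoc)
  have "iv (e \<cdot> f) = f \<cdot> e"
    by (rule inv_unique) (auto simp: cl mult_assoc ee ef fe)
  moreover have "iv (e \<cdot> f) = e \<cdot> f"
    by (rule inv_idem) (auto simp: cl idem_mult_idem[OF e f])
  ultimately show ?thesis by simp
qed

lemma inv_mult_idem: "g \<in> elts \<Longrightarrow> (iv g \<cdot> g) \<cdot> (iv g \<cdot> g) = iv g \<cdot> g"
  and mult_inv_idem: "g \<in> elts \<Longrightarrow> (g \<cdot> iv g) \<cdot> (g \<cdot> iv g) = g \<cdot> iv g"
  by (simp_all add: mult_assoc[symmetric] mult_closed inv_closed mult_inv_mult inv_mult_inv)

lemma inv_mult:
  assumes g: "g \<in> elts" and h: "h \<in> elts"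
  shows "iv (g \<cdot> h) = iv h \<cdot> iv g"
proof (rule inv_unique)
  note cl = g h mult_closed inv_closed
  have comm: "(h \<cdot> iv h) \<cdot> (iv g \<cdot> g) = (iv g \<cdot> g) \<cdot> (h \<cdot> iv h)"
    by (rule idem_commute) (simp_all add: cl inv_mult_idem mult_inv_idem)
  have "g \<cdot> h \<cdot> (iv h \<cdot> iv g) \<cdot> (g \<cdot> h) = g \<cdot> ((h \<cdot> iv h) \<cdot> (iv g \<cdot> g)) \<cdot> h"
    by (simp add: cl mult_assoc)
  also have "\<dots> = (g \<cdot> iv g \<cdot> g) \<cdot> (h \<cdot> iv h \<cdot> h)" unfolding comm by (simp add: cl mult_assoc)
  finally show "g \<cdot> h \<cdot> (iv h \<cdot> iv g) \<cdot> (g \<cdot> h) = g \<cdot> h" by (simp add: g h mult_inv_mult)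
  have "iv h \<cdot> iv g \<cdot> (g \<cdot> h) \<cdot> (iv h \<cdot> iv g) = iv h \<cdot> ((iv g \<cdot> g) \<cdot> (h \<cdot> iv h)) \<cdot> iv g"
    by (simp add: cl mult_assoc)
  also have "\<dots> = (iv h \<cdot> h \<cdot> iv h) \<cdot> (iv g \<cdot> g \<cdot> iv g)" unfolding comm[symmetric] by (simp add: cl mult_assoc)
  finally show "iv h \<cdot> iv g \<cdot> (g \<cdot> h) \<cdot> (iv h \<cdot> iv g) = iv h \<cdot> iv g" by (simp add: g h inv_mult_inv)
qed (simp_all add: g h mult_closed inv_closed)

lemma is_zero_closed: "is_zero I z \<Longrightarrow> z \<in> elts"
  and zero_mult: "\<lbrakk>is_zero I z; g \<in> elts\<rbrakk> \<Longrightarrow> z \<cdot> g = z"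
  and mult_zero: "\<lbrakk>is_zero I z; g \<in> elts\<rbrakk> \<Longrightarrow> g \<cdot> z = z"
  by (auto simp: is_zero_def)

lemma inv_zero: "is_zero I z \<Longrightarrow> iv z = z"
  by (rule inv_idem) (auto simp: is_zero_def)

lemma is_zero_inv: "g \<in> elts \<Longrightarrow> is_zero I (iv g) \<longleftrightarrow> is_zero I g"
  using inv_inv inv_zero by metis

lemma nonzero_factors:
  assumes "g \<in> elts" "h \<in> elts" "\<not> is_zero I (g \<cdot> h)"
  shows "\<not> is_zero I g" "\<not> is_zero I h"
  using assms by (auto simp: zero_mult mult_zero)

end


section \<open>The C*-algebra of an inverse semigroup\<close>

context hilbert_space
begin

text \<open>The operator \<open>P = T\<^sup>* T\<close> is a projection, so the C*-identity reads
  \<open>\<parallel>P\<parallel> = \<parallel>P\<parallel>\<^sup>2\<close>.\<close>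

lemma opr_norm_partial_isometry:
  assumes T: "bounded_opr H T" and pi: "T \<circ> opr_adj H T \<circ> T = T"
  shows "opr_norm H T \<le> 1"
proof -
  let ?P = "opr_adj H T \<circ> T"
  have P: "bounded_opr H ?P" using T by (simp add: bounded_opr_adj bounded_opr_comp)
  have adjP: "opr_adj H ?P = ?P" using T by (simp add: opr_adj_comp bounded_opr_adj opr_adj_adj)
  have "?P \<circ> ?P = ?P" using pi by (simp add: comp_assoc)
  hence "opr_norm H ?P = (opr_norm H ?P)\<^sup>2" using opr_norm_adj_comp[OF P] adjP by simp
  hence "opr_norm H ?P \<le> 1" by (metis le_numeral_extra(4) mult_cancel_left2 power2_eq_square zero_le_one)
  hence "(opr_norm H T)\<^sup>2 \<le> 1\<^sup>2" using opr_norm_adj_comp[OF T] by simp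
  thus ?thesis by (rule power2_le_imp_le) simp
qed

end

lemma univ_gen_rep: "is_rep I r \<Longrightarrow> univ_gen I g r = snd r g"
  by (simp add: univ_gen_def)

lemma univ_gen_closed: "g \<in> sg_carrier I \<Longrightarrow> univ_gen I g \<in> cs_carrier (rep_families I)"
  by (rule rep_familiesI[of _ _ 1])
    (auto simp: univ_gen_def ozero_eq is_repD hilbert_space.opr_norm_partial_isometry)

context inverse_semigroup
begin

abbreviation V where "V \<equiv> univ_gen I"

sublocale F: cstar_plus "rep_families I"
  by (rule cstar_plus_rep_families)

lemma V_mult: "\<lbrakk>g \<in> elts; h \<in> elts\<rbrakk> \<Longrightarrow> cs_mult (rep_families I) (V g) (V h) = V (g \<cdot> h)"
  by (auto simp: rep_families_simps univ_gen_def ozero_eq fun_eq_iff is_repD opr_apply)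

lemma V_star: "g \<in> elts \<Longrightarrow> cs_star (rep_families I) (V g) = V (iv g)"
  by (auto simp: rep_families_simps univ_gen_def ozero_eq fun_eq_iff is_repD)

lemma V_zero: "is_zero I z \<Longrightarrow> V z = 0"
  by (auto simp: univ_gen_def ozero_eq fun_eq_iff is_repD fam_apply)

lemma V_subset: "V ` elts \<subseteq> cs_carrier (rep_families I)"
  by (auto intro: univ_gen_closed)

sublocale A: cstar_plus "C0star I"
  unfolding C0star_def
  by (rule F.cstar_plus_restrict[OF V_subset])
    (auto simp: V_mult V_star intro!: F.cspan_base[OF V_subset] mult_closed inv_closed)

lemma C0star_simps:
  "cs_add (C0star I) = (+)" "cs_zero (C0star I) = 0" "cs_scale (C0star I) = fscale"
  "cs_mult (C0star I) = cs_mult (rep_families I)" "cs_star (C0star I) = cs_star (rep_families I)"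
  "cs_norm (C0star I) = cs_norm (rep_families I)"
  by (simp_all add: C0star_def rep_families_simps)

lemma C0star_closed_rep_families: "cs_carrier (C0star I) \<subseteq> cs_carrier (rep_families I)"
  using F.cspan_closed by (simp add: C0star_def)

lemma V_closed: "g \<in> elts \<Longrightarrow> V g \<in> cs_carrier (C0star I)"
  by (simp add: C0star_def F.cspan_base[OF V_subset])

lemma V_subset_A: "S \<subseteq> elts \<Longrightarrow> V ` S \<subseteq> cs_carrier (C0star I)"
  by (auto intro: V_closed)

lemma mul_V: "\<lbrakk>g \<in> elts; h \<in> elts\<rbrakk> \<Longrightarrow> A.mul (V g) (V h) = V (g \<cdot> h)"
  and str_V: "g \<in> elts \<Longrightarrow> A.str (V g) = V (iv g)"
  by (simp_all add: C0star_simps V_mult V_star)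

text \<open>From here on approximation takes place inside \<open>C0star I\<close> instead of among
  all bounded families.\<close>

lemma C0star_carrier: "cs_carrier (C0star I) = A.cspn (V ` elts)"
proof -
  have "A.cspn (V ` elts) = F.cspn (V ` elts) \<inter> cs_carrier (C0star I)"
    using C0star_closed_rep_families by (auto simp: C0star_def cs_closed_span_def)
  thus ?thesis by (simp add: C0star_def)
qed

section \<open>Finite linear combinations of the generators\<close>

definition lin :: "'a set \<Rightarrow> ('a \<Rightarrow> complex) \<Rightarrow> ('a, 'a) rep \<Rightarrow> 'a opr" where
  "lin S c = (\<Sum>g\<in>S. fscale (c g) (V g))"

lemma lin_closed: "S \<subseteq> elts \<Longrightarrow> lin S c \<in> cs_carrier (C0star I)"
  unfolding lin_def
  by (induction S rule: infinite_finite_induct)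
    (auto simp: A.null_closed intro!: A.plus_closed A.scale_closed[unfolded C0star_simps] V_closed)

lemma lin_in_span: "S \<subseteq> T \<Longrightarrow> lin S c \<in> A.spn (V ` T)"
proof -
  have "fscale k (V g) \<in> A.spn (V ` T)" if "g \<in> T" for k g
    using cs_span.scale[OF cs_span.base, of "V g" "V ` T" "C0star I" k] that by (simp add: C0star_simps)
  thus "S \<subseteq> T \<Longrightarrow> lin S c \<in> A.spn (V ` T)"
    unfolding lin_def
    by (induction S rule: infinite_finite_induct) (simp_all add: A.span_zero A.span_add)
qed

lemma lin_mono: "\<lbrakk>finite T; S \<subseteq> T\<rbrakk> \<Longrightarrow> lin S c = lin T (\<lambda>g. if g \<in> S then c g else 0)"
  unfolding lin_def by (rule sum.mono_neutral_cong_left) auto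

lemma span_lin: "x \<in> A.spn (V ` T) \<Longrightarrow> \<exists>S c. finite S \<and> S \<subseteq> T \<and> x = lin S c"
proof (induction rule: cs_span.induct)
  case zero
  show ?case by (intro exI[of _ "{}"]) (simp add: lin_def C0star_simps)
next
  case (base x)
  then obtain g where "g \<in> T" "x = V g" by auto
  thus ?case by (intro exI[of _ "{g}"] exI[of _ "\<lambda>_. 1"]) (simp add: lin_def)
next
  case (add a b)
  then obtain S c S' c' where "finite S" "S \<subseteq> T" "a = lin S c" "finite S'" "S' \<subseteq> T" "b = lin S' c'" by auto
  thus ?case
    using lin_mono[of "S \<union> S'" S c] lin_mono[of "S \<union> S'" S' c']
    by (intro exI[of _ "S \<union> S'"] exI[of _ "\<lambda>g. (if g \<in> S then c g else 0) + (if g \<in> S' then c' g else 0)"])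
      (simp add: lin_def C0star_simps fscale_add_left sum.distrib)
next
  case (scale a k)
  then obtain S c where "finite S" "S \<subseteq> T" "a = lin S c" by auto
  thus ?case
    by (intro exI[of _ S] exI[of _ "\<lambda>g. k * c g"]) (simp add: lin_def C0star_simps fscale_sum)
qed

end


section \<open>Reproducing kernel Hilbert spaces\<close>

text \<open>Hermitian symmetry is demanded separately, since only the real part of the quadratic
  form is required to be nonnegative.\<close>

definition pd_on :: "'x set \<Rightarrow> ('x \<Rightarrow> 'x \<Rightarrow> complex) \<Rightarrow> bool" where
  "pd_on X K \<longleftrightarrow> (\<forall>x\<in>X. \<forall>y\<in>X. K y x = cnj (K x y)) \<and>
     (\<forall>S c. finite S \<longrightarrow> S \<subseteq> X \<longrightarrow> 0 \<le> Re (\<Sum>x\<in>S. \<Sum>y\<in>S. c x * cnj (c y) * K x y))"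

lemma sum_regroup:
  fixes c G :: "_ \<Rightarrow> complex"
  assumes "finite A"
  shows "(\<Sum>i\<in>A. c i * G (x i)) = (\<Sum>u\<in>x ` A. (\<Sum>i | i \<in> A \<and> x i = u. c i) * G u)"
  by (subst sum.image_gen[OF assms, of _ x]) (auto simp: sum_distrib_right intro!: sum.cong)

lemma sum_regroup_double:
  fixes K :: "'x \<Rightarrow> 'x \<Rightarrow> complex"
  assumes A: "finite A"
  shows "(\<Sum>i\<in>A. \<Sum>j\<in>A. c i * cnj (c j) * K (x i) (x j)) =
    (\<Sum>u\<in>x ` A. \<Sum>v\<in>x ` A. (\<Sum>i | i \<in> A \<and> x i = u. c i) * cnj (\<Sum>i | i \<in> A \<and> x i = v. c i) * K u v)"
proof -
  let ?d = "\<lambda>u. \<Sum>i | i \<in> A \<and> x i = u. c i"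
  have "(\<Sum>i\<in>A. \<Sum>j\<in>A. c i * cnj (c j) * K (x i) (x j)) = (\<Sum>i\<in>A. c i * (\<Sum>j\<in>A. cnj (c j) * K (x i) (x j)))"
    by (simp add: sum_distrib_left mult.assoc)
  also have "\<dots> = (\<Sum>u\<in>x ` A. ?d u * (\<Sum>j\<in>A. cnj (c j) * K u (x j)))"
    by (rule sum_regroup[OF A])
  also have "\<dots> = (\<Sum>u\<in>x ` A. ?d u * (\<Sum>v\<in>x ` A. cnj (?d v) * K u v))"
  proof (rule sum.cong[OF refl])
    fix u
    show "?d u * (\<Sum>j\<in>A. cnj (c j) * K u (x j)) = ?d u * (\<Sum>v\<in>x ` A. cnj (?d v) * K u v)"
      by (subst sum_regroup[OF A]) simp
  qed
  also have "\<dots> = (\<Sum>u\<in>x ` A. \<Sum>v\<in>x ` A. ?d u * cnj (?d v) * K u v)"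
    by (simp add: sum_distrib_left mult.assoc del: cnj_sum)
  finally show ?thesis .
qed

text \<open>Positivity for points that may repeat: coefficients at equal points are added up. This
  permits substitutions such as \<open>g \<mapsto> p \<cdot> g\<close> that are not
  injective.\<close>

lemma pd_on_indexed:
  assumes K: "pd_on X K" and A: "finite A" "x ` A \<subseteq> X"
  shows "0 \<le> Re (\<Sum>i\<in>A. \<Sum>j\<in>A. c i * cnj (c j) * K (x i) (x j))"
proof -
  have *: "0 \<le> Re (\<Sum>u\<in>S. \<Sum>v\<in>S. d u * cnj (d v) * K u v)" if "finite S" "S \<subseteq> X" for S d
    using K that unfolding pd_on_def by blast
  show ?thesis unfolding sum_regroup_double[OF A(1)] by (rule *) (use A in auto)
qed

section \<open>The span of the kernel functions and its completion\<close>

locale pd_kernel =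
  fixes K :: "'x \<Rightarrow> 'x \<Rightarrow> complex"
  assumes pd: "pd_on UNIV K"
begin

definition comb :: "'x set \<Rightarrow> ('x \<Rightarrow> complex) \<Rightarrow> 'x vec" where
  "comb S c = (\<lambda>y. \<Sum>x\<in>S. c x * K x y)"

lemma pd_sum: "finite S \<Longrightarrow> 0 \<le> Re (\<Sum>x\<in>S. \<Sum>y\<in>S. c x * cnj (c y) * K x y)"
  using pd unfolding pd_on_def by blast

lemma K_cnj: "cnj (K x y) = K y x"
  using pd unfolding pd_on_def by (metis UNIV_I)

text \<open>If \<open>v\<close> is a combination of kernel functions, the reproducing property
  leaves only one possible value for the inner product with \<open>v\<close>: a weighted sum of
  values of \<open>u\<close>. By \<open>comb_swap\<close> it does not depend on the chosen expansion
  of \<open>v\<close>.\<close>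

definition H0 :: "'x hilb" where
  "H0 = \<lparr> hvecs = {comb S c | S c. finite S},
     hip = (\<lambda>u v. let (T, d) = SOME (T, d). finite T \<and> v = comb T d in \<Sum>y\<in>T. cnj (d y) * u y) \<rparr>"

lemma H0I: "finite S \<Longrightarrow> comb S c \<in> hvecs H0"
  by (auto simp: H0_def)

lemma H0E: assumes "u \<in> hvecs H0" obtains S c where "finite S" "u = comb S c"
  using assms by (auto simp: H0_def)

text \<open>Both sides are the double sum of \<open>c x * cnj (d y) * K x y\<close>. The left side
  sees only the values of the first function and the right side only those of the second, so neither
  expansion matters.\<close>

lemma comb_swap: "(\<Sum>y\<in>T. cnj (d y) * comb S c y) = (\<Sum>x\<in>S. c x * cnj (comb T d x))"
  unfolding comb_def sum_distrib_left cnj_sum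
  by (subst sum.swap) (simp add: K_cnj sum_distrib_left mult_ac)

lemma ip0_comb:
  assumes u: "u \<in> hvecs H0" and T: "finite T"
  shows "hip H0 u (comb T d) = (\<Sum>y\<in>T. cnj (d y) * u y)"
proof -
  obtain S c where S: "u = comb S c" using u by (rule H0E)
  obtain T' d' where P: "(SOME (T', d'). finite T' \<and> comb T d = comb T' d') = (T', d')" by fastforce
  have "\<exists>p. case p of (T', d') \<Rightarrow> finite T' \<and> comb T d = comb T' d'" using T by (intro exI[of _ "(T, d)"]) simp
  from someI_ex[OF this] have eq: "comb T d = comb T' d'" using P by simp
  have "hip H0 u (comb T d) = (\<Sum>y\<in>T'. cnj (d' y) * u y)" by (simp add: H0_def P)
  also have "\<dots> = (\<Sum>x\<in>S. c x * cnj (comb T' d' x))" unfolding S by (rule comb_swap)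
  also have "\<dots> = (\<Sum>y\<in>T. cnj (d y) * u y)" unfolding eq[symmetric] S by (rule comb_swap[symmetric])
  finally show ?thesis .
qed

lemma comb_mono: "\<lbrakk>finite T; S \<subseteq> T\<rbrakk> \<Longrightarrow> comb S c = comb T (\<lambda>x. if x \<in> S then c x else 0)"
  unfolding comb_def by (intro ext sum.mono_neutral_cong_left) auto

lemma comb_add:
  assumes "finite S" "finite T"
  shows "comb S c + comb T d = comb (S \<union> T) (\<lambda>x. (if x \<in> S then c x else 0) + (if x \<in> T then d x else 0))"
  using assms comb_mono[of "S \<union> T" S c] comb_mono[of "S \<union> T" T d]
  by (simp add: comb_def fun_eq_iff fun_apply distrib_right sum.distrib)

lemma comb_vscale: "vscale k (comb S c) = comb S (\<lambda>x. k * c x)"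
  by (simp add: comb_def vscale_def sum_distrib_left mult.assoc)

lemma comb_single: "comb {x} (\<lambda>_. 1) = K x"
  by (simp add: comb_def)

lemma K_mem_H0: "K x \<in> hvecs H0"
  using H0I[of "{x}" "\<lambda>_. 1"] by (simp add: comb_single)

lemma ip0_K: "u \<in> hvecs H0 \<Longrightarrow> hip H0 u (K x) = u x"
  using ip0_comb[of u "{x}" "\<lambda>_. 1"] by (simp add: comb_single)

lemma H0_add: "\<lbrakk>u \<in> hvecs H0; v \<in> hvecs H0\<rbrakk> \<Longrightarrow> u + v \<in> hvecs H0"
  by (elim H0E) (simp add: comb_add H0I)

lemma H0_vscale: "u \<in> hvecs H0 \<Longrightarrow> vscale k u \<in> hvecs H0"
  by (elim H0E) (simp add: comb_vscale H0I)

lemma ip0_add: "\<lbrakk>u \<in> hvecs H0; v \<in> hvecs H0; w \<in> hvecs H0\<rbrakk> \<Longrightarrow> hip H0 (u + v) w = hip H0 u w + hip H0 v w"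
  by (erule H0E[of w]) (simp add: ip0_comb H0_add fun_apply distrib_left sum.distrib)

lemma ip0_vscale: "\<lbrakk>u \<in> hvecs H0; w \<in> hvecs H0\<rbrakk> \<Longrightarrow> hip H0 (vscale k u) w = k * hip H0 u w"
  by (erule H0E[of w]) (simp add: ip0_comb H0_vscale vscale_apply sum_distrib_left mult_ac)

lemma ip0_cnj: "\<lbrakk>u \<in> hvecs H0; w \<in> hvecs H0\<rbrakk> \<Longrightarrow> hip H0 w u = cnj (hip H0 u w)"
  by (erule H0E[of w], erule H0E[of u]) (simp add: ip0_comb H0I comb_swap cnj_sum mult.commute)

lemma ip0_nonneg: assumes "u \<in> hvecs H0" shows "0 \<le> Re (hip H0 u u)"
proof -
  obtain S c where S: "finite S" "u = comb S c" using assms by (rule H0E)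
  have "hip H0 u u = (\<Sum>y\<in>S. \<Sum>x\<in>S. c x * cnj (c y) * K x y)"
    using S by (simp add: ip0_comb H0I) (simp add: comb_def sum_distrib_left mult_ac)
  also have "\<dots> = (\<Sum>x\<in>S. \<Sum>y\<in>S. c x * cnj (c y) * K x y)" by (rule sum.swap)
  finally show ?thesis using pd_sum[OF S(1)] by simp
qed

sublocale P: prehilbert H0
proof
  have "comb {} undefined = 0" by (simp add: comb_def fun_eq_iff fun_apply)
  thus "0 \<in> hvecs H0" using H0I[of "{}" undefined] by simp
  fix u assume u: "u \<in> hvecs H0" and "u \<noteq> 0"
  then obtain y where y: "u y \<noteq> 0" by (auto simp: fun_eq_iff fun_apply)
  define k where "k = Re (K y y)"
  have Kyy: "K y y = of_real k" using K_cnj[of y y] by (auto simp: complex_eq_iff k_def)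
  have k: "0 \<le> k" using ip0_nonneg[OF K_mem_H0, of y] K_mem_H0 by (simp add: ip0_K k_def)
  \<comment> \<open>Definiteness comes from the Cauchy-Schwarz inequality for \<open>u y\<close>,
    the product of \<open>u\<close> with \<open>K y\<close>. At this point the form is only known to
    be nonnegative, so the argument is carried out by hand with \<open>w = u + t K y\<close>. The
    denominator \<open>k + 1\<close> instead of \<open>k\<close> covers
    \<open>K y y = 0\<close>.\<close>
  define t where "t = - u y / of_real (k + 1)"
  have t: "cnj t * u y = of_real (- (cmod (u y))\<^sup>2 / (k + 1))" "t * cnj t = of_real ((cmod (u y))\<^sup>2 / (k + 1)\<^sup>2)"
    using complex_norm_square[of "u y"] by (auto simp: t_def mult.commute power2_eq_square)
  define w where "w = u + vscale t (K y)"
  have mem: "u \<in> hvecs H0" "K y \<in> hvecs H0" "vscale t (K y) \<in> hvecs H0" "w \<in> hvecs H0"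
    using u by (auto simp: w_def intro: H0_add H0_vscale K_mem_H0)
  have r: "hip H0 v (vscale t (K y)) = cnj t * v y" if "v \<in> hvecs H0" for v
    using ip0_cnj[OF mem(3) that] ip0_vscale[OF mem(2) that, of t] ip0_cnj[OF mem(2) that] that by (simp add: ip0_K)
  have uw: "hip H0 v w = hip H0 v u + cnj t * v y" if "v \<in> hvecs H0" for v
    using ip0_cnj[OF mem(4) that] ip0_add[OF mem(1,3) that] ip0_cnj[OF mem(1) that] ip0_cnj[OF mem(3) that] r[OF that]
    by (simp add: w_def)
  have "hip H0 w w = hip H0 u w + t * hip H0 (K y) w"
    unfolding w_def by (subst ip0_add, unfold w_def[symmetric]) (use mem in \<open>auto simp: ip0_vscale\<close>)
  also have "\<dots> = hip H0 u u + cnj t * u y + t * (cnj (u y) + cnj t * K y y)"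
    using mem ip0_cnj[OF mem(1,2)] by (simp add: uw ip0_K)
  finally have "Re (hip H0 w w) = Re (hip H0 u u) + Re (cnj t * u y) + Re (cnj (cnj t * u y)) + k * Re (t * cnj t)"
    by (simp add: Kyy algebra_simps)
  also have "\<dots> = Re (hip H0 u u) - 2 * ((cmod (u y))\<^sup>2 / (k + 1)) + k * ((cmod (u y))\<^sup>2 / (k + 1)\<^sup>2)"
    unfolding t by simp
  finally have "2 * ((cmod (u y))\<^sup>2 / (k + 1)) - k * ((cmod (u y))\<^sup>2 / (k + 1)\<^sup>2) \<le> Re (hip H0 u u)"
    using ip0_nonneg[OF mem(4)] by simp
  moreover have "2 * ((cmod (u y))\<^sup>2 / (k + 1)) - k * ((cmod (u y))\<^sup>2 / (k + 1)\<^sup>2) = (cmod (u y))\<^sup>2 * (k + 2) / (k + 1)\<^sup>2"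
  proof -
    have "2 * ((cmod (u y))\<^sup>2 / (k + 1)) = 2 * (cmod (u y))\<^sup>2 * (k + 1) / (k + 1)\<^sup>2"
      using k by (simp add: power2_eq_square)
    thus ?thesis by (simp add: diff_divide_distrib[symmetric] algebra_simps)
  qed
  moreover have "0 < (cmod (u y))\<^sup>2 * (k + 2) / (k + 1)\<^sup>2" using y k by simp
  ultimately show "0 < Re (hip H0 u u)" by linarith
qed (simp_all add: H0_add H0_vscale ip0_add ip0_vscale, rule ip0_cnj)

text \<open>Evaluation at a point is bounded, so norm-Cauchy sequences converge pointwise. The
  completion can therefore consist of functions instead of classes of sequences, as the encoding of
  Hilbert spaces demands.\<close>

definition approx :: "(nat \<Rightarrow> 'x vec) \<Rightarrow> 'x vec \<Rightarrow> bool" where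
  "approx u F \<longleftrightarrow> (\<forall>n. u n \<in> hvecs H0) \<and> (\<forall>e>0. \<exists>M. \<forall>m\<ge>M. \<forall>n\<ge>M. P.nrm (u m - u n) < e) \<and>
     (\<forall>y. (\<lambda>n. u n y) \<longlonglongrightarrow> F y)"

lemma approxD:
  assumes "approx u F"
  shows approx_mem: "u n \<in> hvecs H0" and approx_cauchy: "0 < e \<Longrightarrow> \<exists>M. \<forall>m\<ge>M. \<forall>n\<ge>M. P.nrm (u m - u n) < e"
    and approx_pointwise: "(\<lambda>n. u n y) \<longlonglongrightarrow> F y"
  using assms by (auto simp: approx_def)

lemma approx_const: "u \<in> hvecs H0 \<Longrightarrow> approx (\<lambda>_. u) u"
  by (auto simp: approx_def P.hnorm_zero)

lemma approx_add: assumes u: "approx u F" and v: "approx v G" shows "approx (\<lambda>n. u n + v n) (F + G)"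
  unfolding approx_def
proof (intro conjI allI impI)
  fix e :: real assume e: "0 < e"
  obtain M where M: "\<forall>m\<ge>M. \<forall>n\<ge>M. P.nrm (u m - u n) < e / 2" using approx_cauchy[OF u, of "e / 2"] e by auto
  obtain N where N: "\<forall>m\<ge>N. \<forall>n\<ge>N. P.nrm (v m - v n) < e / 2" using approx_cauchy[OF v, of "e / 2"] e by auto
  have "P.nrm (u m + v m - (u n + v n)) < e" if "max M N \<le> m" "max M N \<le> n" for m n
  proof -
    have "P.nrm ((u m - u n) + (v m - v n)) \<le> P.nrm (u m - u n) + P.nrm (v m - v n)"
      by (intro P.hnorm_triangle P.mem approx_mem[OF u] approx_mem[OF v])
    also have "\<dots> < e / 2 + e / 2" using M N that by (intro add_strict_mono) auto
    finally show ?thesis by (simp add: algebra_simps)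
  qed
  thus "\<exists>M. \<forall>m\<ge>M. \<forall>n\<ge>M. P.nrm (u m + v m - (u n + v n)) < e" by blast
qed (auto simp: fun_apply intro: P.mem approx_mem[OF u] approx_mem[OF v] tendsto_add approx_pointwise[OF u] approx_pointwise[OF v])

lemma approx_vscale: assumes u: "approx u F" shows "approx (\<lambda>n. vscale k (u n)) (vscale k F)"
  unfolding approx_def
proof (intro conjI allI impI)
  fix e :: real assume e: "0 < e"
  have p: "0 < cmod k + 1" by (simp add: add_nonneg_pos)
  obtain M where M: "\<forall>m\<ge>M. \<forall>n\<ge>M. P.nrm (u m - u n) < e / (cmod k + 1)"
    using approx_cauchy[OF u, of "e / (cmod k + 1)"] e p by auto
  have "P.nrm (vscale k (u m) - vscale k (u n)) < e" if "M \<le> m" "M \<le> n" for m n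
  proof -
    have "P.nrm (vscale k (u m) - vscale k (u n)) = cmod k * P.nrm (u m - u n)"
      unfolding vscale_diff[symmetric] by (intro P.hnorm_vscale P.mem approx_mem[OF u])
    also have "\<dots> \<le> (cmod k + 1) * P.nrm (u m - u n)"
      by (intro mult_right_mono P.hnorm_nonneg P.mem approx_mem[OF u]) simp
    also have "\<dots> < e" using M that p by (simp add: field_simps)
    finally show ?thesis .
  qed
  thus "\<exists>M. \<forall>m\<ge>M. \<forall>n\<ge>M. P.nrm (vscale k (u m) - vscale k (u n)) < e" by blast
qed (auto simp: vscale_apply intro: P.mem approx_mem[OF u] tendsto_mult_left approx_pointwise[OF u])

lemma approx_diff: "\<lbrakk>approx u F; approx v G\<rbrakk> \<Longrightarrow> approx (\<lambda>n. u n - v n) (F - G)"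
  using approx_add[of u F "\<lambda>n. vscale (-1) (v n)" "vscale (-1) G"] approx_vscale[of v G "-1"] by simp

lemma approx_bounded: assumes u: "approx u F" obtains B where "0 < B" "\<And>n. P.nrm (u n) \<le> B"
proof -
  obtain M where M: "\<forall>m\<ge>M. \<forall>n\<ge>M. P.nrm (u m - u n) < 1" using approx_cauchy[OF u, of 1] by auto
  define B where "B = Max ((\<lambda>n. P.nrm (u n)) ` {..M}) + 1"
  have le: "P.nrm (u n) \<le> B - 1" if "n \<le> M" for n using that by (auto simp: B_def intro!: Max_ge)
  have "P.nrm (u n) \<le> B" for n
  proof (cases "n \<le> M")
    case False
    have "P.nrm (u n) \<le> P.nrm (u n - u M) + P.nrm (u M)"
      using P.hnorm_triangle[of "u n - u M" "u M"] approx_mem[OF u] by (simp add: P.mem)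
    moreover have "P.nrm (u n - u M) < 1" using M False by simp
    ultimately show ?thesis using le[of M] by simp
  qed (use le in force)
  moreover have "0 < B" using le[of 0] P.hnorm_nonneg[OF approx_mem[OF u], of 0] by simp
  ultimately show ?thesis using that by blast
qed

text \<open>This is what makes the passage from Cauchy sequences to functions injective. The vector
  \<open>w M\<close> is a finite combination of kernel functions, so its product with
  \<open>w n\<close> tends to 0 by pointwise convergence, while \<open>w n - w M\<close> is small in
  norm.\<close>

lemma approx_null: assumes w: "approx w 0" shows "(\<lambda>n. P.nrm (w n)) \<longlonglongrightarrow> 0"
proof -
  obtain B where B: "0 < B" "\<And>n. P.nrm (w n) \<le> B" using approx_bounded[OF w] by blast
  have "(\<lambda>n. (P.nrm (w n))\<^sup>2) \<longlonglongrightarrow> 0"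
  proof (rule LIMSEQ_I)
    fix e :: real assume e: "0 < e"
    obtain M where M: "\<forall>m\<ge>M. \<forall>n\<ge>M. P.nrm (w m - w n) < e / (2 * B)"
      using approx_cauchy[OF w, of "e / (2 * B)"] e B by auto
    obtain T d where T: "finite T" "w M = comb T d" using approx_mem[OF w] by (rule H0E)
    have "(\<lambda>n. \<Sum>y\<in>T. cnj (d y) * w n y) \<longlonglongrightarrow> (\<Sum>y\<in>T. cnj (d y) * (0 :: 'x vec) y)"
      by (intro tendsto_sum tendsto_mult_left approx_pointwise[OF w])
    hence "(\<lambda>n. P.ip (w n) (w M)) \<longlonglongrightarrow> 0" using T approx_mem[OF w] by (simp add: ip0_comb fun_apply)
    then obtain N where N: "\<forall>n\<ge>N. cmod (P.ip (w n) (w M)) < e / 2"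
      using e LIMSEQ_D[of "\<lambda>n. P.ip (w n) (w M)" 0 "e / 2"] by auto
    have "(P.nrm (w n))\<^sup>2 < e" if n: "max M N \<le> n" for n
    proof -
      have "(P.nrm (w n))\<^sup>2 = Re (P.ip (w n) (w n - w M)) + Re (P.ip (w n) (w M))"
        using approx_mem[OF w] by (simp add: P.hnorm_sq P.ip_simps)
      also have "Re (P.ip (w n) (w n - w M)) \<le> cmod (P.ip (w n) (w n - w M))" by (rule complex_Re_le_cmod)
      also have "\<dots> \<le> P.nrm (w n) * P.nrm (w n - w M)"
        by (intro P.cauchy_schwarz P.mem approx_mem[OF w])
      also have "\<dots> \<le> B * (e / (2 * B))"
        using M n B P.hnorm_nonneg[OF P.diff_mem[OF approx_mem[OF w] approx_mem[OF w]]]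
        by (intro mult_mono) (auto intro: less_imp_le)
      also have "Re (P.ip (w n) (w M)) \<le> cmod (P.ip (w n) (w M))" by (rule complex_Re_le_cmod)
      also have "\<dots> < e / 2" using N n by simp
      finally show ?thesis using B by (simp add: field_simps)
    qed
    thus "\<exists>N. \<forall>n\<ge>N. norm ((P.nrm (w n))\<^sup>2 - 0) < e" by (intro exI[of _ "max M N"]) auto
  qed
  from tendsto_real_sqrt[OF this] show ?thesis
    using P.hnorm_nonneg[OF approx_mem[OF w]] by simp
qed

lemma approx_ip_null:
  assumes w: "approx w 0" and v: "approx v G"
  shows "(\<lambda>n. P.ip (w n) (v n)) \<longlonglongrightarrow> 0" "(\<lambda>n. P.ip (v n) (w n)) \<longlonglongrightarrow> 0"
proof -
  obtain B where B: "0 < B" "\<And>n. P.nrm (v n) \<le> B" using approx_bounded[OF v] by blast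
  have le: "P.nrm (w n) * P.nrm (v n) \<le> P.nrm (w n) * B" for n
    by (intro mult_left_mono B P.hnorm_nonneg approx_mem[OF w])
  have null: "(\<lambda>n. P.nrm (w n) * B) \<longlonglongrightarrow> 0" by (rule tendsto_mult_left_zero[OF approx_null[OF w]])
  have "cmod (P.ip (w n) (v n)) \<le> P.nrm (w n) * B" for n
    using P.cauchy_schwarz[OF approx_mem[OF w] approx_mem[OF v], of n n] le[of n] by linarith
  thus "(\<lambda>n. P.ip (w n) (v n)) \<longlonglongrightarrow> 0"
    by (intro Lim_null_comparison[OF _ null]) simp
  have "cmod (P.ip (v n) (w n)) \<le> P.nrm (w n) * B" for n
    using P.cauchy_schwarz[OF approx_mem[OF v] approx_mem[OF w], of n n] le[of n] by (simp add: mult.commute)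
  thus "(\<lambda>n. P.ip (v n) (w n)) \<longlonglongrightarrow> 0"
    by (intro Lim_null_comparison[OF _ null]) simp
qed

lemma approx_ip_convergent:
  assumes u: "approx u F" and v: "approx v G"
  shows "convergent (\<lambda>n. P.ip (u n) (v n))"
proof (rule Cauchy_convergent, rule CauchyI)
  fix e :: real assume e: "0 < e"
  obtain B where B: "0 < B" "\<And>n. P.nrm (u n) \<le> B" using approx_bounded[OF u] by blast
  obtain C where C: "0 < C" "\<And>n. P.nrm (v n) \<le> C" using approx_bounded[OF v] by blast
  obtain M where M: "\<forall>m\<ge>M. \<forall>n\<ge>M. P.nrm (u m - u n) < e / (2 * C)"
    using approx_cauchy[OF u, of "e / (2 * C)"] e C by auto
  obtain N where N: "\<forall>m\<ge>N. \<forall>n\<ge>N. P.nrm (v m - v n) < e / (2 * B)"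
    using approx_cauchy[OF v, of "e / (2 * B)"] e B by auto
  note mem = P.mem approx_mem[OF u] approx_mem[OF v]
  have "cmod (P.ip (u m) (v m) - P.ip (u n) (v n)) < e" if "max M N \<le> m" "max M N \<le> n" for m n
  proof -
    have "P.ip (u m) (v m) - P.ip (u n) (v n) = P.ip (u m - u n) (v m) + P.ip (u n) (v m - v n)"
      by (simp add: P.ip_simps mem)
    also have "cmod \<dots> \<le> cmod (P.ip (u m - u n) (v m)) + cmod (P.ip (u n) (v m - v n))" by (rule norm_triangle_ineq)
    also have "\<dots> \<le> P.nrm (u m - u n) * P.nrm (v m) + P.nrm (u n) * P.nrm (v m - v n)"
      by (intro add_mono P.cauchy_schwarz mem)
    also have "\<dots> \<le> P.nrm (u m - u n) * C + B * P.nrm (v m - v n)"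
      by (intro add_mono mult_left_mono mult_right_mono B C P.hnorm_nonneg mem)
    also have "\<dots> < e / (2 * C) * C + B * (e / (2 * B))"
      using M N that B C by (intro add_strict_mono mult_strict_right_mono mult_strict_left_mono) auto
    also have "\<dots> = e" using B C by simp
    finally show ?thesis .
  qed
  thus "\<exists>M. \<forall>m\<ge>M. \<forall>n\<ge>M. cmod (P.ip (u m) (v m) - P.ip (u n) (v n)) < e" by blast
qed

definition H :: "'x hilb" where
  "H = \<lparr> hvecs = {F. \<exists>u. approx u F},
     hip = (\<lambda>F G. lim (\<lambda>n. P.ip ((SOME u. approx u F) n) ((SOME u. approx u G) n))) \<rparr>"

lemma H_mem: "F \<in> hvecs H \<longleftrightarrow> (\<exists>u. approx u F)"
  by (simp add: H_def)

text \<open>Independence of the chosen sequences: two sequences for the same function differ by an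
  approximation of 0, which is null in norm.\<close>

lemma approx_ip:
  assumes u: "approx u F" and v: "approx v G"
  shows "(\<lambda>n. P.ip (u n) (v n)) \<longlonglongrightarrow> hip H F G"
proof -
  define u' where "u' = (SOME u. approx u F)"
  define v' where "v' = (SOME u. approx u G)"
  have u': "approx u' F" and v': "approx v' G" 
    using someI[of "\<lambda>u. approx u F", OF u] someI[of "\<lambda>u. approx u G", OF v] by (simp_all only: u'_def v'_def)
  have "(\<lambda>n. P.ip (u' n) (v' n)) \<longlonglongrightarrow> hip H F G"
    using approx_ip_convergent[OF u' v'] by (simp add: H_def u'_def v'_def convergent_LIMSEQ_iff)
  moreover have "approx (\<lambda>n. u n - u' n) 0" "approx (\<lambda>n. v n - v' n) 0"
    using approx_diff[OF u u'] approx_diff[OF v v'] by auto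
  hence "(\<lambda>n. P.ip (u n - u' n) (v n) + P.ip (u' n) (v n - v' n)) \<longlonglongrightarrow> 0 + 0"
    by (intro tendsto_add approx_ip_null[OF _ v] approx_ip_null[OF _ u'])
  ultimately have "(\<lambda>n. P.ip (u' n) (v' n) + (P.ip (u n - u' n) (v n) + P.ip (u' n) (v n - v' n))) \<longlonglongrightarrow> hip H F G + (0 + 0)"
    by (rule tendsto_add)
  thus ?thesis
    using approx_mem[OF u] approx_mem[OF v] approx_mem[OF u'] approx_mem[OF v'] by (simp add: P.ip_simps)
qed

text \<open>The converse of \<open>approx_null\<close>, from boundedness of evaluation; it yields
  definiteness of the completed inner product.\<close>

lemma approx_eval:
  assumes u: "approx u F" and null: "(\<lambda>n. P.nrm (u n)) \<longlonglongrightarrow> 0" shows "F = 0"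
proof
  fix y
  have "(\<lambda>n. u n y) \<longlonglongrightarrow> 0"
  proof (rule Lim_null_comparison[OF _ tendsto_mult_left_zero[OF null, of "P.nrm (K y)"]])
    have "cmod (u n y) \<le> P.nrm (u n) * P.nrm (K y)" for n
      using P.cauchy_schwarz[OF approx_mem[OF u] K_mem_H0, of n y] approx_mem[OF u] by (simp add: ip0_K)
    thus "\<forall>\<^sub>F n in sequentially. cmod (u n y) \<le> P.nrm (u n) * P.nrm (K y)" by simp
  qed
  thus "F y = 0 y" using approx_pointwise[OF u, of y] LIMSEQ_unique by (auto simp: fun_apply)
qed

sublocale Q: prehilbert H
proof
  show "0 \<in> hvecs H" using approx_const[OF P.zero_mem] by (auto simp: H_mem)
  fix F assume F: "F \<in> hvecs H" and "F \<noteq> 0"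
  obtain u where u: "approx u F" using F by (auto simp: H_mem)
  have lim: "(\<lambda>n. (P.nrm (u n))\<^sup>2) \<longlonglongrightarrow> Re (hip H F F)"
    using tendsto_Re[OF approx_ip[OF u u]] approx_mem[OF u] by (simp add: P.hnorm_sq)
  have nn: "0 \<le> Re (hip H F F)" by (rule LIMSEQ_le_const[OF lim]) auto
  have "Re (hip H F F) \<noteq> 0"
  proof
    assume "Re (hip H F F) = 0"
    with tendsto_real_sqrt[OF lim] have "(\<lambda>n. P.nrm (u n)) \<longlonglongrightarrow> 0"
      using P.hnorm_nonneg[OF approx_mem[OF u]] by simp
    from approx_eval[OF u this] \<open>F \<noteq> 0\<close> show False by simp
  qed
  thus "0 < Re (hip H F F)" using nn by simp
next
  fix F G L assume "F \<in> hvecs H" "G \<in> hvecs H" "L \<in> hvecs H"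
  then obtain u v w where *: "approx u F" "approx v G" "approx w L" by (auto simp: H_mem)
  have "(\<lambda>n. P.ip (u n) (w n) + P.ip (v n) (w n)) \<longlonglongrightarrow> hip H F L + hip H G L"
    by (intro tendsto_add approx_ip *)
  moreover have "(\<lambda>n. P.ip (u n + v n) (w n)) \<longlonglongrightarrow> hip H (F + G) L"
    by (intro approx_ip approx_add *)
  ultimately show "hip H (F + G) L = hip H F L + hip H G L"
    using * by (intro LIMSEQ_unique[of "\<lambda>n. P.ip (u n + v n) (w n)"]) (auto simp: P.ip_simps approx_mem)
next
  fix F G k assume "F \<in> hvecs H" "G \<in> hvecs H"
  then obtain u v where *: "approx u F" "approx v G" by (auto simp: H_mem)
  have "(\<lambda>n. k * P.ip (u n) (v n)) \<longlonglongrightarrow> k * hip H F G"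
    by (intro tendsto_mult_left approx_ip *)
  moreover have "(\<lambda>n. P.ip (vscale k (u n)) (v n)) \<longlonglongrightarrow> hip H (vscale k F) G"
    by (intro approx_ip approx_vscale *)
  ultimately show "hip H (vscale k F) G = k * hip H F G"
    using * by (intro LIMSEQ_unique[of "\<lambda>n. P.ip (vscale k (u n)) (v n)"]) (auto simp: P.ip_simps approx_mem)
  have "(\<lambda>n. cnj (P.ip (u n) (v n))) \<longlonglongrightarrow> cnj (hip H F G)"
    by (intro tendsto_cnj approx_ip *)
  moreover have "(\<lambda>n. P.ip (v n) (u n)) \<longlonglongrightarrow> hip H G F"
    by (intro approx_ip *)
  ultimately show "hip H G F = cnj (hip H F G)"
    using * P.ip_commute[OF approx_mem[OF *(1)] approx_mem[OF *(2)]]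
    by (intro LIMSEQ_unique[of "\<lambda>n. P.ip (v n) (u n)"]) auto
qed (auto simp: H_mem intro: approx_add approx_vscale)

lemma approx_hnorm: assumes u: "approx u F" shows "(\<lambda>n. P.nrm (u n)) \<longlonglongrightarrow> Q.nrm F"
proof -
  have "(\<lambda>n. (P.nrm (u n))\<^sup>2) \<longlonglongrightarrow> Re (hip H F F)"
    using tendsto_Re[OF approx_ip[OF u u]] approx_mem[OF u] by (simp add: P.hnorm_sq)
  from tendsto_real_sqrt[OF this] show ?thesis
    using P.hnorm_nonneg[OF approx_mem[OF u]] by (simp add: hnorm_def)
qed

lemma H0_subset: "u \<in> hvecs H0 \<Longrightarrow> u \<in> hvecs H"
  using approx_const by (auto simp: H_mem)

lemma hnorm_H0: "u \<in> hvecs H0 \<Longrightarrow> Q.nrm u = P.nrm u"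
  using approx_hnorm[OF approx_const, of u] LIMSEQ_const_iff[of "P.nrm u" "Q.nrm u"] by auto

lemma ip_K: assumes F: "F \<in> hvecs H" shows "hip H F (K x) = F x"
proof -
  obtain u where u: "approx u F" using F by (auto simp: H_mem)
  have "(\<lambda>n. P.ip (u n) (K x)) \<longlonglongrightarrow> hip H F (K x)" by (rule approx_ip[OF u approx_const[OF K_mem_H0]])
  thus ?thesis using approx_pointwise[OF u, of x] approx_mem[OF u] LIMSEQ_unique by (auto simp: ip0_K)
qed

lemma approx_dense:
  assumes u: "approx u F" shows "(\<lambda>n. Q.nrm (F - u n)) \<longlonglongrightarrow> 0"
proof (rule LIMSEQ_I)
  fix e :: real assume e: "0 < e"
  have F: "F \<in> hvecs H" using u by (auto simp: H_mem)
  obtain M where M: "\<forall>m\<ge>M. \<forall>n\<ge>M. P.nrm (u m - u n) < e / 2" using approx_cauchy[OF u, of "e / 2"] e by auto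
  have "Q.nrm (F - u n) < e" if n: "M \<le> n" for n
  proof -
    have "(\<lambda>m. P.nrm (u m - u n)) \<longlonglongrightarrow> Q.nrm (F - u n)"
      by (intro approx_hnorm approx_diff[OF u] approx_const approx_mem[OF u])
    hence "Q.nrm (F - u n) \<le> e / 2"
      using M n by (intro LIMSEQ_le_const2[of "\<lambda>m. P.nrm (u m - u n)"]) (auto intro!: exI[of _ M] less_imp_le)
    thus ?thesis using e by simp
  qed
  thus "\<exists>N. \<forall>n\<ge>N. norm (Q.nrm (F - u n) - 0) < e"
    using Q.hnorm_nonneg[OF Q.diff_mem[OF F H0_subset[OF approx_mem[OF u]]]] by auto
qed

lemma approx_close: assumes u: "approx u F" and e: "0 < e" shows "\<exists>n. Q.nrm (F - u n) < e"
proof -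
  obtain N where "\<forall>n\<ge>N. norm (Q.nrm (F - u n) - 0) < e" using LIMSEQ_D[OF approx_dense[OF u] e] by blast
  hence "Q.nrm (F - u N) < e" by auto
  thus ?thesis by blast
qed

text \<open>A diagonal argument: \<open>X n\<close> is replaced by a vector \<open>w n\<close> of
  \<open>H0\<close> within distance \<open>1 / (n + 1)\<close>. Then \<open>w\<close> is Cauchy in
  \<open>H0\<close>, and its pointwise limit is the limit of \<open>X\<close>.\<close>

lemma hilbert_space_H: "hilbert_space H"
proof
  fix X :: "nat \<Rightarrow> 'x vec"
  assume X: "\<And>n. X n \<in> hvecs H"
    and cauchy: "\<And>e. 0 < e \<Longrightarrow> \<exists>M. \<forall>m\<ge>M. \<forall>n\<ge>M. hnorm H (vadd (X m) (vscale (- 1) (X n))) < e"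
  have "\<exists>w \<in> hvecs H0. Q.nrm (X n - w) < 1 / real (Suc n)" for n
  proof -
    obtain u where u: "approx u (X n)" using X[of n] by (auto simp: H_mem)
    obtain m where "Q.nrm (X n - u m) < 1 / real (Suc n)"
      using approx_close[OF u, of "1 / real (Suc n)"] by auto
    thus ?thesis using approx_mem[OF u] by blast
  qed
  then obtain w where w: "\<And>n. w n \<in> hvecs H0" and Xw: "\<And>n. Q.nrm (X n - w n) < 1 / real (Suc n)" by metis
  note wH = H0_subset[OF w]
  have wc: "\<exists>M. \<forall>m\<ge>M. \<forall>n\<ge>M. P.nrm (w m - w n) < e" if e: "0 < e" for e
  proof -
    obtain M where M: "\<forall>m\<ge>M. \<forall>n\<ge>M. Q.nrm (X m - X n) < e / 3" using cauchy[of "e / 3"] e by (auto simp: vadd_eq)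
    obtain N where "3 / e < real N" using reals_Archimedean2 by blast
    hence N: "1 / real (Suc N) < e / 3" using e by (simp add: field_simps)
    have "P.nrm (w m - w n) < e" if "max M N \<le> m" "max M N \<le> n" for m n
    proof -
      have k: "1 / real (Suc k) \<le> 1 / real (Suc N)" if "N \<le> k" for k using that by (simp add: frac_le)
      have "Q.nrm (w m - w n) \<le> Q.nrm (w m - X m) + (Q.nrm (X m - X n) + Q.nrm (X n - w n))"
        using Q.hnorm_triangle_diff[OF wH[of m] X[of m] wH[of n]] Q.hnorm_triangle_diff[OF X[of m] X[of n] wH[of n]] by linarith
      also have "Q.nrm (w m - X m) = Q.nrm (X m - w m)" by (rule Q.hnorm_minus_commute[OF wH X])
      also have "Q.nrm (X m - w m) + (Q.nrm (X m - X n) + Q.nrm (X n - w n)) < e / 3 + (e / 3 + e / 3)"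
        using M that Xw[of m] Xw[of n] k[of m] k[of n] N by (intro add_strict_mono) auto
      finally show ?thesis by (simp add: hnorm_H0 P.diff_mem[OF w w])
    qed
    thus ?thesis by blast
  qed
  have "convergent (\<lambda>n. w n y)" for y
  proof (rule Cauchy_convergent, rule CauchyI)
    fix e :: real assume e: "0 < e"
    have p: "0 < P.nrm (K y) + 1" using P.hnorm_nonneg[OF K_mem_H0, of y] by simp
    obtain M where M: "\<forall>m\<ge>M. \<forall>n\<ge>M. P.nrm (w m - w n) < e / (P.nrm (K y) + 1)"
      using wc[of "e / (P.nrm (K y) + 1)"] e p by auto
    have "cmod (w m y - w n y) < e" if "M \<le> m" "M \<le> n" for m n
    proof -
      have "cmod (w m y - w n y) \<le> P.nrm (w m - w n) * P.nrm (K y)"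
        using P.cauchy_schwarz[OF P.diff_mem[OF w w] K_mem_H0, of m n y] P.diff_mem[OF w w] by (simp add: ip0_K fun_apply)
      also have "\<dots> \<le> P.nrm (w m - w n) * (P.nrm (K y) + 1)"
        by (intro mult_left_mono P.hnorm_nonneg P.diff_mem w) simp
      also have "\<dots> < e" using M that p by (simp add: field_simps)
      finally show ?thesis .
    qed
    thus "\<exists>M. \<forall>m\<ge>M. \<forall>n\<ge>M. norm (w m y - w n y) < e" by blast
  qed
  hence "approx w (\<lambda>y. lim (\<lambda>n. w n y))"
    using w wc by (auto simp: approx_def convergent_LIMSEQ_iff)
  then obtain F where F: "approx w F" by blast
  have FH: "F \<in> hvecs H" using F by (auto simp: H_mem)
  have "(\<lambda>n. Q.nrm (X n - F)) \<longlonglongrightarrow> 0"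
  proof (rule Lim_null_comparison)
    show "(\<lambda>n. 1 / real (Suc n) + Q.nrm (F - w n)) \<longlonglongrightarrow> 0"
      using tendsto_add[OF LIMSEQ_Suc[OF lim_1_over_n] approx_dense[OF F]] by simp
    have "Q.nrm (X n - F) \<le> 1 / real (Suc n) + Q.nrm (F - w n)" for n
      using Q.hnorm_triangle_diff[OF X wH FH, of n n] Xw[of n] Q.hnorm_minus_commute[OF wH FH, of n] by linarith
    thus "\<forall>\<^sub>F n in sequentially. norm (Q.nrm (X n - F)) \<le> 1 / real (Suc n) + Q.nrm (F - w n)"
      using Q.hnorm_nonneg[OF Q.diff_mem[OF X FH]] by simp
  qed
  thus "\<exists>x\<in>hvecs H. (\<lambda>n. hnorm H (vadd (X n) (vscale (- 1) x))) \<longlonglongrightarrow> 0"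
    using FH by (auto simp: vadd_eq)
qed (simp_all add: vadd_eq vzero_eq Q.mem Q.ip_simps Q.ip_self_pos, rule Q.ip_commute)

lemma dense:
  assumes F: "F \<in> hvecs H" and e: "0 < e"
  shows "\<exists>u\<in>hvecs H0. Q.nrm (F - u) < e"
proof -
  obtain u where u: "approx u F" using F by (auto simp: H_mem)
  obtain n where "Q.nrm (F - u n) < e" using approx_close[OF u e] by blast
  thus ?thesis using approx_mem[OF u, of n] by blast
qed

lemma comb_sum: "comb S c = (\<Sum>x\<in>S. vscale (c x) (K x))"
  by (auto simp: comb_def fun_eq_iff sum_fun_apply vscale_apply)

end

text \<open>The set \<open>D\<close> records a dense subspace of finite combinations. With the
  reproducing property it is all that the GNS construction takes from the completion.\<close>

theorem rkhs:
  fixes K :: "'x \<Rightarrow> 'x \<Rightarrow> complex"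
  assumes "pd_on UNIV K"
  obtains H D where "hilbert_space H" "\<And>x. K x \<in> hvecs H"
    "\<And>F x. F \<in> hvecs H \<Longrightarrow> hip H F (K x) = F x"
    "\<And>u. u \<in> D \<Longrightarrow> \<exists>S c. finite S \<and> u = (\<Sum>x\<in>S. vscale (c x) (K x))"
    "\<And>u v. \<lbrakk>u \<in> D; v \<in> D\<rbrakk> \<Longrightarrow> u - v \<in> D"
    "\<And>F e. \<lbrakk>F \<in> hvecs H; 0 < e\<rbrakk> \<Longrightarrow> \<exists>u\<in>D. hnorm H (F - u) < e"
proof -
  interpret pd_kernel K by unfold_locales (rule assms)
  show ?thesis
  proof (rule that[of H "hvecs H0"])
    fix u assume "u \<in> hvecs H0"
    thus "\<exists>S c. finite S \<and> u = (\<Sum>x\<in>S. vscale (c x) (K x))"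
      by (elim H0E) (auto simp: comb_sum)
  qed (auto simp: hilbert_space_H H0_subset[OF K_mem_H0] ip_K P.diff_mem dense)
qed


section \<open>The GNS construction for positive definite functions\<close>

text \<open>The kernel must live on the whole type to apply \<open>rkhs\<close>, while the semigroup
  is only a subset of it.\<close>

lemma pd_onI_extend:
  assumes K: "pd_on X K"
  shows "pd_on UNIV (\<lambda>x y. if x \<in> X \<and> y \<in> X then K x y else 0)"
  unfolding pd_on_def
proof (intro conjI ballI allI impI)
  fix x y show "(if y \<in> X \<and> x \<in> X then K y x else 0) = cnj (if x \<in> X \<and> y \<in> X then K x y else 0)"
  proof (cases "x \<in> X \<and> y \<in> X")
    case True
    hence "K y x = cnj (K x y)" using K unfolding pd_on_def by blast
    thus ?thesis using True by simp
  qed auto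
next
  fix S :: "'a set" and c assume S: "finite S"
  have "(\<Sum>x\<in>S. \<Sum>y\<in>S. c x * cnj (c y) * (if x \<in> X \<and> y \<in> X then K x y else 0)) =
      (\<Sum>x\<in>S \<inter> X. \<Sum>y\<in>S \<inter> X. c x * cnj (c y) * K x y)"
    using S by (intro sum.mono_neutral_cong_right) (auto intro!: sum.mono_neutral_cong_right)
  moreover have "0 \<le> Re (\<Sum>x\<in>S \<inter> X. \<Sum>y\<in>S \<inter> X. c x * cnj (c y) * K x y)"
    using K finite_Int[of S X] S Int_lower2[of S X] unfolding pd_on_def by blast
  ultimately show "0 \<le> Re (\<Sum>x\<in>S. \<Sum>y\<in>S. c x * cnj (c y) * (if x \<in> X \<and> y \<in> X then K x y else 0))"
    by (simp only:)
qed

context inverse_semigroup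
begin

text \<open>The vector \<open>k g\<close> stands for \<open>\<pi> g\<close> applied to a cyclic
  vector, which need not exist in the space when \<open>I\<close> has no unit. The representation is
  left translation of functions, which takes the kernel function at \<open>g\<close> to the one at
  \<open>k \<cdot> g\<close>.\<close>

theorem gns:
  assumes pd: "pd_on elts (\<lambda>g h. f (iv h \<cdot> g))" and fz: "\<And>z. is_zero I z \<Longrightarrow> f z = 0"
  shows "\<exists>H \<pi> k. is_rep I (H :: 'a hilb, \<pi>) \<and> (\<forall>g\<in>elts. k g \<in> hvecs H) \<and>
    (\<forall>g\<in>elts. \<forall>h\<in>elts. hip H (k g) (k h) = f (iv h \<cdot> g)) \<and>
    (\<forall>g\<in>elts. \<forall>h\<in>elts. \<pi> g (k h) = k (g \<cdot> h))"
proof -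
  define K where "K g h = (if g \<in> elts \<and> h \<in> elts then f (iv h \<cdot> g) else 0)" for g h
  have "pd_on UNIV K" unfolding K_def by (rule pd_onI_extend[OF pd])
  then obtain H D where H: "hilbert_space H" and KH: "\<And>x. K x \<in> hvecs H"
    and ip_K: "\<And>F x. F \<in> hvecs H \<Longrightarrow> hip H F (K x) = F x"
    and D_comb: "\<And>u. u \<in> D \<Longrightarrow> \<exists>S c. finite S \<and> u = (\<Sum>x\<in>S. vscale (c x) (K x))"
    and D_diff: "\<And>u v. \<lbrakk>u \<in> D; v \<in> D\<rbrakk> \<Longrightarrow> u - v \<in> D"
    and D_dense: "\<And>F e. \<lbrakk>F \<in> hvecs H; 0 < e\<rbrakk> \<Longrightarrow> \<exists>u\<in>D. hnorm H (F - u) < e"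
    by (rule rkhs) (rule that; assumption)
  interpret hilbert_space H by (rule H)
  define comb where "comb S c = (\<Sum>x\<in>S. vscale (c x) (K x))" for S and c :: "'a \<Rightarrow> complex"
  have combH: "comb S c \<in> hvecs H" for S c unfolding comb_def by (intro sum_mem vscale_mem KH)
  have D_comb: "\<exists>S c. finite S \<and> u = comb S c" if "u \<in> D" for u using D_comb[OF that] by (simp add: comb_def)
  have K0: "K x = 0" if "x \<notin> elts" for x using that by (auto simp: K_def fun_eq_iff fun_apply)
  define T where "T k F = (\<lambda>h. if h \<in> elts then F (iv k \<cdot> h) else 0)" for k and F :: "'a vec"
  note cl = mult_closed inv_closed
  have T_lin: "T k (F + G) = T k F + T k G" "T k (vscale c F) = vscale c (T k F)" "T k (F - G) = T k F - T k G" for k F G c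
    by (auto simp: T_def fun_eq_iff fun_apply vscale_apply)
  have T_K: "T k (K g) = K (k \<cdot> g)" if "k \<in> elts" "g \<in> elts" for k g
    using that by (auto simp: T_def K_def fun_eq_iff cl inv_mult inv_inv mult_assoc)
  have T_sum: "T k (\<Sum>x\<in>S. vscale (c x) (K x)) = (\<Sum>x\<in>S. vscale (c x) (K (k \<cdot> x)))" if k: "k \<in> elts" and S: "S \<subseteq> elts" for k S c
    using S
  proof (induction S rule: infinite_finite_induct)
    case (insert x S)
    thus ?case using k by (simp add: T_lin T_K)
  qed (auto simp: T_def fun_eq_iff fun_apply)
  have comb_elts: "comb S c = comb (S \<inter> elts) c" if "finite S" for S c
    unfolding comb_def using that K0 by (intro sum.mono_neutral_right) auto
  have T_comb: "T k (comb S c) \<in> hvecs H \<and> nrm (T k (comb S c)) \<le> nrm (comb S c)"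
    if k: "k \<in> elts" and S: "finite S" for k S c
  proof -
    define S' where "S' = S \<inter> elts"
    have S': "finite S'" "S' \<subseteq> elts" "comb S c = comb S' c" using S comb_elts[OF S, of c] by (simp_all add: S'_def)
    have e: "x \<in> elts" if "x \<in> S'" for x using that S' by blast
    \<comment> \<open>Contractivity: \<open>d\<close> is the translate of \<open>a\<close>, and
      \<open>b\<close> is the image of \<open>a\<close> under the projection \<open>p\<close>. The
      products of \<open>d\<close> with itself, of \<open>b\<close> with \<open>a\<close> and of
      \<open>b\<close> with itself agree, so
      \<open>(nrm (b - a))\<^sup>2 = (nrm a)\<^sup>2 - (nrm d)\<^sup>2\<close>.\<close>
    define p where "p = iv k \<cdot> k"
    have p: "p \<in> elts" "p \<cdot> p = p" "iv p = p"
      using k by (auto simp: p_def cl inv_mult_idem inv_mult inv_inv)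
    define a where "a = (\<Sum>x\<in>S'. vscale (c x) (K x))"
    define b where "b = (\<Sum>x\<in>S'. vscale (c x) (K (p \<cdot> x)))"
    define d where "d = (\<Sum>x\<in>S'. vscale (c x) (K (k \<cdot> x)))"
    have mem: "a \<in> hvecs H" "b \<in> hvecs H" "d \<in> hvecs H" by (auto simp: a_def b_def d_def intro!: sum_mem vscale_mem KH)
    have ipK: "hip H (K x) (K y) = K x y" for x y using ip_K[OF KH] .
    have ip_sums: "hip H (\<Sum>x\<in>S'. vscale (c x) (K (\<alpha> x))) (\<Sum>y\<in>S'. vscale (c y) (K (\<beta> y))) =
        (\<Sum>x\<in>S'. \<Sum>y\<in>S'. c x * cnj (c y) * K (\<alpha> x) (\<beta> y))" for \<alpha> \<beta>
      by (simp add: ip_sum_sum KH ipK)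
    have pp: "p \<cdot> (p \<cdot> x) = p \<cdot> x" if "x \<in> elts" for x using p that mult_assoc[of p p x] by simp
    have "hip H d d = hip H b a"
      unfolding d_def b_def a_def ip_sums
      by (intro sum.cong refl) (use k p e in \<open>auto simp: K_def cl inv_mult p_def mult_assoc\<close>)
    moreover have "hip H b b = hip H b a"
      unfolding b_def a_def ip_sums
      by (intro sum.cong refl) (use p pp e in \<open>auto simp: K_def cl inv_mult mult_assoc\<close>)
    ultimately have "(nrm (b - a))\<^sup>2 = (nrm a)\<^sup>2 - (nrm d)\<^sup>2"
      using mem hnorm_diff_sq[of b a] by (simp add: hnorm_sq)
    hence "(nrm d)\<^sup>2 \<le> (nrm a)\<^sup>2" by (metis diff_ge_0_iff_ge zero_le_power2)
    hence "nrm d \<le> nrm a" by (rule power2_le_imp_le) (rule hnorm_nonneg[OF mem(1)])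
    moreover have ca: "comb S c = a" unfolding S'(3) by (simp add: comb_def a_def)
    moreover have "T k (comb S c) = d" unfolding ca a_def d_def by (rule T_sum[OF k S'(2)])
    ultimately show ?thesis using mem by simp
  qed
  have eval: "cmod (F x) \<le> nrm F * nrm (K x)" if "F \<in> hvecs H" for F x
    using cauchy_schwarz[OF that KH, of x] ip_K[OF that] by simp
  have H_elts: "F x = 0" if "F \<in> hvecs H" "x \<notin> elts" for F x
    using ip_K[OF that(1), of x] K0[OF that(2)] ip_zero_right[OF that(1)] by simp
  \<comment> \<open>The formula for \<open>T k\<close> makes sense for every function. That it maps
    the Hilbert space into itself follows by density: the translates of approximants converge in
    norm, and evaluation identifies the limit with \<open>T k F\<close>.\<close>
  have T_H: "T k F \<in> hvecs H \<and> nrm (T k F) \<le> nrm F" if k: "k \<in> elts" and F: "F \<in> hvecs H" for k F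
  proof -
    have "\<exists>u\<in>D. nrm (F - u) < 1 / real (Suc n)" for n by (rule D_dense[OF F]) simp
    then obtain u where uD: "\<And>n. u n \<in> D" and Fc: "\<And>n. nrm (F - u n) < 1 / real (Suc n)" by metis
    have TD: "v \<in> hvecs H \<and> T k v \<in> hvecs H \<and> nrm (T k v) \<le> nrm v" if "v \<in> D" for v
      using D_comb[OF that] T_comb[OF k] combH by blast
    have u: "u n \<in> hvecs H" for n using TD uD by blast
    have lim: "(\<lambda>n. nrm (F - u n)) \<longlonglongrightarrow> 0"
    proof (rule Lim_null_comparison[OF _ LIMSEQ_Suc[OF lim_1_over_n]])
      show "\<forall>\<^sub>F n in sequentially. norm (nrm (F - u n)) \<le> 1 / real (Suc n)"
        using Fc hnorm_nonneg[OF diff_mem[OF F u]] by (intro always_eventually allI) (simp add: less_imp_le)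
    qed
    have lim': "(\<lambda>n. nrm (u n - F)) \<longlonglongrightarrow> 0" using lim by (simp add: hnorm_minus_commute[OF F u])
    have Tu: "T k (u n) \<in> hvecs H" for n using TD uD by blast
    have Tdiff: "nrm (T k (u m) - T k (u n)) \<le> nrm (u m - u n)" for m n
      using TD[OF D_diff[OF uD uD], of m n] by (simp add: T_lin)
    have "\<exists>G\<in>hvecs H. (\<lambda>n. nrm (T k (u n) - G)) \<longlonglongrightarrow> 0"
    proof (rule cauchy_limit)
      fix e :: real assume e: "0 < e"
      obtain M where M: "\<And>n. M \<le> n \<Longrightarrow> nrm (F - u n) < e / 2"
        using LIMSEQ_D[OF lim, of "e / 2"] e by fastforce
      have "nrm (T k (u m) - T k (u n)) < e" if "M \<le> m" "M \<le> n" for m n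
        using Tdiff[of m n] hnorm_triangle_diff[OF u[of m] F u[of n]] M[OF that(1)] M[OF that(2)] hnorm_minus_commute[OF F u[of m]]
        by linarith
      thus "\<exists>M. \<forall>m\<ge>M. \<forall>n\<ge>M. nrm (T k (u m) - T k (u n)) < e" by blast
    qed (rule Tu)
    then obtain G where G: "G \<in> hvecs H" and Glim: "(\<lambda>n. nrm (T k (u n) - G)) \<longlonglongrightarrow> 0" by blast
    have pt: "(\<lambda>n. X n x) \<longlonglongrightarrow> Y x" if X: "\<And>n. X n \<in> hvecs H" "Y \<in> hvecs H" and l: "(\<lambda>n. nrm (X n - Y)) \<longlonglongrightarrow> 0" for X Y x
    proof -
      have "(\<lambda>n. X n x - Y x) \<longlonglongrightarrow> 0"
      proof (rule Lim_null_comparison[OF _ tendsto_mult_left_zero[OF l, of "nrm (K x)"]])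
        show "\<forall>\<^sub>F n in sequentially. cmod (X n x - Y x) \<le> nrm (X n - Y) * nrm (K x)"
          using eval[OF diff_mem[OF X]] by (simp add: fun_apply)
      qed
      thus ?thesis by (simp add: LIM_zero_iff)
    qed
    have "G = T k F"
    proof
      fix h
      show "G h = T k F h"
      proof (cases "h \<in> elts")
        case True
        have "(\<lambda>n. T k (u n) h) \<longlonglongrightarrow> G h" by (rule pt[OF Tu G Glim])
        moreover have "(\<lambda>n. T k (u n) h) \<longlonglongrightarrow> T k F h"
          using pt[OF u F lim', of "iv k \<cdot> h"] True by (simp add: T_def)
        ultimately show ?thesis by (rule LIMSEQ_unique)
      qed (simp add: H_elts[OF G] T_def)
    qed
    moreover have "nrm G \<le> nrm F"
    proof (rule LIMSEQ_le[OF hnorm_tendsto[OF Tu G Glim] hnorm_tendsto[OF u F lim']])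
      show "\<exists>N. \<forall>n\<ge>N. nrm (T k (u n)) \<le> nrm (u n)" using TD uD by blast
    qed
    ultimately show ?thesis using G by simp
  qed
  define \<pi> where "\<pi> k F = (if F \<in> hvecs H then T k F else 0)" for k F
  have bd: "bounded_opr H (\<pi> k)" if k: "k \<in> elts" for k
    by (rule bounded_oprI[of _ 1]) (use T_H[OF k] in \<open>auto simp: \<pi>_def T_lin add_mem vscale_mem\<close>)
  have mult: "\<pi> (g \<cdot> h) = \<pi> g \<circ> \<pi> h" if gh: "g \<in> elts" "h \<in> elts" for g h
  proof
    fix F
    have "T (g \<cdot> h) F = T g (T h F)"
      using gh by (auto simp: T_def fun_eq_iff inv_mult mult_assoc cl)
    moreover have "T k 0 = 0" for k by (auto simp: T_def fun_eq_iff fun_apply)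
    ultimately show "\<pi> (g \<cdot> h) F = (\<pi> g \<circ> \<pi> h) F" using T_H[OF gh(2)] by (auto simp: \<pi>_def)
  qed
  have adj: "opr_adj H (\<pi> k) = \<pi> (iv k)" if k: "k \<in> elts" for k
  proof (rule opr_adj_eqI[OF bd[OF k] bd[OF inv_closed[OF k]]])
    fix F G assume F: "F \<in> hvecs H" and G: "G \<in> hvecs H"
    have TF: "T k F \<in> hvecs H" using T_H[OF k F] by simp
    have TG: "T (iv k) G \<in> hvecs H" if "G \<in> hvecs H" for G using T_H[OF inv_closed[OF k] that] by simp
    have comb: "hip H (T k F) (comb S c) = hip H F (T (iv k) (comb S c))" if S: "finite S" for S c
    proof -
      have e: "x \<in> elts" if "x \<in> S \<inter> elts" for x using that by blast
      have *: "hip H (T k F) (K x) = hip H F (K (iv k \<cdot> x))" if "x \<in> elts" for x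
        using that by (simp add: ip_K TF F) (simp add: T_def)
      show ?thesis
        unfolding comb_elts[OF S, of c] unfolding comb_def
        by (subst T_sum[OF inv_closed[OF k]])
          (auto simp: ip_sum_right ip_vscale_right vscale_mem KH TF F * intro!: sum.cong)
    qed
    have "cmod (hip H (T k F) G - hip H F (T (iv k) G)) \<le> 0"
    proof (rule field_le_epsilon)
      fix e :: real assume e: "0 < e"
      have p: "0 < 2 * nrm F + 1" using hnorm_nonneg[OF F] by simp
      obtain v where "v \<in> D" and close: "nrm (G - v) < e / (2 * nrm F + 1)"
        using D_dense[OF G, of "e / (2 * nrm F + 1)"] e p by auto
      then obtain S c where S: "finite S" and close: "nrm (G - comb S c) < e / (2 * nrm F + 1)"
        using D_comb by blast
      define E where "E = G - comb S c"
      have E: "E \<in> hvecs H" unfolding E_def by (intro diff_mem G combH)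
      have "hip H (T k F) G - hip H F (T (iv k) G) = hip H (T k F) E - hip H F (T (iv k) E)"
        using comb[OF S, of c] by (simp add: E_def ip_diff_right T_lin TF F G combH TG)
      also have "cmod \<dots> \<le> cmod (hip H (T k F) E) + cmod (hip H F (T (iv k) E))" by (rule norm_triangle_ineq4)
      also have "\<dots> \<le> nrm (T k F) * nrm E + nrm F * nrm (T (iv k) E)"
        by (intro add_mono cauchy_schwarz TF F E TG)
      also have "\<dots> \<le> nrm F * nrm E + nrm F * nrm E"
        using T_H[OF k F] T_H[OF inv_closed[OF k] E]
        by (intro add_mono mult_right_mono mult_left_mono hnorm_nonneg F E) auto
      also have "\<dots> \<le> (2 * nrm F + 1) * nrm E" using hnorm_nonneg[OF E] by (simp add: algebra_simps)
      also have "\<dots> \<le> e" using close p by (simp add: E_def field_simps)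
      finally show "cmod (hip H (T k F) G - hip H F (T (iv k) G)) \<le> 0 + e" by simp
    qed
    thus "hip H (\<pi> k F) G = hip H F (\<pi> (iv k) G)" using F G by (simp add: \<pi>_def)
  qed
  have zero: "\<pi> z = 0" if z: "is_zero I z" for z
  proof
    fix F
    have "T z F = 0" if F: "F \<in> hvecs H"
    proof
      fix h
      have "K z = 0"
        using z fz is_zero_closed[OF z] by (auto simp: K_def fun_eq_iff fun_apply mult_zero inv_closed)
      hence "F z = 0" using ip_K[OF F, of z] ip_zero_right[OF F] by simp
      thus "T z F h = 0 h" using z by (simp add: T_def fun_apply inv_zero zero_mult)
    qed
    thus "\<pi> z F = 0 F" by (simp add: \<pi>_def opr_apply)
  qed
  have "is_rep I (H, \<pi>)"
  proof (rule is_repI[OF hilbert_space_axioms bd mult adj _ zero])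
    fix g assume g: "g \<in> elts"
    show "\<pi> g \<circ> \<pi> (iv g) \<circ> \<pi> g = \<pi> g"
      using g mult[of "g \<cdot> iv g" g] mult[of g "iv g"] by (simp add: cl mult_inv_mult)
  qed
  moreover have "hip H (K g) (K h) = f (iv h \<cdot> g)" if "g \<in> elts" "h \<in> elts" for g h
    using that ip_K[OF KH] by (simp add: K_def)
  ultimately show ?thesis
    using KH T_K by (intro exI[of _ H] exI[of _ \<pi>] exI[of _ K]) (auto simp: \<pi>_def)
qed


section \<open>States and the norm of the C*-algebra of an inverse semigroup\<close>

text \<open>For \<open>a = \<Sum>\<^sub>g c\<^sub>g v\<^sub>g\<close> the number \<open>quad S c f\<close> is \<open>f(a\<^sup>* a)\<close>. The inequality in \<open>state\<close> says
  that \<open>f\<close> stays positive definite when a unit with \<open>f(1) = 1\<close> is adjoined, so that \<open>f\<close> is a vector state.\<close>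

definition quad :: "'a set \<Rightarrow> ('a \<Rightarrow> complex) \<Rightarrow> ('a \<Rightarrow> complex) \<Rightarrow> complex" where
  "quad S c f = (\<Sum>g\<in>S. \<Sum>h\<in>S. c g * cnj (c h) * f (iv h \<cdot> g))"

definition state :: "('a \<Rightarrow> complex) \<Rightarrow> bool" where
  "state f \<longleftrightarrow> (\<forall>z. is_zero I z \<longrightarrow> f z = 0) \<and> (\<forall>g\<in>elts. f (iv g) = cnj (f g)) \<and>
     (\<forall>S c. finite S \<longrightarrow> S \<subseteq> elts \<longrightarrow> (cmod (\<Sum>g\<in>S. c g * f g))\<^sup>2 \<le> Re (quad S c f))"

lemma stateD:
  assumes "state f"
  shows state_zero: "is_zero I z \<Longrightarrow> f z = 0" and state_inv: "g \<in> elts \<Longrightarrow> f (iv g) = cnj (f g)"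
    and state_quad: "\<lbrakk>finite S; S \<subseteq> elts\<rbrakk> \<Longrightarrow> (cmod (\<Sum>g\<in>S. c g * f g))\<^sup>2 \<le> Re (quad S c f)"
  using assms by (auto simp: state_def)

lemma state_pd:
  assumes f: "state f"
  shows "pd_on elts (\<lambda>g h. f (iv h \<cdot> g))"
  unfolding pd_on_def
proof (intro conjI ballI allI impI)
  fix g h assume "g \<in> elts" "h \<in> elts"
  thus "f (iv g \<cdot> h) = cnj (f (iv h \<cdot> g))"
    using state_inv[OF f, of "iv h \<cdot> g"] by (simp add: inv_mult inv_inv mult_closed inv_closed)
next
  fix S c assume "finite S" "S \<subseteq> elts"
  from state_quad[OF f this, of c] show "0 \<le> Re (\<Sum>g\<in>S. \<Sum>h\<in>S. c g * cnj (c h) * f (iv h \<cdot> g))"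
    unfolding quad_def by (rule order_trans[OF zero_le_power2])
qed

lemma state_quad_indexed:
  assumes f: "state f" and A: "finite A" "x ` A \<subseteq> elts"
  shows "(cmod (\<Sum>i\<in>A. c i * f (x i)))\<^sup>2 \<le> Re (\<Sum>i\<in>A. \<Sum>j\<in>A. c i * cnj (c j) * f (iv (x j) \<cdot> x i))"
  unfolding sum_regroup[OF A(1), of c f] sum_regroup_double[OF A(1), of c "\<lambda>g h. f (iv h \<cdot> g)"]
  by (rule state_quad[OF f _ A(2), unfolded quad_def]) (use A in simp)

lemma lin_rep:
  assumes r: "is_rep I r"
  shows "lin S c r x = (\<Sum>g\<in>S. vscale (c g) (snd r g x))"
  by (simp add: lin_def sum_fun_apply fscale_def univ_gen_rep[OF r])

text \<open>The vector \<open>a\<close> of the GNS space has squared norm \<open>f(a\<^sup>* a)\<close>, and \<open>\<parallel>a\<^sup>* a\<parallel> \<ge> f(a\<^sup>* a)\<close> because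
  \<open>f\<close> is a state; no cyclic vector is needed.\<close>

lemma state_le_norm:
  assumes f: "state f" and S: "finite S" "S \<subseteq> elts"
  shows "Re (quad S c f) \<le> (A.nm (lin S c))\<^sup>2"
proof -
  have "\<exists>H \<pi> k. is_rep I (H :: 'a hilb, \<pi>) \<and> (\<forall>g\<in>elts. k g \<in> hvecs H) \<and>
    (\<forall>g\<in>elts. \<forall>h\<in>elts. hip H (k g) (k h) = f (iv h \<cdot> g)) \<and>
    (\<forall>g\<in>elts. \<forall>h\<in>elts. \<pi> g (k h) = k (g \<cdot> h))"
    by (rule gns) (use f in \<open>auto simp: state_pd state_zero\<close>)
  then obtain H \<pi> k where rep: "is_rep I (H :: 'a hilb, \<pi>)" and kH: "\<And>g. g \<in> elts \<Longrightarrow> k g \<in> hvecs H"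
    and ipk: "\<And>g h. \<lbrakk>g \<in> elts; h \<in> elts\<rbrakk> \<Longrightarrow> hip H (k g) (k h) = f (iv h \<cdot> g)"
    and \<pi>k: "\<And>g h. \<lbrakk>g \<in> elts; h \<in> elts\<rbrakk> \<Longrightarrow> \<pi> g (k h) = k (g \<cdot> h)" by blast
  interpret hilbert_space H using is_repD(1)[OF rep] by simp
  let ?a = "lin S c" and ?r = "(H, \<pi>)"
  have aC: "?a \<in> cs_carrier (rep_families I)"
    using lin_closed[OF S(2)] C0star_closed_rep_families by blast
  define T where "T = ?a ?r"
  have T: "bounded_opr H T" using rep_families_bounded[OF aC rep] by (simp add: T_def)
  have e: "g \<in> elts" if "g \<in> S" for g using that S by blast
  define v where "v = (\<Sum>g\<in>S. vscale (c g) (k g))"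
  have v: "v \<in> hvecs H" by (auto simp: v_def intro!: sum_mem vscale_mem kH e)
  have vv: "(nrm v)\<^sup>2 = Re (quad S c f)"
    unfolding hnorm_sq[OF v] unfolding v_def quad_def
    by (subst ip_sum_sum) (auto simp: kH e ipk simp del: Re_sum intro!: arg_cong[where f = Re] sum.cong)
  have bd\<pi>: "bounded_opr H (\<pi> g)" if "g \<in> elts" for g using is_repD(2)[OF rep that] by simp
  have adj\<pi>: "opr_adj H (\<pi> g) = \<pi> (iv g)" if "g \<in> elts" for g using is_repD(4)[OF rep that] by simp
  have T_ap: "T x = (\<Sum>g\<in>S. vscale (c g) (\<pi> g x))" for x unfolding T_def by (simp add: lin_rep[OF rep])
  \<comment> \<open>With \<open>v\<close> the vector of \<open>a\<close>, this is the vector of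
    \<open>a\<^sup>* a\<close>. The state inequality for \<open>a\<^sup>* a\<close> bounds
    \<open>f (a\<^sup>* a) = (nrm v)\<^sup>2\<close> by \<open>nrm w\<close>, and
    \<open>w = T\<^sup>* v\<close> bounds that by \<open>opr_norm H T * nrm v\<close>.\<close>
  define w where "w = (\<Sum>(g, h)\<in>S \<times> S. vscale (c g * cnj (c h)) (k (iv h \<cdot> g)))"
  have w: "w \<in> hvecs H" unfolding w_def by (auto simp: e mult_closed inv_closed intro!: sum_mem vscale_mem kH)
  have "opr_adj H T v = w"
  proof (rule ip_right_cong_imp)
    fix x assume x: "x \<in> hvecs H"
    have "hip H x (opr_adj H T v) = hip H (T x) v" using ip_opr_adj[OF T x v] by simp
    also have "\<dots> = (\<Sum>h\<in>S. c h * hip H x (\<pi> (iv h) v))"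
      unfolding T_ap using x v e
      by (simp add: ip_sum_left vscale_mem opr_mem[OF bd\<pi>] ip_vscale_left ip_opr_adj[OF bd\<pi>] adj\<pi>)
    also have "\<dots> = (\<Sum>h\<in>S. \<Sum>g\<in>S. c h * (cnj (c g) * hip H x (k (iv h \<cdot> g))))"
      unfolding v_def using x e
      by (simp add: opr_sum[OF bd\<pi>] opr_vscale[OF bd\<pi>] vscale_mem kH inv_closed \<pi>k ip_sum_right mult_closed
          ip_vscale_right sum_distrib_left)
    also have "\<dots> = (\<Sum>g\<in>S. \<Sum>h\<in>S. cnj (c g * cnj (c h)) * hip H x (k (iv h \<cdot> g)))"
      by (subst sum.swap) (simp add: mult_ac)
    also have "\<dots> = (\<Sum>i\<in>S \<times> S. hip H x (case i of (g, h) \<Rightarrow> vscale (c g * cnj (c h)) (k (iv h \<cdot> g))))"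
      using x e unfolding sum.cartesian_product
      by (intro sum.cong) (auto simp: ip_vscale_right kH mult_closed inv_closed)
    also have "\<dots> = hip H x w"
      unfolding w_def using x e
      by (intro ip_sum_right[symmetric]) (auto simp: vscale_mem kH inv_closed mult_closed)
    finally show "hip H x (opr_adj H T v) = hip H x w" .
  qed (use v w T in \<open>auto intro: opr_mem bounded_opr_adj\<close>)
  hence "nrm w \<le> opr_norm H T * nrm v"
    using hnorm_opr_le[OF bounded_opr_adj[OF T] v] opr_norm_adj[OF T] by simp
  moreover have "Re (quad S c f) \<le> nrm w"
  proof -
    \<comment> \<open>The combination \<open>a\<^sup>* a\<close> is indexed by pairs, and different
      pairs may give the same product; hence the indexed form of the state inequality.\<close>
    have img: "(\<lambda>(g, h). iv h \<cdot> g) ` (S \<times> S) \<subseteq> elts" using e by (auto simp: mult_closed inv_closed)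
    have "quad S c f = (\<Sum>(g, h)\<in>S \<times> S. c g * cnj (c h) * f (iv h \<cdot> g))"
      by (simp add: quad_def sum.cartesian_product)
    also have "\<dots> = (\<Sum>i\<in>S \<times> S. (\<lambda>(g, h). c g * cnj (c h)) i * f ((\<lambda>(g, h). iv h \<cdot> g) i))"
      by (simp add: split_beta)
    finally have q: "(cmod (quad S c f))\<^sup>2 \<le> Re (\<Sum>i\<in>S \<times> S. \<Sum>j\<in>S \<times> S. (\<lambda>(g, h). c g * cnj (c h)) i * cnj ((\<lambda>(g, h). c g * cnj (c h)) j) *
        f (iv ((\<lambda>(g, h). iv h \<cdot> g) j) \<cdot> (\<lambda>(g, h). iv h \<cdot> g) i))"
      using state_quad_indexed[OF f _ img, of "\<lambda>(g, h). c g * cnj (c h)"] S(1) by simp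
    have wi: "w = (\<Sum>i\<in>S \<times> S. vscale ((\<lambda>(g, h). c g * cnj (c h)) i) (k ((\<lambda>(g, h). iv h \<cdot> g) i)))"
      by (simp add: w_def split_beta)
    have ki: "(\<lambda>(g, h). iv h \<cdot> g) i \<in> elts" if "i \<in> S \<times> S" for i using img that by blast
    have "(nrm w)\<^sup>2 = Re (\<Sum>i\<in>S \<times> S. \<Sum>j\<in>S \<times> S. (\<lambda>(g, h). c g * cnj (c h)) i * cnj ((\<lambda>(g, h). c g * cnj (c h)) j) *
        f (iv ((\<lambda>(g, h). iv h \<cdot> g) j) \<cdot> (\<lambda>(g, h). iv h \<cdot> g) i))"
      unfolding hnorm_sq[OF w] unfolding wi
      by (subst ip_sum_sum) (auto simp: kH ki ipk simp del: Re_sum split_beta split_paired_all intro!: arg_cong[where f = Re] sum.cong)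
    hence "(cmod (quad S c f))\<^sup>2 \<le> (nrm w)\<^sup>2" using q by simp
    hence "cmod (quad S c f) \<le> nrm w" by (rule power2_le_imp_le) (rule hnorm_nonneg[OF w])
    thus ?thesis using complex_Re_le_cmod[of "quad S c f"] by linarith
  qed
  ultimately have "(nrm v)\<^sup>2 \<le> opr_norm H T * nrm v" using vv by simp
  hence "nrm v \<le> opr_norm H T"
    using hnorm_nonneg[OF v] opr_norm_nonneg[OF T] by (cases "nrm v = 0") (auto simp: power2_eq_square)
  also have "\<dots> \<le> A.nm ?a"
    using opr_norm_le_fam_norm[OF aC rep] by (simp add: T_def C0star_simps)
  finally show ?thesis unfolding vv[symmetric] by (rule power_mono) (rule hnorm_nonneg[OF v])
qed

text \<open>The state inequality is Cauchy-Schwarz for \<open>a x\<close> and \<open>x\<close>,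
  where \<open>x\<close> has norm at most 1. The value 0 off the semigroup places \<open>f\<close>
  in the product of unit discs used for compactness.\<close>

lemma vector_state:
  assumes r: "is_rep I r" and x: "x \<in> hvecs (fst r)" "hnorm (fst r) x \<le> 1"
  defines "f \<equiv> \<lambda>g. if g \<in> elts then hip (fst r) (snd r g x) x else 0"
  shows "state f" and "\<lbrakk>finite S; S \<subseteq> elts\<rbrakk> \<Longrightarrow> Re (quad S c f) = (hnorm (fst r) (lin S c r x))\<^sup>2"
proof -
  interpret hilbert_space "fst r" by (rule is_repD[OF r])
  have bd: "bounded_opr (fst r) (snd r g)" if "g \<in> elts" for g using is_repD(2)[OF r that] .
  have adj: "ip (snd r (iv g) x) y = ip x (snd r g y)" if "g \<in> elts" "x \<in> hvecs (fst r)" "y \<in> hvecs (fst r)" for g x y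
    using is_repD(4)[OF r that(1)] ip_opr_adj'[OF bd[OF that(1)] that(2,3)] by simp
  have Q: "lin S c r x \<in> hvecs (fst r)" "Re (quad S c f) = (nrm (lin S c r x))\<^sup>2" "(\<Sum>g\<in>S. c g * f g) = ip (lin S c r x) x"
    if S: "finite S" "S \<subseteq> elts" for S c
  proof -
    have e: "g \<in> elts" if "g \<in> S" for g using that S by blast
    show m: "lin S c r x \<in> hvecs (fst r)"
      using x e by (auto simp: lin_rep[OF r] intro!: sum_mem vscale_mem opr_mem[OF bd])
    have fm: "f (iv h \<cdot> g) = ip (snd r g x) (snd r h x)" if "g \<in> S" "h \<in> S" for g h
      using that e x adj[of h "snd r g x" x] by (simp add: f_def mult_closed inv_closed is_repD(3)[OF r] opr_mem[OF bd])
    show "Re (quad S c f) = (nrm (lin S c r x))\<^sup>2"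
      unfolding hnorm_sq[OF m] unfolding lin_rep[OF r] quad_def using x e
      by (subst ip_sum_sum) (auto simp: opr_mem[OF bd] fm simp del: Re_sum intro!: arg_cong[where f = Re] sum.cong)
    show "(\<Sum>g\<in>S. c g * f g) = ip (lin S c r x) x"
      unfolding lin_rep[OF r] using x e
      by (simp add: ip_sum_left vscale_mem opr_mem[OF bd] ip_vscale_left f_def)
  qed
  show "state f" unfolding state_def
  proof (intro conjI allI ballI impI)
    fix z assume "is_zero I z" thus "f z = 0" using x by (simp add: f_def is_repD(5)[OF r] opr_apply ip_zero_left)
  next
    fix g assume g: "g \<in> elts"
    show "f (iv g) = cnj (f g)"
      using g x adj[OF g x(1) x(1)] ip_commute[OF opr_mem[OF bd[OF g] x(1)] x(1)] by (simp add: f_def inv_closed)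
  next
    fix S c assume S: "finite S" "S \<subseteq> elts"
    have "cmod (\<Sum>g\<in>S. c g * f g) \<le> nrm (lin S c r x) * nrm x"
      unfolding Q(3)[OF S] by (rule cauchy_schwarz[OF Q(1)[OF S] x(1)])
    also have "\<dots> \<le> nrm (lin S c r x)" using x(2) hnorm_nonneg[OF Q(1)[OF S]] by (simp add: mult_left_le)
    finally have "(cmod (\<Sum>g\<in>S. c g * f g))\<^sup>2 \<le> (nrm (lin S c r x))\<^sup>2" by (rule power_mono) simp
    thus "(cmod (\<Sum>g\<in>S. c g * f g))\<^sup>2 \<le> Re (quad S c f)" unfolding Q(2)[OF S] .
  qed
  show "\<lbrakk>finite S; S \<subseteq> elts\<rbrakk> \<Longrightarrow> Re (quad S c f) = (hnorm (fst r) (lin S c r x))\<^sup>2" by (rule Q)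
qed

end


section \<open>The crystal of an inverse semigroup with a scale\<close>

locale scaled_semigroup = inverse_semigroup I for I :: "'a sgrp" +
  fixes N :: "'a \<Rightarrow> real"
  assumes scale: "is_scale I N"
begin

abbreviation Ec where "Ec \<equiv> crystal_idempotents I N"
abbreviation Ic where "Ic \<equiv> crystal_nonzero I N"

definition I1 :: "'a set" where
  "I1 = {g \<in> elts. is_zero I g \<or> N g = 1}"

lemma N_pos: "\<lbrakk>g \<in> elts; \<not> is_zero I g\<rbrakk> \<Longrightarrow> 0 < N g"
  using scale by (simp add: is_scale_def nonzero_def)

lemma N_mult: "\<lbrakk>g \<in> elts; h \<in> elts; \<not> is_zero I (g \<cdot> h)\<rbrakk> \<Longrightarrow> N (g \<cdot> h) = N g * N h"
  using scale nonzero_factors[of g h] by (simp add: is_scale_def nonzero_def mult_closed)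

lemma N_idem: assumes "p \<in> elts" "p \<cdot> p = p" "\<not> is_zero I p" shows "N p = 1"
  using N_mult[of p p] N_pos[of p] assms by simp

lemma inv_mult_nonzero: "\<lbrakk>g \<in> elts; \<not> is_zero I g\<rbrakk> \<Longrightarrow> \<not> is_zero I (iv g \<cdot> g)"
  using nonzero_factors(2)[of g "iv g \<cdot> g"] by (simp add: mult_closed inv_closed mult_assoc[symmetric] mult_inv_mult)

lemma mult_inv_nonzero: "\<lbrakk>g \<in> elts; \<not> is_zero I g\<rbrakk> \<Longrightarrow> \<not> is_zero I (g \<cdot> iv g)"
  using nonzero_factors(1)[of "g \<cdot> iv g" g] by (simp add: mult_closed inv_closed mult_inv_mult)

lemma N_inv: assumes "g \<in> elts" "\<not> is_zero I g" shows "N (iv g) = 1 / N g"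
proof -
  have "N (iv g \<cdot> g) = 1"
    using assms by (intro N_idem) (auto simp: mult_closed inv_closed inv_mult_idem inv_mult_nonzero)
  thus ?thesis
    using assms N_mult[of "iv g" g] N_pos[of g] by (simp add: inv_closed inv_mult_nonzero field_simps)
qed

lemma I1_elts: "g \<in> I1 \<Longrightarrow> g \<in> elts" by (simp add: I1_def)

lemma I1_mult: "\<lbrakk>g \<in> I1; h \<in> I1\<rbrakk> \<Longrightarrow> g \<cdot> h \<in> I1"
  using N_mult[of g h] nonzero_factors[of g h]
  by (cases "is_zero I (g \<cdot> h)") (auto simp: I1_def mult_closed)

lemma I1_inv: "g \<in> I1 \<Longrightarrow> iv g \<in> I1"
  using N_inv[of g] by (cases "is_zero I g") (auto simp: I1_def inv_closed inv_zero)

lemma I1_idem: "\<lbrakk>p \<in> elts; p \<cdot> p = p\<rbrakk> \<Longrightarrow> p \<in> I1"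
  using N_idem[of p] by (auto simp: I1_def)

text \<open>Translation by \<open>iv k\<close> brings the elements of the same scale as
  \<open>k\<close> to scale 1, where positivity is known.\<close>

lemma inv_mult_I1:
  assumes "g \<in> elts" "k \<in> elts" "\<not> is_zero I k" "is_zero I g \<or> N g = N k"
  shows "iv k \<cdot> g \<in> I1"
proof (cases "is_zero I (iv k \<cdot> g)")
  case False
  hence "\<not> is_zero I g" using nonzero_factors(2)[of "iv k" g] assms by (simp add: inv_closed)
  thus ?thesis using False N_mult[of "iv k" g] N_inv[of k] N_pos[of k] assms by (simp add: I1_def inv_closed mult_closed)
qed (use assms in \<open>auto simp: I1_def inv_closed mult_closed\<close>)

lemma crystal_idempotentsD:
  assumes "p \<in> Ec" shows "p \<in> elts" "\<not> is_zero I p" "p \<cdot> p = p" "\<And>g. \<lbrakk>g \<in> elts; p = iv g \<cdot> g\<rbrakk> \<Longrightarrow> 1 \<le> N g"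
  using assms by (auto simp: crystal_idempotents_def nonzero_idempotents_def nonzero_def)

lemma Ic_elts: "g \<in> Ic \<Longrightarrow> g \<in> elts" and Ic_nonzero: "g \<in> Ic \<Longrightarrow> \<not> is_zero I g"
  by (auto simp: crystal_nonzero_def nonzero_def)

lemma Ic_inv: assumes "g \<in> Ic" shows "iv g \<in> Ic"
  using assms by (auto simp: crystal_nonzero_def nonzero_def inv_closed inv_inv is_zero_inv)

text \<open>The condition on the source projection bounds \<open>N g\<close> below by 1, and that on
  the range projection does the same for \<open>N (iv g) = 1 / N g\<close>.\<close>

lemma Ic_I1: assumes g: "g \<in> Ic" shows "g \<in> I1"
proof -
  have e: "g \<in> elts" "\<not> is_zero I g" using g by (auto simp: Ic_elts Ic_nonzero)
  have "1 \<le> N g" using crystal_idempotentsD(4)[of "iv g \<cdot> g" g] g e by (simp add: crystal_nonzero_def)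
  moreover have "1 \<le> N (iv g)"
  proof (rule crystal_idempotentsD(4))
    show "g \<cdot> iv g \<in> Ec" using g by (simp add: crystal_nonzero_def)
  qed (simp_all add: e inv_closed inv_inv)
  ultimately have "N g = 1" using N_inv[OF e] N_pos[OF e] by simp
  thus ?thesis using e by (simp add: I1_def)
qed

lemma not_crystal_idempotentE:
  assumes "p \<in> elts" "p \<cdot> p = p" "\<not> is_zero I p" "p \<notin> Ec"
  obtains g where "g \<in> elts" "p = iv g \<cdot> g" "\<not> is_zero I g" "N g < 1"
proof -
  obtain g where g: "g \<in> elts" "p = iv g \<cdot> g" "N g < 1"
    using assms by (auto simp: crystal_idempotents_def nonzero_idempotents_def nonzero_def not_le)
  moreover have "\<not> is_zero I g" using assms(3) nonzero_factors(2)[of "iv g" g] g by (simp add: inv_closed)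
  ultimately show ?thesis using that by blast
qed

text \<open>If the range projection of \<open>g\<close> violates the condition, the inverse of the
  violating element is the witness. If the source projection does, with violating element
  \<open>k\<close>, then \<open>g \<cdot> iv k\<close> has the range projection of \<open>g\<close>,
  and its scale is that of \<open>iv k\<close> because \<open>N g = 1\<close>.\<close>

lemma not_crystalE:
  assumes g: "g \<in> I1" "\<not> is_zero I g" "g \<notin> Ic"
  obtains h where "h \<in> elts" "\<not> is_zero I h" "1 < N h" "h \<cdot> iv h = g \<cdot> iv g"
proof -
  have e: "g \<in> elts" "N g = 1" using g by (auto simp: I1_def)
  note cl = mult_closed inv_closed
  have "g \<cdot> iv g \<notin> Ec \<or> iv g \<cdot> g \<notin> Ec"
    using g e by (auto simp: crystal_nonzero_def nonzero_def)
  thus ?thesis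
  proof
    assume "g \<cdot> iv g \<notin> Ec"
    then obtain k where k: "k \<in> elts" "g \<cdot> iv g = iv k \<cdot> k" "\<not> is_zero I k" "N k < 1"
      using e g by (elim not_crystal_idempotentE[rotated -1]) (auto simp: cl mult_inv_idem mult_inv_nonzero)
    show ?thesis
      by (rule that[of "iv k"]) (use k N_inv[of k] N_pos[of k] in \<open>auto simp: inv_closed is_zero_inv inv_inv\<close>)
  next
    assume "iv g \<cdot> g \<notin> Ec"
    then obtain k where k: "k \<in> elts" "iv g \<cdot> g = iv k \<cdot> k" "\<not> is_zero I k" "N k < 1"
      using e g by (elim not_crystal_idempotentE[rotated -1]) (auto simp: cl inv_mult_idem inv_mult_nonzero)
    have "(g \<cdot> iv k) \<cdot> iv (g \<cdot> iv k) = g \<cdot> (iv k \<cdot> k) \<cdot> iv g"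
      using e k(1) by (simp add: inv_mult inv_inv cl mult_assoc)
    also have "\<dots> = (g \<cdot> iv g \<cdot> g) \<cdot> iv g" unfolding k(2)[symmetric] using e by (simp add: cl mult_assoc)
    finally have eq: "(g \<cdot> iv k) \<cdot> iv (g \<cdot> iv k) = g \<cdot> iv g" using e by (simp add: mult_inv_mult)
    have nz: "\<not> is_zero I (g \<cdot> iv k)"
      using eq mult_inv_nonzero[OF e(1) g(2)] nonzero_factors(1)[of "g \<cdot> iv k" "iv (g \<cdot> iv k)"] e k by (simp add: cl)
    show ?thesis
      by (rule that[of "g \<cdot> iv k"])
        (use eq nz k e N_inv[of k] N_pos[of k] N_mult[of g "iv k"] in \<open>auto simp: cl\<close>)
  qed
qed

text \<open>A converse of \<open>not_crystalE\<close> in which the range projection of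
  \<open>g\<close> need only lie below \<open>h \<cdot> iv h\<close>. Cutting \<open>h\<close> down
  by this projection \<open>p\<close> keeps the scale and makes the range projection of
  \<open>p \<cdot> h\<close> equal to \<open>p\<close>, against \<open>p \<in> Ec\<close>.\<close>

lemma not_crystalI:
  assumes g: "g \<in> elts" and h: "h \<in> elts" "1 < N h" "h \<cdot> iv h \<cdot> g = g"
  shows "g \<notin> Ic"
proof
  assume gc: "g \<in> Ic"
  note cl = mult_closed inv_closed
  define p where "p = g \<cdot> iv g"
  have p: "p \<in> elts" "p \<cdot> p = p" "iv p = p" "\<not> is_zero I p"
    using g mult_inv_nonzero[OF g Ic_nonzero[OF gc]] by (auto simp: p_def cl mult_inv_idem inv_mult inv_inv)
  have hp: "h \<cdot> iv h \<cdot> p = p" unfolding p_def using g h by (simp add: cl mult_assoc[symmetric])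
  have "(p \<cdot> h) \<cdot> iv (p \<cdot> h) = p \<cdot> (h \<cdot> iv h \<cdot> p)"
    using p h by (simp add: inv_mult cl mult_assoc)
  hence eq: "(p \<cdot> h) \<cdot> iv (p \<cdot> h) = p" using hp p by simp
  have nz: "\<not> is_zero I (p \<cdot> h)"
    using eq p nonzero_factors(1)[of "p \<cdot> h" "iv (p \<cdot> h)"] h by (simp add: cl)
  have "N (p \<cdot> h) = N h" using N_mult[OF p(1) h(1) nz] N_idem[OF p(1,2,4)] by simp
  hence "N (iv (p \<cdot> h)) < 1" using N_inv[OF _ nz] h p by (simp add: cl)
  moreover have "1 \<le> N (iv (p \<cdot> h))"
    using gc eq p h by (intro crystal_idempotentsD(4)[of p]) (auto simp: crystal_nonzero_def p_def cl inv_inv)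
  ultimately show False by simp
qed

text \<open>\<open>I1 - Ic\<close> is an ideal of \<open>I1\<close>.\<close>

lemma Ic_factors:
  assumes g: "g \<in> I1" and h: "h \<in> I1" and gh: "g \<cdot> h \<in> Ic"
  shows "g \<in> Ic" "h \<in> Ic"
proof -
  note cl = mult_closed inv_closed
  have e: "g \<in> elts" "h \<in> elts" using g h by (auto simp: I1_elts)
  have nz: "\<not> is_zero I (g \<cdot> h)" "\<not> is_zero I g" "\<not> is_zero I h"
    using Ic_nonzero[OF gh] nonzero_factors[OF e] by auto
  show "g \<in> Ic"
  proof (rule ccontr)
    assume "g \<notin> Ic"
    then obtain k where k: "k \<in> elts" "\<not> is_zero I k" "1 < N k" "k \<cdot> iv k = g \<cdot> iv g"
      using not_crystalE[OF g nz(2)] by blast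
    have "k \<cdot> iv k \<cdot> (g \<cdot> h) = g \<cdot> h"
      unfolding k(4) using e by (simp add: cl mult_assoc[symmetric] mult_inv_mult)
    thus False using not_crystalI[of "g \<cdot> h" k] k e gh by (simp add: cl)
  qed
  show "h \<in> Ic"
  proof (rule ccontr)
    assume "h \<notin> Ic"
    then obtain k where k: "k \<in> elts" "\<not> is_zero I k" "1 < N k" "k \<cdot> iv k = h \<cdot> iv h"
      using not_crystalE[OF h nz(3)] by blast
    have kh: "k \<cdot> iv k \<cdot> h = h" unfolding k(4) using e by (simp add: mult_inv_mult)
    have comm: "(iv g \<cdot> g) \<cdot> (k \<cdot> iv k) = (k \<cdot> iv k) \<cdot> (iv g \<cdot> g)"
      using e k by (intro idem_commute) (auto simp: cl inv_mult_idem mult_inv_idem)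
    \<comment> \<open>The element \<open>g \<cdot> k\<close> shows that \<open>g \<cdot> h\<close>
      is outside \<open>Ic\<close>: its range projection fixes \<open>g \<cdot> h\<close>, and its
      scale is \<open>N k\<close> because \<open>N g = 1\<close>.\<close>
    have "(g \<cdot> k) \<cdot> iv (g \<cdot> k) \<cdot> (g \<cdot> h) = g \<cdot> ((k \<cdot> iv k) \<cdot> (iv g \<cdot> g)) \<cdot> h"
      using e k(1) by (simp add: inv_mult cl mult_assoc)
    also have "\<dots> = (g \<cdot> iv g \<cdot> g) \<cdot> (k \<cdot> iv k \<cdot> h)" unfolding comm[symmetric] using e k(1) by (simp add: cl mult_assoc)
    also have "\<dots> = g \<cdot> h" unfolding kh using e by (simp add: mult_inv_mult)
    finally have eq: "(g \<cdot> k) \<cdot> iv (g \<cdot> k) \<cdot> (g \<cdot> h) = g \<cdot> h" .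
    hence "\<not> is_zero I (g \<cdot> k)"
      using nz(1) e k zero_mult[of "g \<cdot> k" "iv (g \<cdot> k)"] zero_mult[of "g \<cdot> k" "g \<cdot> h"] by (auto simp: cl)
    hence "N (g \<cdot> k) = N k" using N_mult[OF e(1) k(1)] g nz by (simp add: I1_def)
    thus False using not_crystalI[of "g \<cdot> h" "g \<cdot> k"] eq k e gh by (simp add: cl)
  qed
qed

lemma Ic_inv_iff: "g \<in> elts \<Longrightarrow> iv g \<in> Ic \<longleftrightarrow> g \<in> Ic"
  using Ic_inv inv_inv by metis

lemma Ic_mult_inv: assumes g: "g \<in> Ic" shows "g \<cdot> iv g \<in> Ic" "iv g \<cdot> g \<in> Ic"
proof -
  have e: "g \<in> elts" "\<not> is_zero I g" using g by (auto simp: Ic_elts Ic_nonzero)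
  show "g \<cdot> iv g \<in> Ic" "iv g \<cdot> g \<in> Ic"
    using g e by (auto simp: crystal_nonzero_def nonzero_def mult_closed inv_closed inv_mult inv_inv
        mult_inv_idem inv_mult_idem mult_inv_nonzero inv_mult_nonzero)
qed

section \<open>The crystal as an inverse semigroup\<close>

abbreviation Cr where "Cr \<equiv> sg_crystal I N"

lemma crystal_simps:
  "sg_carrier Cr = insert None (Some ` Ic)"
  "sg_mult Cr None u = None" "sg_mult Cr u None = None"
  "sg_mult Cr (Some g) (Some h) = (if g \<cdot> h \<in> Ic then Some (g \<cdot> h) else None)"
  by (auto simp: sg_crystal_def split: option.splits)

text \<open>Associativity amounts to the fact that a triple product in \<open>Ic\<close> has its
  partial products in \<open>Ic\<close>. The equations for an inverse of a nonzero element never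
  pass through the zero, so uniqueness is inherited from \<open>I\<close>.\<close>

lemma inverse_semigroup_crystal: "inverse_semigroup Cr"
proof
  fix u v w assume u: "u \<in> sg_carrier Cr" and v: "v \<in> sg_carrier Cr"
  show "sg_mult Cr u v \<in> sg_carrier Cr"
    using u v by (auto simp: crystal_simps)
  assume w: "w \<in> sg_carrier Cr"
  show "sg_mult Cr (sg_mult Cr u v) w = sg_mult Cr u (sg_mult Cr v w)"
  proof (cases "u = None \<or> v = None \<or> w = None")
    case False
    then obtain g h k where e: "u = Some g" "v = Some h" "w = Some k" "g \<in> Ic" "h \<in> Ic" "k \<in> Ic"
      using u v w by (auto simp: crystal_simps)
    have i: "g \<in> I1" "h \<in> I1" "k \<in> I1" using e by (simp_all add: Ic_I1)
    have "g \<cdot> h \<cdot> k \<in> Ic \<Longrightarrow> g \<cdot> h \<in> Ic" by (rule Ic_factors(1)[OF I1_mult[OF i(1,2)] i(3)])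
    moreover have "g \<cdot> (h \<cdot> k) \<in> Ic \<Longrightarrow> h \<cdot> k \<in> Ic" by (rule Ic_factors(2)[OF i(1) I1_mult[OF i(2,3)]])
    moreover have "g \<cdot> h \<cdot> k = g \<cdot> (h \<cdot> k)" using e by (simp add: mult_assoc Ic_elts)
    ultimately show ?thesis using e by (auto simp: crystal_simps)
  qed (auto simp: crystal_simps)
next
  fix u assume u: "u \<in> sg_carrier Cr"
  show "\<exists>!v. v \<in> sg_carrier Cr \<and> sg_mult Cr (sg_mult Cr u v) u = u \<and> sg_mult Cr (sg_mult Cr v u) v = v"
  proof (cases u)
    case None
    thus ?thesis by (intro ex1I[of _ None]) (auto simp: crystal_simps)
  next
    case (Some g)
    hence g: "g \<in> Ic" using u by (auto simp: crystal_simps)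
    show ?thesis
    proof (rule ex1I[of _ "Some (iv g)"])
      show "Some (iv g) \<in> sg_carrier Cr \<and> sg_mult Cr (sg_mult Cr u (Some (iv g))) u = u \<and>
          sg_mult Cr (sg_mult Cr (Some (iv g)) u) (Some (iv g)) = Some (iv g)"
        using g Ic_mult_inv[OF g] Ic_inv[OF g] by (simp add: Some crystal_simps Ic_elts mult_inv_mult inv_mult_inv)
    next
      fix v assume v: "v \<in> sg_carrier Cr \<and> sg_mult Cr (sg_mult Cr u v) u = u \<and> sg_mult Cr (sg_mult Cr v u) v = v"
      then obtain h where h: "v = Some h" "h \<in> Ic" by (auto simp: crystal_simps Some)
      have "g \<cdot> h \<cdot> g = g" "h \<cdot> g \<cdot> h = h" using v by (auto simp: h Some crystal_simps split: if_splits)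
      hence "iv g = h" using g h by (intro inv_unique) (auto simp: Ic_elts)
      thus "v = Some (iv g)" using h by simp
    qed
  qed
qed

sublocale C: inverse_semigroup Cr
  rewrites "sg_carrier Cr = insert None (Some ` Ic)"
  by (rule inverse_semigroup_crystal) (rule crystal_simps)

lemma crystal_zero: "is_zero Cr u \<longleftrightarrow> u = None"
  by (auto simp: is_zero_def crystal_simps)

lemma crystal_inv: "g \<in> Ic \<Longrightarrow> sg_inv Cr (Some g) = Some (iv g)"
  by (rule C.inv_unique) (auto simp: crystal_simps Ic_inv Ic_mult_inv Ic_elts mult_inv_mult inv_mult_inv)


section \<open>Ground states\<close>

text \<open>By the ideal property \<open>iv h \<cdot> g\<close> can lie in \<open>Ic\<close> only if
  \<open>g\<close> and \<open>h\<close> both do; all other terms vanish.\<close>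

lemma quad_restrict:
  assumes S: "finite S" "S \<subseteq> I1" and f: "\<And>g. \<lbrakk>g \<in> I1; g \<notin> Ic\<rbrakk> \<Longrightarrow> f g = 0"
  shows "quad S c f = quad (S \<inter> Ic) c f"
proof -
  have z: "f (iv h \<cdot> g) = 0" if "g \<in> S" "h \<in> S" "g \<notin> Ic \<or> h \<notin> Ic" for g h
  proof (rule f)
    have 1: "g \<in> I1" "h \<in> I1" "iv h \<in> I1" using that S by (auto intro: I1_inv)
    show "iv h \<cdot> g \<in> I1" using 1 by (simp add: I1_mult)
    show "iv h \<cdot> g \<notin> Ic" using Ic_factors[OF 1(3,1)] Ic_inv_iff[OF I1_elts[OF 1(2)]] that(3) by blast
  qed
  show ?thesis unfolding quad_def
    using S z by (intro sum.mono_neutral_cong_right) (auto intro!: sum.mono_neutral_cong_right sum.neutral)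
qed

lemma crystal_sum:
  assumes "finite S" "S \<subseteq> insert None (Some ` Ic)" "F None = (0 :: complex)"
  shows "sum F S = (\<Sum>g | Some g \<in> S. F (Some g))"
proof -
  have "sum F S = sum F (Some ` {g. Some g \<in> S})"
  proof (rule sum.mono_neutral_right)
    show "\<forall>u\<in>S - Some ` {g. Some g \<in> S}. F u = 0"
    proof
      fix u assume "u \<in> S - Some ` {g. Some g \<in> S}"
      thus "F u = 0" using assms(3) by (cases u) auto
    qed
  qed (use assms in auto)
  thus ?thesis by (simp add: sum.reindex)
qed

text \<open>A product that becomes the zero of the crystal lies in \<open>I1 - Ic\<close>, where
  \<open>f\<close> vanishes just as \<open>\<phi>\<close> does at \<open>None\<close>.\<close>

lemma crystal_quad:
  assumes S: "finite S" "S \<subseteq> insert None (Some ` Ic)"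
    and f: "\<And>g. g \<in> I1 \<Longrightarrow> f g = (if g \<in> Ic then \<phi> (Some g) else 0)" and \<phi>: "\<phi> None = 0"
  shows "C.quad S c \<phi> = quad {g. Some g \<in> S} (\<lambda>g. c (Some g)) f"
proof -
  have N: "sg_inv Cr None = None" by (rule C.inv_zero) (simp add: crystal_zero)
  have eq: "\<phi> (sg_mult Cr (sg_inv Cr (Some h)) (Some g)) = f (iv h \<cdot> g)" if "Some g \<in> S" "Some h \<in> S" for g h
  proof -
    have "g \<in> Ic" "h \<in> Ic" using that S by auto
    thus ?thesis using f[of "iv h \<cdot> g"] \<phi> by (simp add: crystal_inv crystal_simps I1_mult I1_inv Ic_I1)
  qed
  show ?thesis unfolding C.quad_def quad_def
    using S \<phi> by (simp add: crystal_sum crystal_simps N eq)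
qed

section \<open>Positivity of states extended by zero\<close>

lemma pd_on_cong:
  assumes K: "pd_on X K" and eq: "\<And>x y. \<lbrakk>x \<in> X; y \<in> X\<rbrakk> \<Longrightarrow> K x y = K' x y"
  shows "pd_on X K'"
proof -
  have sums: "(\<Sum>x\<in>S. \<Sum>y\<in>S. c x * cnj (c y) * K' x y) = (\<Sum>x\<in>S. \<Sum>y\<in>S. c x * cnj (c y) * K x y)"
    if "S \<subseteq> X" for S c
    using that eq by (intro sum.cong refl) (auto simp: subset_iff)
  show ?thesis unfolding pd_on_def
  proof (intro conjI ballI allI impI)
    fix x y assume xy: "x \<in> X" "y \<in> X"
    have "K y x = cnj (K x y)" using K xy unfolding pd_on_def by blast
    thus "K' y x = cnj (K' x y)" unfolding eq[OF xy] eq[OF xy(2,1)] .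
  next
    fix S c assume S: "finite S" "S \<subseteq> X"
    show "0 \<le> Re (\<Sum>x\<in>S. \<Sum>y\<in>S. c x * cnj (c y) * K' x y)"
      unfolding sums[OF S(2)] using K S unfolding pd_on_def by blast
  qed
qed

text \<open>For the form \<open>M\<close> the map \<open>t\<close> acts as a self-adjoint
  projection; the new kernel is the form compressed by the complementary projection.\<close>

lemma pd_on_diff:
  assumes M: "pd_on X M" and t: "\<And>g. g \<in> X \<Longrightarrow> t g \<in> X" "\<And>g h. \<lbrakk>g \<in> X; h \<in> X\<rbrakk> \<Longrightarrow> M (t g) h = M g (t h)"
    "\<And>g. g \<in> X \<Longrightarrow> t (t g) = t g"
  shows "pd_on X (\<lambda>g h. M g h - M (t g) h)"
proof -
  have H: "M h g = cnj (M g h)" if "g \<in> X" "h \<in> X" for g h using M that unfolding pd_on_def by blast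
  show ?thesis unfolding pd_on_def
  proof (intro conjI ballI allI impI)
    fix g h assume gh: "g \<in> X" "h \<in> X"
    show "M h g - M (t h) g = cnj (M g h - M (t g) h)"
      using H[OF gh] H[of "t g" h] t gh by simp
  next
    fix S and c :: "'b \<Rightarrow> complex" assume S: "finite S" "S \<subseteq> X"
    \<comment> \<open>Each \<open>g\<close> enters twice, at \<open>g\<close> with coefficient
      \<open>c g\<close> and at \<open>t g\<close> with coefficient \<open>- c g\<close>. The points
      may coincide, which \<open>pd_on_indexed\<close> allows.\<close>
    define x where "x i = (if snd i then t (fst i) else fst i)" for i :: "'b \<times> bool"
    define d where "d i = (if snd i then - c (fst i) else c (fst i))" for i :: "'b \<times> bool"
    have "0 \<le> Re (\<Sum>i\<in>S \<times> UNIV. \<Sum>j\<in>S \<times> UNIV. d i * cnj (d j) * M (x i) (x j))"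
      using S t by (intro pd_on_indexed[OF M]) (auto simp: x_def)
    also have "(\<Sum>i\<in>S \<times> UNIV. \<Sum>j\<in>S \<times> UNIV. d i * cnj (d j) * M (x i) (x j)) =
        (\<Sum>g\<in>S. \<Sum>a\<in>UNIV. \<Sum>h\<in>S. \<Sum>b\<in>UNIV. d (g, a) * cnj (d (h, b)) * M (x (g, a)) (x (h, b)))"
      by (simp add: sum.cartesian_product' split_beta)
    also have "\<dots> = (\<Sum>g\<in>S. \<Sum>h\<in>S. c g * cnj (c h) * (M g h - M (t g) h))"
    proof (rule sum.cong[OF refl])
      fix g assume g: "g \<in> S"
      have "(\<Sum>a\<in>UNIV. \<Sum>h\<in>S. \<Sum>b\<in>UNIV. d (g, a) * cnj (d (h, b)) * M (x (g, a)) (x (h, b))) =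
          (\<Sum>h\<in>S. \<Sum>a\<in>UNIV. \<Sum>b\<in>UNIV. d (g, a) * cnj (d (h, b)) * M (x (g, a)) (x (h, b)))"
        by (rule sum.swap)
      also have "\<dots> = (\<Sum>h\<in>S. c g * cnj (c h) * (M g h - M (t g) h))"
      proof (rule sum.cong[OF refl])
        fix h assume h: "h \<in> S"
        have "M g (t h) = M (t g) h" "M (t g) (t h) = M (t g) h"
          using t(2)[of g h] t(2)[of "t g" h] t(1,3) g h S by (auto simp: subset_iff)
        thus "(\<Sum>a\<in>UNIV. \<Sum>b\<in>UNIV. d (g, a) * cnj (d (h, b)) * M (x (g, a)) (x (h, b))) =
            c g * cnj (c h) * (M g h - M (t g) h)"
          by (simp add: UNIV_bool x_def d_def algebra_simps)
      qed
      finally show "(\<Sum>a\<in>UNIV. \<Sum>h\<in>S. \<Sum>b\<in>UNIV. d (g, a) * cnj (d (h, b)) * M (x (g, a)) (x (h, b))) =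
          (\<Sum>h\<in>S. c g * cnj (c h) * (M g h - M (t g) h))" .
    qed
    finally show "0 \<le> Re (\<Sum>g\<in>S. \<Sum>h\<in>S. c g * cnj (c h) * (M g h - M (t g) h))" .
  qed
qed

text \<open>Elements of equal scale are split off one at a time: for \<open>q = k k\<^sup>-\<^sup>1\<close> the part \<open>L(q g, q h)\<close>
  of the kernel is pulled back to \<open>I1\<close> along \<open>g \<mapsto> k\<^sup>-\<^sup>1 g\<close>, and the remaining part
  \<open>L(g, h) - L(q g, h)\<close> vanishes at \<open>k\<close>.\<close>

lemma block_nonneg:
  assumes "finite S" "S \<subseteq> {g \<in> elts. \<not> is_zero I g \<and> N g = l}"
    and "\<And>p g h. \<lbrakk>p \<in> elts; p \<cdot> p = p; g \<in> elts; h \<in> elts\<rbrakk> \<Longrightarrow> L (p \<cdot> g) h = L g (p \<cdot> h)"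
    and "\<And>k. \<lbrakk>k \<in> elts; \<not> is_zero I k; N k = l\<rbrakk> \<Longrightarrow> pd_on I1 (\<lambda>g h. L (k \<cdot> g) (k \<cdot> h))"
  shows "0 \<le> Re (\<Sum>g\<in>S. \<Sum>h\<in>S. c g * cnj (c h) * L g h)"
  using assms
proof (induction S arbitrary: L rule: finite_induct)
  case (insert k S)
  note idem = insert.prems(2) and pd = insert.prems(3)
  note cl = mult_closed inv_closed
  have k: "k \<in> elts" "\<not> is_zero I k" "N k = l" and S: "S \<subseteq> {g \<in> elts. \<not> is_zero I g \<and> N g = l}" using insert.prems(1) by auto
  define q where "q = k \<cdot> iv k"
  have q: "q \<in> elts" "q \<cdot> q = q" "q \<cdot> k = k" using k by (auto simp: q_def cl mult_inv_idem mult_inv_mult)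
  have qq: "q \<cdot> (q \<cdot> g) = q \<cdot> g" if "g \<in> elts" for g using q that mult_assoc[of q q g] by simp
  define L' where "L' g h = L g h - L (q \<cdot> g) h" for g h
  have "0 \<le> Re (\<Sum>g\<in>S. \<Sum>h\<in>S. c g * cnj (c h) * L' g h)"
  proof (rule insert.IH[OF S])
    fix p g h assume p: "p \<in> elts" "p \<cdot> p = p" and g: "g \<in> elts" and h: "h \<in> elts"
    have "q \<cdot> (p \<cdot> g) = p \<cdot> (q \<cdot> g)"
      using idem_commute[OF q(1,2) p] q(1) p(1) g by (simp add: mult_assoc[symmetric])
    thus "L' (p \<cdot> g) h = L' g (p \<cdot> h)" using idem p g h q by (simp add: L'_def cl)
  next
    fix m assume m: "m \<in> elts" "\<not> is_zero I m" "N m = l"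
    \<comment> \<open>Multiplication by the projection \<open>q\<close>, pulled back along
      \<open>m\<close>, is multiplication by the conjugate \<open>iv m \<cdot> q \<cdot> m\<close>,
      an idempotent and therefore an element of \<open>I1\<close>.\<close>
    define t where "t g = iv m \<cdot> q \<cdot> m \<cdot> g" for g
    have p: "iv m \<cdot> q \<cdot> m \<in> elts" "iv m \<cdot> q \<cdot> m \<cdot> (iv m \<cdot> q \<cdot> m) = iv m \<cdot> q \<cdot> m"
    proof -
      have comm: "(m \<cdot> iv m) \<cdot> q = q \<cdot> (m \<cdot> iv m)" using m q by (intro idem_commute) (auto simp: cl mult_inv_idem)
      have "iv m \<cdot> q \<cdot> m \<cdot> (iv m \<cdot> q \<cdot> m) = iv m \<cdot> q \<cdot> ((m \<cdot> iv m) \<cdot> q) \<cdot> m" using m q by (simp add: cl mult_assoc)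
      also have "\<dots> = iv m \<cdot> (q \<cdot> q) \<cdot> (m \<cdot> iv m \<cdot> m)" unfolding comm using m q(1) by (simp add: cl mult_assoc)
      finally show "iv m \<cdot> q \<cdot> m \<cdot> (iv m \<cdot> q \<cdot> m) = iv m \<cdot> q \<cdot> m" using m q by (simp add: mult_inv_mult)
    qed (use m q in \<open>simp add: cl\<close>)
    have mt: "m \<cdot> t g = q \<cdot> (m \<cdot> g)" if "g \<in> elts" for g
    proof -
      have comm: "(m \<cdot> iv m) \<cdot> q = q \<cdot> (m \<cdot> iv m)" using m q by (intro idem_commute) (auto simp: cl mult_inv_idem)
      have "m \<cdot> t g = ((m \<cdot> iv m) \<cdot> q) \<cdot> m \<cdot> g" using m q(1) that by (simp add: t_def cl mult_assoc)
      also have "\<dots> = q \<cdot> ((m \<cdot> iv m \<cdot> m) \<cdot> g)" unfolding comm using m q(1) that by (simp add: cl mult_assoc)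
      finally show ?thesis using m by (simp add: mult_inv_mult)
    qed
    have "pd_on I1 (\<lambda>g h. L (m \<cdot> g) (m \<cdot> h) - L (m \<cdot> t g) (m \<cdot> h))"
    proof (rule pd_on_diff[OF pd[OF m]])
      fix g assume g: "g \<in> I1"
      show "t g \<in> I1" unfolding t_def using I1_mult[OF I1_idem[OF p] g] .
      show "t (t g) = t g" unfolding t_def using p I1_elts[OF g] by (simp add: mult_assoc[of "iv m \<cdot> q \<cdot> m" "iv m \<cdot> q \<cdot> m" g, symmetric])
      fix h assume h: "h \<in> I1"
      show "L (m \<cdot> t g) (m \<cdot> h) = L (m \<cdot> g) (m \<cdot> t h)"
        using I1_elts[OF g] I1_elts[OF h] m q by (simp add: mt idem cl)
    qed
    thus "pd_on I1 (\<lambda>g h. L' (m \<cdot> g) (m \<cdot> h))"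
      by (rule pd_on_cong) (simp add: L'_def mt I1_elts)
  qed
  also have "(\<Sum>g\<in>S. \<Sum>h\<in>S. c g * cnj (c h) * L' g h) = (\<Sum>g\<in>insert k S. \<Sum>h\<in>insert k S. c g * cnj (c h) * L' g h)"
  proof -
    \<comment> \<open>Since \<open>q \<cdot> k = k\<close>, the remaining kernel vanishes at
      \<open>k\<close>; its sum over \<open>S\<close> is therefore also its sum over
      \<open>insert k S\<close>.\<close>
    have "L' k h = 0" "L' h k = 0" if "h \<in> elts" for h
      using q k idem[OF q(1,2) that k(1)] that by (auto simp: L'_def)
    thus ?thesis using insert.hyps S k by (simp add: subset_iff)
  qed
  finally have 1: "0 \<le> Re (\<Sum>g\<in>insert k S. \<Sum>h\<in>insert k S. c g * cnj (c h) * L' g h)" .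
  have "0 \<le> Re (\<Sum>g\<in>insert k S. \<Sum>h\<in>insert k S. c g * cnj (c h) * L (k \<cdot> (iv k \<cdot> g)) (k \<cdot> (iv k \<cdot> h)))"
    using insert.hyps insert.prems(1) k by (intro pd_on_indexed[OF pd[OF k]]) (auto intro!: inv_mult_I1)
  also have "(\<Sum>g\<in>insert k S. \<Sum>h\<in>insert k S. c g * cnj (c h) * L (k \<cdot> (iv k \<cdot> g)) (k \<cdot> (iv k \<cdot> h))) =
      (\<Sum>g\<in>insert k S. \<Sum>h\<in>insert k S. c g * cnj (c h) * L (q \<cdot> g) h)"
  proof (intro sum.cong refl)
    fix g h assume "g \<in> insert k S" "h \<in> insert k S"
    hence gh: "g \<in> elts" "h \<in> elts" using k S by auto
    have "k \<cdot> (iv k \<cdot> g) = q \<cdot> g" "k \<cdot> (iv k \<cdot> h) = q \<cdot> h" using k gh by (auto simp: q_def cl mult_assoc)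
    moreover have "L (q \<cdot> g) (q \<cdot> h) = L (q \<cdot> g) h" using idem[OF q(1,2), of "q \<cdot> g" h] gh q qq by (simp add: cl)
    ultimately show "c g * cnj (c h) * L (k \<cdot> (iv k \<cdot> g)) (k \<cdot> (iv k \<cdot> h)) = c g * cnj (c h) * L (q \<cdot> g) h" by simp
  qed
  finally have 2: "0 \<le> Re (\<Sum>g\<in>insert k S. \<Sum>h\<in>insert k S. c g * cnj (c h) * L (q \<cdot> g) h)" .
  have "(\<Sum>g\<in>insert k S. \<Sum>h\<in>insert k S. c g * cnj (c h) * L g h) =
      (\<Sum>g\<in>insert k S. \<Sum>h\<in>insert k S. c g * cnj (c h) * L' g h) + (\<Sum>g\<in>insert k S. \<Sum>h\<in>insert k S. c g * cnj (c h) * L (q \<cdot> g) h)"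
    by (simp only: sum.distrib[symmetric] distrib_left[symmetric] L'_def diff_add_cancel)
  thus ?case using 1 2 by (simp only: plus_complex.sel)
qed simp

text \<open>Elements of different scale are orthogonal for \<open>f\<close>, since every element of
  \<open>Ic\<close> has scale 1. The quadratic form is thus a sum over scales. Every block is
  nonnegative by \<open>block_nonneg\<close>, and the block of scale 1 alone dominates the linear
  term, by the state inequality for the crystal.\<close>

lemma extend_state:
  assumes \<phi>: "C.state \<phi>"
  defines "f \<equiv> \<lambda>g. if g \<in> Ic then \<phi> (Some g) else 0"
  shows "state f"
proof -
  have f_inv: "f (iv g) = cnj (f g)" if g: "g \<in> elts" for g
  proof (cases "g \<in> Ic")
    case True
    thus ?thesis using C.state_inv[OF \<phi>, of "Some g"] by (simp add: f_def Ic_inv crystal_inv)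
  qed (use g in \<open>simp add: f_def Ic_inv_iff\<close>)
  show ?thesis
    unfolding state_def
  proof (intro conjI allI ballI impI)
    fix z assume "is_zero I z" thus "f z = 0" using Ic_nonzero by (auto simp: f_def)
  next
    fix S and c :: "'a \<Rightarrow> complex" assume S: "finite S" "S \<subseteq> elts"
    have \<phi>0: "\<phi> None = 0" using C.state_zero[OF \<phi>] by (simp add: crystal_zero)
    have I1_state: "(cmod (\<Sum>g\<in>S. c g * f g))\<^sup>2 \<le> Re (quad S c f)" if S: "finite S" "S \<subseteq> I1" for S c
    proof -
      let ?S = "Some ` (S \<inter> Ic)"
      have im: "{g. Some g \<in> ?S} = S \<inter> Ic" by auto
      have "(cmod (\<Sum>u\<in>?S. c (the u) * \<phi> u))\<^sup>2 \<le> Re (C.quad ?S (\<lambda>u. c (the u)) \<phi>)"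
        using S by (intro C.state_quad[OF \<phi>]) auto
      also have "C.quad ?S (\<lambda>u. c (the u)) \<phi> = quad (S \<inter> Ic) c f"
        using S \<phi>0 by (subst crystal_quad[where f = f]) (auto simp: f_def im)
      also have "\<dots> = quad S c f" using S by (intro quad_restrict[symmetric]) (auto simp: f_def)
      also have "(\<Sum>u\<in>?S. c (the u) * \<phi> u) = (\<Sum>g\<in>S \<inter> Ic. c g * f g)" by (simp add: sum.reindex f_def)
      also have "\<dots> = (\<Sum>g\<in>S. c g * f g)" using S by (intro sum.mono_neutral_left) (auto simp: f_def)
      finally show ?thesis .
    qed
    have pd: "pd_on I1 (\<lambda>g h. f (iv h \<cdot> g))"
      unfolding pd_on_def
    proof (intro conjI ballI allI impI)
      fix g h assume "g \<in> I1" "h \<in> I1"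
      hence gh: "g \<in> elts" "h \<in> elts" by (auto simp: I1_elts)
      have "iv (iv h \<cdot> g) = iv g \<cdot> h" using gh by (simp add: inv_mult inv_inv inv_closed)
      thus "f (iv g \<cdot> h) = cnj (f (iv h \<cdot> g))"
        using f_inv[of "iv h \<cdot> g"] gh by (simp add: mult_closed inv_closed)
    next
      fix S c assume "finite S" "S \<subseteq> I1"
      from I1_state[OF this, of c] show "0 \<le> Re (\<Sum>g\<in>S. \<Sum>h\<in>S. c g * cnj (c h) * f (iv h \<cdot> g))"
        unfolding quad_def by (rule order_trans[OF zero_le_power2])
    qed
    \<comment> \<open>The level 0 is not a value of the scale on nonzero elements; it collects a
      possible zero of \<open>I\<close>, whose block vanishes.\<close>
    define lev where "lev g = (if is_zero I g then 0 else N g)" for g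
    let ?B = "\<lambda>l. {g \<in> S. lev g = l}"
    have off: "f (iv h \<cdot> g) = 0" if "g \<in> elts" "h \<in> elts" "lev g \<noteq> lev h \<or> lev g = 0" for g h
    proof (rule ccontr)
      assume "f (iv h \<cdot> g) \<noteq> 0"
      hence ic: "iv h \<cdot> g \<in> Ic" by (auto simp: f_def split: if_splits)
      have nz: "\<not> is_zero I (iv h \<cdot> g)" "N (iv h \<cdot> g) = 1" using Ic_nonzero[OF ic] Ic_I1[OF ic] by (auto simp: I1_def)
      have z: "\<not> is_zero I g" "\<not> is_zero I h"
        using nonzero_factors[of "iv h" g] nz that by (auto simp: inv_closed is_zero_inv)
      have "N h = N g"
        using N_mult[of "iv h" g] nz that z N_inv[of h] N_pos[of h] by (simp add: inv_closed field_simps)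
      thus False using that z N_pos[of g] by (simp add: lev_def)
    qed
    have blocks: "quad S c f = (\<Sum>l\<in>lev ` S. quad (?B l) c f)"
    proof -
      have "quad S c f = (\<Sum>l\<in>lev ` S. \<Sum>g\<in>?B l. \<Sum>h\<in>S. c g * cnj (c h) * f (iv h \<cdot> g))"
        unfolding quad_def by (rule sum.image_gen[OF S(1)])
      also have "\<dots> = (\<Sum>l\<in>lev ` S. quad (?B l) c f)"
        unfolding quad_def
      proof (rule sum.cong[OF refl], rule sum.cong[OF refl])
        fix l g assume g: "g \<in> ?B l"
        show "(\<Sum>h\<in>S. c g * cnj (c h) * f (iv h \<cdot> g)) = (\<Sum>h\<in>?B l. c g * cnj (c h) * f (iv h \<cdot> g))"
        proof (rule sum.mono_neutral_right)
          have "f (iv h \<cdot> g) = 0" if "h \<in> S" "lev h \<noteq> l" for h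
            by (rule off) (use that g S in auto)
          thus "\<forall>h\<in>S - ?B l. c g * cnj (c h) * f (iv h \<cdot> g) = 0" by simp
        qed (use S in auto)
      qed
      finally show ?thesis .
    qed
    have nonneg: "0 \<le> Re (quad (?B l) c f)" for l
    proof (cases "l = 0")
      case True
      have "quad (?B l) c f = 0" unfolding quad_def using S off True by (intro sum.neutral ballI) auto
      thus ?thesis by simp
    next
      case False
      show ?thesis unfolding quad_def
      proof (rule block_nonneg[of _ l])
        fix p g h assume "p \<in> elts" "p \<cdot> p = p" "g \<in> elts" "h \<in> elts"
        thus "f (iv h \<cdot> (p \<cdot> g)) = f (iv (p \<cdot> h) \<cdot> g)" by (simp add: inv_mult inv_idem mult_assoc inv_closed mult_closed)
      next
        fix k assume k: "k \<in> elts"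
        \<comment> \<open>The kernel pulled back along \<open>k\<close> is the kernel on
          \<open>I1\<close> pulled back along \<open>g \<mapsto> p \<cdot> g\<close>, because
          \<open>iv (k \<cdot> h) \<cdot> (k \<cdot> g) = iv (p \<cdot> h) \<cdot> (p \<cdot>
          g)\<close>.\<close>
        define p where "p = iv k \<cdot> k"
        have p: "p \<in> elts" "p \<cdot> p = p" "iv p = p" using k by (auto simp: p_def mult_closed inv_closed inv_mult_idem inv_mult inv_inv)
        have eq: "f (iv (k \<cdot> h) \<cdot> (k \<cdot> g)) = f (iv (p \<cdot> h) \<cdot> (p \<cdot> g))" if "g \<in> I1" "h \<in> I1" for g h
        proof -
          have gh: "g \<in> elts" "h \<in> elts" using that by (auto simp: I1_elts)
          have "iv (k \<cdot> h) \<cdot> (k \<cdot> g) = iv h \<cdot> (p \<cdot> g)" using k gh by (simp add: p_def inv_mult mult_assoc mult_closed inv_closed)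
          also have "p \<cdot> g = p \<cdot> (p \<cdot> g)" using p gh mult_assoc[of p p g] by simp
          also have "iv h \<cdot> (p \<cdot> (p \<cdot> g)) = iv (p \<cdot> h) \<cdot> (p \<cdot> g)"
            using p(1,3) gh by (simp add: inv_mult mult_assoc mult_closed inv_closed)
          finally show ?thesis by simp
        qed
        show "pd_on I1 (\<lambda>g h. f (iv (k \<cdot> h) \<cdot> (k \<cdot> g)))"
          unfolding pd_on_def
        proof (intro conjI ballI allI impI)
          fix g h assume gh: "g \<in> I1" "h \<in> I1"
          have "p \<cdot> g \<in> I1" "p \<cdot> h \<in> I1" using gh by (auto intro: I1_mult I1_idem p)
          thus "f (iv (k \<cdot> g) \<cdot> (k \<cdot> h)) = cnj (f (iv (k \<cdot> h) \<cdot> (k \<cdot> g)))"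
            using pd gh unfolding pd_on_def eq[OF gh] eq[OF gh(2,1)] by blast
        next
          fix S c assume S: "finite S" "S \<subseteq> I1"
          have "0 \<le> Re (\<Sum>g\<in>S. \<Sum>h\<in>S. c g * cnj (c h) * f (iv (p \<cdot> h) \<cdot> (p \<cdot> g)))"
            using S by (intro pd_on_indexed[OF pd]) (auto intro!: I1_mult I1_idem[OF p(1,2)])
          also have "(\<Sum>g\<in>S. \<Sum>h\<in>S. c g * cnj (c h) * f (iv (p \<cdot> h) \<cdot> (p \<cdot> g))) =
              (\<Sum>g\<in>S. \<Sum>h\<in>S. c g * cnj (c h) * f (iv (k \<cdot> h) \<cdot> (k \<cdot> g)))"
            by (intro sum.cong refl) (use S in \<open>simp add: eq subset_iff\<close>)
          finally show "0 \<le> Re (\<Sum>g\<in>S. \<Sum>h\<in>S. c g * cnj (c h) * f (iv (k \<cdot> h) \<cdot> (k \<cdot> g)))" .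
        qed
      qed (use S False in \<open>auto simp: lev_def split: if_splits\<close>)
    qed
    have B1: "finite (?B 1)" "?B 1 \<subseteq> I1" using S by (auto simp: I1_def lev_def split: if_splits)
    have "(\<Sum>g\<in>S. c g * f g) = (\<Sum>g\<in>?B 1. c g * f g)"
    proof (rule sum.mono_neutral_right)
      have "f g = 0" if "g \<in> S" "lev g \<noteq> 1" for g
        using that Ic_I1[of g] Ic_nonzero[of g] by (auto simp: f_def lev_def I1_def split: if_splits)
      thus "\<forall>g\<in>S - ?B 1. c g * f g = 0" by auto
    qed (use S in auto)
    also have "(cmod (\<Sum>g\<in>?B 1. c g * f g))\<^sup>2 \<le> Re (quad (?B 1) c f)" by (rule I1_state[OF B1])
    also have "\<dots> \<le> (\<Sum>l\<in>lev ` S. Re (quad (?B l) c f))"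
    proof (cases "1 \<in> lev ` S")
      case True
      show ?thesis using S True nonneg by (intro member_le_sum) auto
    next
      case False
      hence "?B 1 = {}" by auto
      hence "quad (?B 1) c f = 0" unfolding quad_def by (simp only: sum.empty)
      thus ?thesis using nonneg by (simp add: sum_nonneg)
    qed
    also have "\<dots> = Re (quad S c f)" unfolding blocks by simp
    finally show "(cmod (\<Sum>g\<in>S. c g * f g))\<^sup>2 \<le> Re (quad S c f)" .
  qed (rule f_inv)
qed

text \<open>The image of \<open>lin S c\<close> under the homomorphism to be constructed: the terms
  in the ideal \<open>I1 - Ic\<close> are dropped.\<close>

definition clin :: "'a set \<Rightarrow> ('a \<Rightarrow> complex) \<Rightarrow> ('a option, 'a option) rep \<Rightarrow> 'a option opr" where
  "clin S c = C.lin (Some ` (S \<inter> Ic)) (\<lambda>u. c (the u))"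

lemma clin_closed: "clin S c \<in> cs_carrier (C0star Cr)"
  unfolding clin_def by (rule C.lin_closed) auto

text \<open>Contractivity of the homomorphism: each vector state of the crystal extends by zero to a
  state of \<open>I\<close> with the same value on the element, and \<open>state_le_norm\<close>
  applies to it.\<close>

lemma norm_clin_le:
  assumes S: "finite S" "S \<subseteq> I1"
  shows "C.A.nm (clin S c) \<le> A.nm (lin S c)"
  unfolding C.C0star_simps
proof (rule fam_norm_le)
  fix r :: "('a option, 'a option) rep" assume r: "is_rep Cr r"
  interpret hilbert_space "fst r" by (rule is_repD[OF r])
  show "opr_norm (fst r) (clin S c r) \<le> A.nm (lin S c)"
  proof (rule opr_norm_le)
    fix x assume x: "x \<in> hvecs (fst r)" "hnorm (fst r) x \<le> 1"
    define \<phi> where "\<phi> u = (if u \<in> insert None (Some ` Ic) then hip (fst r) (snd r u x) x else 0)" for u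
    define f where "f g = (if g \<in> Ic then \<phi> (Some g) else 0)" for g
    let ?S = "Some ` (S \<inter> Ic)"
    have im: "{g. Some g \<in> ?S} = S \<inter> Ic" by auto
    have st: "C.state \<phi>" unfolding \<phi>_def by (rule C.vector_state[OF r x])
    have \<phi>0: "\<phi> None = 0" using C.state_zero[OF st] by (simp add: crystal_zero)
    have "(hnorm (fst r) (clin S c r x))\<^sup>2 = Re (C.quad ?S (\<lambda>u. c (the u)) \<phi>)"
      unfolding clin_def \<phi>_def using S by (intro C.vector_state(2)[OF r x, symmetric]) auto
    also have "C.quad ?S (\<lambda>u. c (the u)) \<phi> = quad (S \<inter> Ic) c f"
      using S \<phi>0 by (subst crystal_quad[where f = f]) (auto simp: f_def im)
    also have "\<dots> = quad S c f" using S by (intro quad_restrict[symmetric]) (auto simp: f_def)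
    also have "Re \<dots> \<le> (A.nm (lin S c))\<^sup>2"
      using extend_state[OF st] S I1_elts by (intro state_le_norm) (auto simp: f_def[abs_def])
    finally show "hnorm (fst r) (clin S c r x) \<le> A.nm (lin S c)"
      using S I1_elts by (intro power2_le_imp_le[OF _ A.norm_nonneg[OF lin_closed]]) auto
  qed
qed

end


section \<open>Approximating ground states\<close>

text \<open>Tychonoff's theorem for a product of closed unit discs.\<close>

lemma compact_unit_discs: "compact {f :: 'x \<Rightarrow> complex. \<forall>g. cmod (f g) \<le> 1}"
proof -
  have "compactin (product_topology (\<lambda>_ :: 'x. euclidean :: complex topology) UNIV) (PiE UNIV (\<lambda>_. cball 0 1))"
    by (simp add: compactin_PiE)
  moreover have "PiE UNIV (\<lambda>_ :: 'x. cball (0 :: complex) 1) = {f. \<forall>g. cmod (f g) \<le> 1}" by (auto simp: PiE_def Pi_def)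
  ultimately show ?thesis by (simp add: euclidean_product_topology)
qed

context inverse_semigroup
begin

text \<open>Each condition involves finitely many coordinates of \<open>f\<close>, continuously and
  with a weak inequality or an equation.\<close>

lemma closed_states: "closed {f. state f \<and> b \<le> Re (quad S c f)}"
  unfolding state_def quad_def Ball_def
  by (intro closed_Collect_conj closed_Collect_all closed_Collect_imp open_Collect_const closed_Collect_eq closed_Collect_le
      continuous_intros continuous_on_product_coordinates)

end

context scaled_semigroup
begin

lemma ideal_mult:
  assumes g: "g \<in> I1 - Ic" and h: "h \<in> I1" shows "g \<cdot> h \<in> I1 - Ic" "h \<cdot> g \<in> I1 - Ic"
  using g h I1_mult[of g h] I1_mult[of h g] Ic_factors[of g h] Ic_factors[of h g] by auto

lemma V_I1: "V ` I1 \<subseteq> A.carr" "V ` (I1 - Ic) \<subseteq> A.carr"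
  using I1_elts by (auto intro!: V_closed)

lemma ideal_span_I1: "a \<in> A.spn (V ` (I1 - Ic)) \<Longrightarrow> a \<in> A.spn (V ` I1)"
  by (erule A.span_induct_subset) (auto simp: A.span_zero A.span_add cs_span.scale intro: cs_span.base)

text \<open>The product stays in the algebraic span, so \<open>cut_down\<close> changes
  \<open>a\<close> by an element of the ideal without passing to the closure.\<close>

lemma span_mul_ideal:
  assumes a: "a \<in> A.spn (V ` I1)" and p: "p \<in> I1 - Ic"
  shows "A.mul a (V p) \<in> A.spn (V ` (I1 - Ic))"
proof -
  have pe: "p \<in> elts" using p by (simp add: I1_elts)
  have "a \<in> {a \<in> A.carr. A.mul a (V p) \<in> A.spn (V ` (I1 - Ic))}"
  proof (rule A.span_induct_subset[OF a])
    show "V ` I1 \<subseteq> {a \<in> A.carr. A.mul a (V p) \<in> A.spn (V ` (I1 - Ic))}"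
    proof
      fix x assume "x \<in> V ` I1"
      then obtain g where g: "g \<in> I1" "x = V g" by blast
      have "V (g \<cdot> p) \<in> A.spn (V ` (I1 - Ic))" using ideal_mult(2)[OF p g(1)] by (intro cs_span.base) simp
      thus "x \<in> {a \<in> A.carr. A.mul a (V p) \<in> A.spn (V ` (I1 - Ic))}"
        using g pe by (simp add: I1_elts V_closed mul_V)
    qed
  qed (use V_closed[OF pe] in \<open>auto simp: A.closed A.mul_zero A.mul_add_left A.mult_scale_left A.span_zero
      intro: A.span_add cs_span.scale\<close>)
  thus ?thesis by simp
qed

text \<open>\<open>b\<close> is the product of \<open>a\<close> with the projections \<open>1 - v\<^sub>p\<close>, \<open>p \<in> F\<close>.\<close>

lemma cut_down:
  assumes "finite F" "F \<subseteq> {p \<in> I1 - Ic. p \<cdot> p = p}" "a \<in> A.spn (V ` I1)"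
  shows "\<exists>b. b - a \<in> A.spn (V ` (I1 - Ic)) \<and> (\<forall>r x. is_rep I r \<longrightarrow> x \<in> hvecs (fst r) \<longrightarrow>
      (\<exists>y\<in>hvecs (fst r). hnorm (fst r) y \<le> hnorm (fst r) x \<and> b r x = a r y \<and> (\<forall>p\<in>F. snd r p y = 0)))"
  using assms
proof (induction F arbitrary: a rule: finite_induct)
  case empty
  show ?case by (intro exI[of _ a]) (auto simp: A.span_zero)
next
  case (insert p F)
  have p: "p \<in> I1 - Ic" "p \<cdot> p = p" "p \<in> elts" and F: "F \<subseteq> {p \<in> I1 - Ic. p \<cdot> p = p}"
    using insert.prems(1) I1_elts by auto
  define a' where "a' = a - A.mul a (V p)"
  have ap: "A.mul a (V p) \<in> A.spn (V ` (I1 - Ic))" by (rule span_mul_ideal[OF insert.prems(2) p(1)])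
  have a': "a' \<in> A.spn (V ` I1)"
    unfolding a'_def by (rule A.span_diff[OF V_I1(1) insert.prems(2) ideal_span_I1[OF ap]])
  have ac: "a \<in> A.carr" using insert.prems(2) A.span_closed[OF V_I1(1)] by blast
  obtain b where b: "b - a' \<in> A.spn (V ` (I1 - Ic))"
    and cut: "\<And>r x. \<lbrakk>is_rep I r; x \<in> hvecs (fst r)\<rbrakk> \<Longrightarrow>
      \<exists>y\<in>hvecs (fst r). hnorm (fst r) y \<le> hnorm (fst r) x \<and> b r x = a' r y \<and> (\<forall>p\<in>F. snd r p y = 0)"
    using insert.IH[OF F a'] by blast
  have "(b - a') - A.mul a (V p) \<in> A.spn (V ` (I1 - Ic))" by (rule A.span_diff[OF V_I1(2) b ap])
  hence "b - a \<in> A.spn (V ` (I1 - Ic))" by (simp add: a'_def algebra_simps)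
  moreover have "\<exists>y\<in>hvecs (fst r). hnorm (fst r) y \<le> hnorm (fst r) x \<and> b r x = a r y \<and> (\<forall>q\<in>insert p F. snd r q y = 0)"
    if r: "is_rep I r" and x: "x \<in> hvecs (fst r)" for r x
  proof -
    interpret hilbert_space "fst r" by (rule is_repD[OF r])
    obtain y where y: "y \<in> hvecs (fst r)" "nrm y \<le> nrm x" "b r x = a' r y" "\<And>q. q \<in> F \<Longrightarrow> snd r q y = 0"
      using cut[OF r x] by blast
    have bd: "bounded_opr (fst r) (snd r q)" if "q \<in> elts" for q using is_repD(2)[OF r that] .
    define P where "P = snd r p"
    have P: "bounded_opr (fst r) P" unfolding P_def by (rule bd[OF p(3)])
    have PP: "P (P z) = P z" for z using is_repD(3)[OF r p(3) p(3)] p(2) by (simp add: P_def fun_eq_iff)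
    have adjP: "opr_adj (fst r) P = P" using is_repD(4)[OF r p(3)] inv_idem[OF p(3,2)] by (simp add: P_def)
    have Py: "P y \<in> hvecs (fst r)" by (rule opr_mem[OF P y(1)])
    define z where "z = y - P y"
    have z: "z \<in> hvecs (fst r)" unfolding z_def by (intro diff_mem y Py)
    have "ip y (P y) = ip (P y) (P y)" using ip_opr_adj[OF P y(1) Py] adjP PP ip_opr_adj'[OF P y(1) Py] by (simp add: PP)
    hence "(nrm z)\<^sup>2 = (nrm y)\<^sup>2 - (nrm (P y))\<^sup>2"
      unfolding z_def using hnorm_diff_sq[OF y(1) Py] by (simp add: hnorm_sq[OF Py])
    hence "(nrm z)\<^sup>2 \<le> (nrm y)\<^sup>2" by simp
    hence "nrm z \<le> nrm y" by (rule power2_le_imp_le) (rule hnorm_nonneg[OF y(1)])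
    moreover have "b r x = a r z"
    proof -
      have "a r z = a r y - a r (P y)"
        unfolding z_def using ac C0star_closed_rep_families r y(1) Py by (intro opr_diff rep_families_bounded[of _ I]) auto
      also have "\<dots> = a' r y"
        by (simp add: a'_def fam_apply opr_apply C0star_simps rep_families_simps univ_gen_rep[OF r] P_def)
      finally show ?thesis using y(3) by simp
    qed
    moreover have "snd r p z = 0"
      using opr_diff[OF P y(1) Py] PP by (simp add: z_def P_def)
    \<comment> \<open>The projections commute, so the cut by \<open>p\<close> preserves the kernels
      of the earlier projections.\<close>
    moreover have "snd r q z = 0" if q: "q \<in> F" for q
    proof -
      have qe: "q \<in> elts" "q \<cdot> q = q" using q F I1_elts by auto
      have "snd r q (P y) = P (snd r q y)"
        using idem_commute[OF qe p(3,2)] is_repD(3)[OF r qe(1) p(3)] is_repD(3)[OF r p(3) qe(1)]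
        by (simp add: P_def fun_eq_iff)
      thus ?thesis using opr_diff[OF bd[OF qe(1)] y(1) Py] y(4)[OF q] opr_zero[OF P] by (simp add: z_def)
    qed
    ultimately show ?thesis using z y(2) by (intro bexI[of _ z]) auto
  qed
  ultimately show ?case by blast
qed

text \<open>Vanishing on the idempotents of the ideal is enough, since the state inequality at one
  element gives \<open>|f (iv g)|\<^sup>2 \<le> f (g \<cdot> iv g)\<close>.\<close>

lemma restrict_state:
  assumes f: "state f" and null: "\<And>p. \<lbrakk>p \<in> I1 - Ic; p \<cdot> p = p\<rbrakk> \<Longrightarrow> f p = 0"
  defines "\<phi> \<equiv> \<lambda>u. case u of None \<Rightarrow> 0 | Some g \<Rightarrow> f g"
  shows "C.state \<phi>" and "g \<in> I1 \<Longrightarrow> f g = (if g \<in> Ic then \<phi> (Some g) else 0)"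
proof -
  have f0: "f g = 0" if g: "g \<in> I1 - Ic" for g
  proof -
    have ge: "g \<in> elts" "iv g \<in> I1" using g by (auto simp: I1_elts I1_inv)
    have "g \<cdot> iv g \<in> I1 - Ic" by (rule ideal_mult(1)[OF g ge(2)])
    hence "f (g \<cdot> iv g) = 0" using ge by (intro null) (auto simp: mult_inv_idem)
    hence "(cmod (f (iv g)))\<^sup>2 \<le> 0"
      using state_quad[OF f, of "{iv g}" "\<lambda>_. 1"] ge by (simp add: quad_def inv_closed inv_inv)
    thus ?thesis using state_inv[OF f ge(1)] by simp
  qed
  show ext: "f g = (if g \<in> Ic then \<phi> (Some g) else 0)" if "g \<in> I1" for g
    using f0[of g] that by (simp add: \<phi>_def)
  show "C.state \<phi>"
    unfolding C.state_def
  proof (intro conjI allI ballI impI)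
    fix u assume "is_zero Cr u" thus "\<phi> u = 0" by (simp add: crystal_zero \<phi>_def)
  next
    fix u assume "u \<in> insert None (Some ` Ic)"
    moreover have "sg_inv Cr None = None" by (rule C.inv_zero) (simp add: crystal_zero)
    ultimately show "\<phi> (sg_inv Cr u) = cnj (\<phi> u)"
      by (auto simp: \<phi>_def crystal_inv state_inv[OF f] Ic_elts)
  next
    fix S and c :: "'a option \<Rightarrow> complex" assume S: "finite S" "S \<subseteq> insert None (Some ` Ic)"
    let ?S = "{g. Some g \<in> S}"
    have fin: "finite ?S" using finite_vimageI[OF S(1), of Some] by (simp add: vimage_def)
    have sub: "?S \<subseteq> elts" using S(2) Ic_elts by blast
    have "(\<Sum>u\<in>S. c u * \<phi> u) = (\<Sum>g\<in>?S. c (Some g) * f g)"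
      using S by (subst crystal_sum) (auto simp: \<phi>_def)
    moreover have "C.quad S c \<phi> = quad ?S (\<lambda>g. c (Some g)) f"
      by (rule crystal_quad[OF S ext]) (auto simp: \<phi>_def)
    ultimately show "(cmod (\<Sum>u\<in>S. c u * \<phi> u))\<^sup>2 \<le> Re (C.quad S c \<phi>)"
      using state_quad[OF f fin sub] by simp
  qed
qed

lemma quotient_norm_le:
  assumes S: "finite S" "S \<subseteq> I1" and e: "0 < e"
  shows "\<exists>j \<in> A.spn (V ` (I1 - Ic)). A.nm (lin S c + j) < C.A.nm (clin S c) + e"
proof (rule ccontr)
  assume "\<not> ?thesis"
  hence large: "C.A.nm (clin S c) + e \<le> A.nm (lin S c + j)" if "j \<in> A.spn (V ` (I1 - Ic))" for j
    using that by (meson not_le)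
  \<comment> \<open>A number strictly between the norm in the crystal and the assumed lower bound:
    the upper gap produces vectors on which \<open>b\<close> exceeds \<open>m\<close>, and the lower
    gap gives the final contradiction.\<close>
  define m where "m = C.A.nm (clin S c) + e / 2"
  have m: "0 \<le> m" "m < C.A.nm (clin S c) + e" "C.A.nm (clin S c) < m"
    using e C.A.norm_nonneg[OF clin_closed] by (auto simp: m_def add_nonneg_pos less_imp_le)
  have Se: "S \<subseteq> elts" using S I1_elts by blast
  define B where "B = {f. state f \<and> m\<^sup>2 \<le> Re (quad S c f)}"
  define X where "X = {f :: 'a \<Rightarrow> complex. \<forall>g. cmod (f g) \<le> 1}"
  define P where "P = {p \<in> I1 - Ic. p \<cdot> p = p}"
  define Z where "Z p = {f :: 'a \<Rightarrow> complex. f p = 0}" for p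
  have lin_I1: "lin S c \<in> A.spn (V ` I1)" by (rule lin_in_span[OF S(2)])
  \<comment> \<open>Modulo the ideal \<open>lin S c\<close> agrees with some \<open>b\<close> of
    norm greater than \<open>m\<close>. A vector where \<open>b\<close> exceeds \<open>m\<close> is
    replaced by one killed by the projections in \<open>F\<close>, on which \<open>lin S c\<close>
    takes the same value; \<open>f\<close> is its vector state.\<close>
  have fin: "\<exists>f \<in> X. f \<in> B \<and> (\<forall>p\<in>F. f p = 0)" if F: "finite F" "F \<subseteq> P" for F
  proof -
    obtain b where b: "b - lin S c \<in> A.spn (V ` (I1 - Ic))"
      and cut: "\<And>r x. \<lbrakk>is_rep I r; x \<in> hvecs (fst r)\<rbrakk> \<Longrightarrow>
        \<exists>y\<in>hvecs (fst r). hnorm (fst r) y \<le> hnorm (fst r) x \<and> b r x = lin S c r y \<and> (\<forall>p\<in>F. snd r p y = 0)"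
      using cut_down[OF F(1) F(2)[unfolded P_def] lin_I1] by blast
    have "m < A.nm b" using large[OF b] m by simp
    then obtain r where r: "is_rep I r" "m < opr_norm (fst r) (b r)"
      using less_fam_normD[of m I b] by (auto simp: C0star_simps)
    interpret hilbert_space "fst r" by (rule is_repD[OF r(1)])
    obtain x where x: "x \<in> hvecs (fst r)" "nrm x \<le> 1" "m < nrm (b r x)"
      using opr_norm_le[of "b r" m] r(2) by (meson not_le)
    obtain y where y: "y \<in> hvecs (fst r)" "nrm y \<le> nrm x" "b r x = lin S c r y" "\<And>p. p \<in> F \<Longrightarrow> snd r p y = 0"
      using cut[OF r(1) x(1)] by blast
    have y1: "nrm y \<le> 1" using y(2) x(2) by simp
    define f where "f g = (if g \<in> elts then hip (fst r) (snd r g y) y else 0)" for g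
    have st: "state f" unfolding f_def by (rule vector_state[OF r(1) y(1) y1])
    have "Re (quad S c f) = (nrm (lin S c r y))\<^sup>2"
      unfolding f_def by (rule vector_state(2)[OF r(1) y(1) y1 S(1) Se])
    moreover have "m\<^sup>2 \<le> (nrm (lin S c r y))\<^sup>2" using x(3) y(3) m(1) by (intro power_mono) auto
    ultimately have "f \<in> B" using st by (simp add: B_def)
    moreover have "f p = 0" if "p \<in> F" for p using y that by (simp add: f_def ip_zero_left)
    moreover have "cmod (f g) \<le> 1" for g
    proof (cases "g \<in> elts")
      case True
      have bd: "bounded_opr (fst r) (snd r g)" by (rule is_repD(2)[OF r(1) True])
      have "opr_norm (fst r) (snd r g) \<le> 1"
        by (rule opr_norm_partial_isometry[OF bd is_repD(6)[OF r(1) True]])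
      hence 1: "nrm (snd r g y) \<le> 1" using hnorm_opr_le_unit[OF bd y(1) y1] by simp
      have "cmod (f g) \<le> nrm (snd r g y) * nrm y" using True cauchy_schwarz[OF opr_mem[OF bd y(1)] y(1)] by (simp add: f_def)
      also have "\<dots> \<le> 1 * 1" using 1 y1 hnorm_nonneg[OF y(1)] by (intro mult_mono) auto
      finally show ?thesis by simp
    qed (simp add: f_def)
    ultimately show ?thesis unfolding X_def by blast
  qed
  \<comment> \<open>Finite intersection property: a common point is a state that vanishes on all
    idempotents of the ideal and still attains \<open>m\<^sup>2\<close>.\<close>
  have "X \<inter> \<Inter>(insert B (Z ` P)) \<noteq> {}"
  proof (rule compact_imp_fip)
    show "compact X" unfolding X_def by (rule compact_unit_discs)
    show "closed T" if "T \<in> insert B (Z ` P)" for T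
    proof -
      have "closed (Z p)" for p unfolding Z_def
        by (intro closed_Collect_eq continuous_on_product_coordinates continuous_intros)
      thus ?thesis using that closed_states by (auto simp: B_def)
    qed
    fix \<F> assume "finite \<F>" "\<F> \<subseteq> insert B (Z ` P)"
    hence "finite (\<F> - {B})" "\<F> - {B} \<subseteq> Z ` P" by auto
    then obtain F where F: "F \<subseteq> P" "finite F" "\<F> - {B} = Z ` F"
      using finite_subset_image by metis
    obtain f where "f \<in> X" "f \<in> B" "\<forall>p\<in>F. f p = 0" using fin[OF F(2,1)] by blast
    moreover have "f \<in> T" if "T \<in> \<F>" for T
      using that F(3) calculation by (cases "T = B") (auto simp: Z_def)
    ultimately show "X \<inter> \<Inter>\<F> \<noteq> {}" by blast
  qed
  then obtain f where f: "f \<in> B" "\<And>p. p \<in> P \<Longrightarrow> f p = 0" by (auto simp: Z_def)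
  define \<phi> where "\<phi> u = (case u of None \<Rightarrow> 0 | Some g \<Rightarrow> f g)" for u
  have st: "state f" using f by (simp add: B_def)
  have null: "f p = 0" if "p \<in> I1 - Ic" "p \<cdot> p = p" for p using f(2) that by (simp add: P_def)
  have ext: "f g = (if g \<in> Ic then \<phi> (Some g) else 0)" if "g \<in> I1" for g
    unfolding \<phi>_def by (rule restrict_state(2)[OF st null that])
  let ?S = "Some ` (S \<inter> Ic)"
  have im: "{g. Some g \<in> ?S} = S \<inter> Ic" by auto
  have "quad S c f = quad (S \<inter> Ic) c f" using S ext by (intro quad_restrict) auto
  also have "\<dots> = C.quad ?S (\<lambda>u. c (the u)) \<phi>"
    using S ext by (subst crystal_quad[where f = f]) (auto simp: im \<phi>_def)
  also have "Re \<dots> \<le> (C.A.nm (clin S c))\<^sup>2"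
    unfolding clin_def \<phi>_def using S by (intro C.state_le_norm restrict_state(1)[OF st null]) auto
  finally have "m\<^sup>2 \<le> (C.A.nm (clin S c))\<^sup>2" using f by (simp add: B_def)
  hence "m \<le> C.A.nm (clin S c)" by (rule power2_le_imp_le) (rule C.A.norm_nonneg[OF clin_closed])
  thus False using m by simp
qed

end


section \<open>The dynamics defined by the scale\<close>

context scaled_semigroup
begin

definition phase :: "real \<Rightarrow> 'a \<Rightarrow> complex" where
  "phase t g = exp (\<i> * of_real t * of_real (ln (N g)))"

lemma phase_powr:
  assumes "g \<in> elts" "\<not> is_zero I g"
  shows "of_real (N g) powr (\<i> * of_real t) = phase t g"
  using N_pos[OF assms] by (simp add: phase_def powr_def Ln_of_real)

lemma phase_mult:
  assumes "g \<in> elts" "h \<in> elts" "\<not> is_zero I (g \<cdot> h)"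
  shows "phase t (g \<cdot> h) = phase t g * phase t h"
proof -
  have "ln (N (g \<cdot> h)) = ln (N g) + ln (N h)"
    using N_pos[OF assms(1)] N_pos[OF assms(2)] nonzero_factors[OF assms] N_mult[OF assms] by (simp add: ln_mult)
  thus ?thesis by (simp add: phase_def exp_add[symmetric] algebra_simps)
qed

lemma phase_inv: "\<lbrakk>g \<in> elts; \<not> is_zero I g\<rbrakk> \<Longrightarrow> phase t (iv g) = cnj (phase t g)"
  using N_pos[of g] by (simp add: phase_def N_inv ln_div exp_cnj)

lemma phase_neg: "phase (- t) g * phase t g = 1"
  by (simp add: phase_def exp_add[symmetric])

text \<open>Twisting by the phase permutes the representations. Composing families with a
  permutation respects all operations and the norm, so the dynamics is defined on all families at
  once and not extended from the generators by continuity.\<close>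

definition rot :: "real \<Rightarrow> ('a, 'a) rep \<Rightarrow> ('a, 'a) rep" where
  "rot t r = (fst r, \<lambda>g. if g \<in> elts \<and> \<not> is_zero I g then (\<lambda>x. vscale (phase t g) (snd r g x)) else snd r g)"

lemma fst_rot [simp]: "fst (rot t r) = fst r"
  by (simp add: rot_def)

lemma rot_rot: "rot (- t) (rot t r) = r"
  using phase_neg[of t] by (cases r) (auto simp: rot_def fun_eq_iff)

text \<open>The phase is multiplicative only where the product is nonzero; a zero product is
  represented by the operator 0, on which scalars have no effect.\<close>

lemma rot_rep: assumes r: "is_rep I r" shows "is_rep I (rot t r)"
proof -
  interpret hilbert_space "fst r" by (rule is_repD[OF r])
  have bd: "bounded_opr (fst r) (snd r g)" if "g \<in> elts" for g using is_repD(2)[OF r that] .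
  define \<pi> where "\<pi> = snd (rot t r)"
  define q where "q g = (if is_zero I g then 1 else phase t g)" for g
  have \<pi>: "\<pi> g = (\<lambda>x. vscale (q g) (snd r g x))" if "g \<in> elts" for g
    using that by (simp add: \<pi>_def rot_def q_def)
  have zero: "snd r z = 0" if "is_zero I z" for z by (rule is_repD(5)[OF r that])
  have mult: "\<pi> (g \<cdot> h) = \<pi> g \<circ> \<pi> h" if gh: "g \<in> elts" "h \<in> elts" for g h
  proof
    fix x
    have eq: "snd r (g \<cdot> h) x = snd r g (snd r h x)" using is_repD(3)[OF r gh] by simp
    have out: "(\<pi> g \<circ> \<pi> h) x = vscale (q g * q h) (snd r g (snd r h x))"
      using gh opr_vscale[OF bd[OF gh(1)]] opr_mem[OF bd[OF gh(2)]] opr_outside[OF bd[OF gh(2)]] opr_zero[OF bd[OF gh(1)]]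
      by (cases "x \<in> hvecs (fst r)") (simp_all add: \<pi>)
    show "\<pi> (g \<cdot> h) x = (\<pi> g \<circ> \<pi> h) x"
    proof (cases "is_zero I (g \<cdot> h)")
      case True
      have "snd r (g \<cdot> h) x = 0" using zero[OF True] by (simp add: opr_apply)
      hence "snd r g (snd r h x) = 0" unfolding eq .
      thus ?thesis unfolding out using \<pi>[OF mult_closed[OF gh]] eq by simp
    next
      case False
      thus ?thesis unfolding out using \<pi>[OF mult_closed[OF gh]] eq nonzero_factors[OF gh False]
        by (simp add: q_def phase_mult[OF gh False])
    qed
  qed
  have "is_rep I (fst r, \<pi>)"
  proof (rule is_repI)
    show "hilbert_space (fst r)" by unfold_locales
  next
    fix g assume g: "g \<in> elts"
    show b: "bounded_opr (fst r) (\<pi> g)" unfolding \<pi>[OF g] by (rule bounded_opr_vscale[OF bd[OF g]])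
    have "q (iv g) = cnj (q g)" using g by (simp add: q_def is_zero_inv phase_inv)
    thus "opr_adj (fst r) (\<pi> g) = \<pi> (iv g)"
      using is_repD(4)[OF r g] by (simp add: \<pi> g inv_closed opr_adj_vscale[OF bd[OF g]])
    show "\<pi> g \<circ> \<pi> (iv g) \<circ> \<pi> g = \<pi> g"
      using g mult[of "g \<cdot> iv g" g] mult[of g "iv g"] by (simp add: mult_closed inv_closed mult_inv_mult)
  next
    fix z assume z: "is_zero I z"
    show "\<pi> z = 0" by (rule ext) (simp add: \<pi> is_zero_closed[OF z] zero[OF z] opr_apply)
  qed (rule mult)
  thus ?thesis by (simp add: \<pi>_def rot_def)
qed

lemma rot_rep_iff: "is_rep I (rot t r) \<longleftrightarrow> is_rep I r"
  using rot_rep[of r t] rot_rep[of "rot t r" "- t"] rot_rot[of t r] by auto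

definition turn :: "real \<Rightarrow> (('a, 'a) rep \<Rightarrow> 'a opr) \<Rightarrow> ('a, 'a) rep \<Rightarrow> 'a opr" where
  "turn t a = (\<lambda>r. a (rot t r))"

lemma turn_linear: "turn t (a + b) = turn t a + turn t b" "turn t (a - b) = turn t a - turn t b"
  "turn t (fscale c a) = fscale c (turn t a)" "turn t 0 = 0"
  by (auto simp: turn_def fun_eq_iff fam_apply fscale_def)

lemma turn_turn: "turn (- t) (turn t a) = a" "turn t (turn (- t) a) = a"
  using rot_rot[of "- t"] rot_rot[of t] by (auto simp: turn_def)

lemma turn_mult: "turn t (A.mul a b) = A.mul (turn t a) (turn t b)"
  by (auto simp: turn_def fun_eq_iff C0star_simps rep_families_simps)

lemma turn_star: "turn t (A.str a) = A.str (turn t a)"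
  by (auto simp: turn_def fun_eq_iff C0star_simps rep_families_simps rot_rep_iff)

lemma turn_V: "g \<in> elts \<Longrightarrow> turn t (V g) = fscale (phase t g) (V g)"
proof (cases "is_zero I g")
  case False
  assume g: "g \<in> elts"
  show ?thesis
  proof (intro ext)
    fix r x k
    have "snd (rot t r) g = (\<lambda>x. vscale (phase t g) (snd r g x))" using g False by (simp add: rot_def)
    thus "turn t (V g) r x k = fscale (phase t g) (V g) r x k"
      by (cases "is_rep I r") (simp_all add: turn_def univ_gen_def rot_rep_iff fscale_def ozero_eq opr_apply)
  qed
qed (simp add: V_zero turn_linear)

lemma turn_norm: "A.nm (turn t a) = A.nm a"
proof -
  have "{opr_norm (fst r) (turn t a r) | r. is_rep I r} = {opr_norm (fst r) (a r) | r. is_rep I r}"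
  proof (intro equalityI subsetI)
    fix x assume "x \<in> {opr_norm (fst r) (turn t a r) | r. is_rep I r}"
    then obtain r where "is_rep I r" "x = opr_norm (fst (rot t r)) (a (rot t r))" by (auto simp: turn_def)
    thus "x \<in> {opr_norm (fst r) (a r) | r. is_rep I r}" using rot_rep by blast
  next
    fix x assume "x \<in> {opr_norm (fst r) (a r) | r. is_rep I r}"
    then obtain r where r: "is_rep I r" "x = opr_norm (fst r) (a r)" by blast
    have "x = opr_norm (fst (rot (- t) r)) (turn t a (rot (- t) r))" using r rot_rot[of "- t" r] by (simp add: turn_def)
    thus "x \<in> {opr_norm (fst r) (turn t a r) | r. is_rep I r}" using rot_rep[OF r(1)] by blast
  qed
  thus ?thesis by (simp add: C0star_simps fam_norm_def)
qed

lemma V_elts: "V ` elts \<subseteq> A.carr"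
  by (rule V_subset_A) simp

lemma lin_turn: "turn t (lin S c) = lin S (\<lambda>g. c g * phase t g)" if "S \<subseteq> elts"
  using that unfolding lin_def
  by (induction S rule: infinite_finite_induct) (auto simp: turn_linear turn_V)

lemma turn_closed_rep_families: assumes "a \<in> cs_carrier (rep_families I)" shows "turn t a \<in> cs_carrier (rep_families I)"
proof (rule rep_familiesI)
  fix r :: "('a, 'a) rep" assume r: "is_rep I r"
  show "bounded_opr (fst r) (turn t a r)"
    using rep_families_bounded[OF assms rot_rep[OF r, of t]] by (simp add: turn_def)
  show "opr_norm (fst r) (turn t a r) \<le> cs_norm (rep_families I) a"
    using opr_norm_le_fam_norm[OF assms rot_rep[OF r, of t]] by (simp add: turn_def)
qed (use assms in \<open>simp add: turn_def rep_families_outside rot_rep_iff\<close>)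

text \<open>On the span \<open>turn t\<close> multiplies coefficients by phases, and it is
  isometric, so it also preserves the closed span.\<close>

lemma turn_closed: assumes a: "a \<in> A.carr" shows "turn t a \<in> A.carr"
proof -
  have "\<exists>b\<in>F.spn (V ` elts). F.nm (turn t a - b) < e" if e: "0 < e" for e
  proof -
    obtain b where b: "b \<in> F.spn (V ` elts)" "F.nm (a - b) < e"
      using F.cspan_approx[OF V_subset _ e, of a] a by (auto simp: C0star_def)
    have "b \<in> A.spn (V ` elts)" using b by (simp add: C0star_def)
    then obtain S c where S: "S \<subseteq> elts" "b = lin S c" using span_lin by blast
    have "turn t b \<in> A.spn (V ` elts)" unfolding S(2) lin_turn[OF S(1)] by (rule lin_in_span[OF S(1)])
    hence "turn t b \<in> F.spn (V ` elts)" by (simp add: C0star_def)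
    moreover have "F.nm (turn t a - turn t b) < e"
      using b(2) turn_norm[of t "a - b"] by (simp add: turn_linear C0star_simps)
    ultimately show ?thesis by blast
  qed
  thus ?thesis
    using a turn_closed_rep_families C0star_closed_rep_families
    by (auto simp: C0star_def F.cspan_iff[OF V_subset])
qed

lemma cstar_iso_turn: "cstar_iso (C0star I) (C0star I) (restrict (turn t) A.carr)"
  unfolding cstar_iso_def
proof (intro conjI ballI allI)
  show "cstar_algebra (C0star I)" "cstar_algebra (C0star I)" by unfold_locales
  show "bij_betw (restrict (turn t) A.carr) A.carr A.carr"
    by (rule bij_betw_byWitness[of _ "turn (- t)"]) (auto simp: turn_turn turn_closed)
qed (auto simp: A.closed[unfolded C0star_simps] C0star_simps turn_linear turn_mult[unfolded C0star_simps]
    turn_star[unfolded C0star_simps] turn_norm[unfolded C0star_simps] A.mult_closed[unfolded C0star_simps]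
    A.star_closed[unfolded C0star_simps])

text \<open>The dynamics is a definite description, so any competitor has to be excluded. It agrees
  with \<open>turn t\<close> on the span of the generators, and both are isometric.\<close>

lemma dynamics_unique:
  assumes ext: "\<theta> \<in> extensional A.carr" and iso: "cstar_iso (C0star I) (C0star I) \<theta>"
    and gen: "\<And>g. g \<in> nonzero I \<Longrightarrow> \<theta> (V g) = fscale (phase t g) (V g)"
  shows "\<theta> = restrict (turn t) A.carr"
proof -
  have add: "\<theta> (a + b) = \<theta> a + \<theta> b" if "a \<in> A.carr" "b \<in> A.carr" for a b
    using iso that unfolding cstar_iso_def C0star_simps by blast
  have scale: "\<theta> (fscale c a) = fscale c (\<theta> a)" if "a \<in> A.carr" for c a
    using iso that unfolding cstar_iso_def C0star_simps by blast
  have norm: "A.nm (\<theta> a) = A.nm a" if "a \<in> A.carr" for a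
    using iso that unfolding cstar_iso_def by blast
  have mem: "\<theta> a \<in> A.carr" if "a \<in> A.carr" for a
    using iso that unfolding cstar_iso_def bij_betw_def by blast
  have \<theta>0: "\<theta> 0 = 0" using add[OF A.null_closed A.null_closed] by simp
  have diff: "\<theta> (a - b) = \<theta> a - \<theta> b" if "a \<in> A.carr" "b \<in> A.carr" for a b
    using add[of "a - b" b] that A.diff_closed[of a b] by (simp add: algebra_simps)
  have eqV: "\<theta> (V g) = turn t (V g)" if "g \<in> elts" for g
    using gen[of g] that by (cases "is_zero I g") (auto simp: V_zero \<theta>0 turn_linear turn_V nonzero_def)
  have span: "b \<in> {b \<in> A.carr. \<theta> b = turn t b}" if "b \<in> A.spn (V ` elts)" for b
    by (rule A.span_induct_subset[OF that])
      (auto simp: eqV V_closed A.null_closed A.plus_closed A.scale_closed[unfolded C0star_simps] \<theta>0 turn_linear add scale C0star_simps)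
  have "\<theta> a = turn t a" if a: "a \<in> A.carr" for a
  proof -
    have "A.nm (\<theta> a - turn t a) \<le> 0"
    proof (rule field_le_epsilon)
      fix e :: real assume e: "0 < e"
      obtain b where b: "b \<in> A.spn (V ` elts)" "A.nm (a - b) < e / 2"
        using A.cspan_approx[OF V_elts, of a "e / 2"] a e by (auto simp: C0star_carrier[symmetric])
      have bc: "b \<in> A.carr" "\<theta> b = turn t b" using span[OF b(1)] by auto
      have "A.nm (\<theta> a - turn t a) \<le> A.nm (\<theta> a - \<theta> b) + A.nm (\<theta> b - turn t a)"
        by (intro A.nm_triangle_diff mem turn_closed a bc)
      also have "A.nm (\<theta> a - \<theta> b) = A.nm (a - b)" using norm[OF A.diff_closed[OF a bc(1)]] diff[OF a bc(1)] by simp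
      also have "A.nm (\<theta> b - turn t a) = A.nm (b - a)" using bc(2) turn_norm[of t "b - a"] by (simp add: turn_linear)
      finally show "A.nm (\<theta> a - turn t a) \<le> 0 + e" using b(2) A.nm_minus_commute[OF a bc(1)] by simp
    qed
    hence "A.nm (\<theta> a - turn t a) = 0"
      using A.norm_nonneg[OF A.diff_closed[OF mem[OF a] turn_closed[OF a, of t]]] by simp
    thus ?thesis using A.nm_eq_zero[OF A.diff_closed[OF mem[OF a] turn_closed[OF a, of t]]] by simp
  qed
  thus ?thesis using ext by (auto simp: fun_eq_iff extensional_def)
qed

lemma scale_dynamics_eq: "scale_dynamics I N t = restrict (turn t) A.carr"
  unfolding scale_dynamics_def
proof (rule the_equality)
  show "restrict (turn t) A.carr \<in> extensional A.carr \<and> cstar_iso (C0star I) (C0star I) (restrict (turn t) A.carr) \<and>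
    (\<forall>g\<in>nonzero I. restrict (turn t) A.carr (V g) = A.scl (of_real (N g) powr (\<i> * of_real t)) (V g))"
    by (auto simp: cstar_iso_turn V_closed turn_V nonzero_def phase_powr C0star_simps)
next
  fix \<theta> assume \<theta>: "\<theta> \<in> extensional A.carr \<and> cstar_iso (C0star I) (C0star I) \<theta> \<and>
    (\<forall>g\<in>nonzero I. \<theta> (V g) = A.scl (of_real (N g) powr (\<i> * of_real t)) (V g))"
  show "\<theta> = restrict (turn t) A.carr"
    by (rule dynamics_unique) (use \<theta> in \<open>auto simp: nonzero_def phase_powr C0star_simps\<close>)
qed

abbreviation \<sigma> where "\<sigma> \<equiv> scale_dynamics I N"

section \<open>Spectral subspaces and the crystal ideal\<close>

definition level :: "real \<Rightarrow> 'a set" where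
  "level l = {g \<in> elts. is_zero I g \<or> ln (N g) = l}"

lemma spectral_iff:
  "a \<in> spectral_subspace (C0star I) \<sigma> l \<longleftrightarrow>
     a \<in> A.carr \<and> (\<forall>t. turn t a = fscale (exp (\<i> * of_real t * of_real l)) a)"
  by (auto simp: spectral_subspace_def scale_dynamics_eq C0star_simps)

lemma level_0: "level 0 = I1"
proof -
  have "ln (N g) = 0 \<longleftrightarrow> N g = 1" if "g \<in> elts" "\<not> is_zero I g" for g
    using ln_eq_zero_iff[OF N_pos[OF that]] .
  thus ?thesis by (auto simp: level_def I1_def)
qed

lemma V_level: "V ` level l \<subseteq> A.carr"
  by (auto simp: level_def V_closed)

lemma V_spectral: assumes g: "g \<in> level l" shows "V g \<in> spectral_subspace (C0star I) \<sigma> l"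
proof -
  have "g \<in> elts" "is_zero I g \<or> ln (N g) = l" using g by (auto simp: level_def)
  thus ?thesis by (auto simp: spectral_iff V_closed turn_V V_zero phase_def)
qed

text \<open>The contraction \<open>a \<mapsto> (a + e\<^bsup>-itl\<^esup> \<sigma>\<^sub>t(a)) / 2\<close> fixes the spectral subspace of \<open>l\<close> and, for
  \<open>t = \<pi> / (ln (N g) - l)\<close>, annihilates \<open>v\<^sub>g\<close>.\<close>

lemma spectral_approx:
  assumes a: "a \<in> spectral_subspace (C0star I) \<sigma> l"
    and "finite S" "S \<subseteq> elts" "A.nm (a - lin S c) < e"
  shows "\<exists>b \<in> A.spn (V ` level l). A.nm (a - b) < e"
  using assms(2-)
\<comment> \<open>The induction is on the number of terms off the level. Each round applies the
  contraction, which does not increase the distance to \<open>a\<close> and removes one such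
  term.\<close>
proof (induction "card (S - level l)" arbitrary: S c)
  case 0
  hence "S \<subseteq> level l" by simp
  hence "lin S c \<in> A.spn (V ` level l)" by (rule lin_in_span)
  thus ?case using 0 by blast
next
  case (Suc n)
  have ac: "a \<in> A.carr" and at: "turn t a = fscale (exp (\<i> * of_real t * of_real l)) a" for t
    using a by (auto simp: spectral_iff)
  have "S - level l \<noteq> {}" using Suc(2) by (metis card.empty nat.distinct(1))
  then obtain g0 where g0: "g0 \<in> S" "g0 \<notin> level l" by blast
  have g0': "g0 \<in> elts" "\<not> is_zero I g0" "ln (N g0) \<noteq> l" using g0 Suc(4) by (auto simp: level_def)
  define t where "t = pi / (ln (N g0) - l)"
  define w where "w = exp (- (\<i> * of_real t * of_real l))"
  define D where "D x = fscale (1/2) (x + fscale w (turn t x))" for x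
  define c' where "c' g = c g * (1 + w * phase t g) / 2" for g
  have Da: "D a = a"
  proof -
    have "fscale w (turn t a) = a" by (simp add: at w_def exp_add[symmetric])
    hence "D a = fscale (1/2) a + fscale (1/2) a" by (simp only: D_def fscale_add)
    also have "\<dots> = a" by (simp only: fscale_add_left[symmetric]) simp
    finally show ?thesis .
  qed
  have Dlin: "D (lin S c) = lin S c'"
    unfolding D_def lin_turn[OF Suc(4)]
    by (simp add: lin_def fscale_sum fscale_add sum.distrib[symmetric] fscale_add_left[symmetric] c'_def algebra_simps add_divide_distrib)
  have lc: "lin S c \<in> A.carr" by (rule lin_closed[OF Suc(4)])
  define x where "x = a - lin S c"
  have x: "x \<in> A.carr" unfolding x_def by (intro A.diff_closed ac lc)
  have wx: "fscale w (turn t x) \<in> A.carr"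
    using A.scale_closed[OF turn_closed[OF x, of t], of w] by (simp add: C0star_simps)
  have "A.nm (D x) = 1/2 * A.nm (x + fscale w (turn t x))"
    using A.norm_scale[OF A.plus_closed[OF x wx], of "1/2"] by (simp add: D_def C0star_simps)
  also have "\<dots> \<le> 1/2 * (A.nm x + A.nm (fscale w (turn t x)))"
    using A.nm_triangle[OF x wx] by simp
  also have "A.nm (fscale w (turn t x)) = A.nm x"
  proof -
    have "cmod w = 1" by (simp add: w_def norm_exp_eq_Re)
    thus ?thesis using A.norm_scale[OF turn_closed[OF x, of t], of w] turn_norm[of t x] by (simp add: C0star_simps)
  qed
  finally have Dx: "A.nm (D x) \<le> A.nm x" by simp
  have "D x = D a - D (lin S c)"
    by (simp add: x_def D_def turn_linear fscale_diff fscale_add algebra_simps)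
  hence "D x = a - lin S c'" by (simp only: Da Dlin)
  moreover have "lin S c' = lin (S - {g0}) c'"
  proof -
    have "w * phase t g0 = exp (of_real (t * (ln (N g0) - l)) * \<i>)"
      by (simp add: w_def phase_def exp_add[symmetric] algebra_simps)
    also have "t * (ln (N g0) - l) = pi" using g0' by (simp add: t_def)
    finally have "c' g0 = 0" by (simp add: c'_def mult.commute)
    thus ?thesis using Suc(3) g0(1) by (simp add: lin_def sum.remove[of S g0])
  qed
  ultimately have close: "A.nm (a - lin (S - {g0}) c') < e" using Dx Suc(5) by (simp add: x_def)
  have "(S - {g0}) - level l = (S - level l) - {g0}" by auto
  hence "n = card ((S - {g0}) - level l)" using Suc(2,3) g0 by (simp add: card_Diff_singleton)
  thus ?case by (rule Suc(1)) (use Suc close in auto)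
qed

lemma spectral_subset: "spectral_subspace (C0star I) \<sigma> l \<subseteq> A.cspn (V ` level l)"
proof
  fix a assume a: "a \<in> spectral_subspace (C0star I) \<sigma> l"
  have ac: "a \<in> A.carr" using a by (simp add: spectral_iff)
  have "\<exists>b \<in> A.spn (V ` level l). A.nm (a - b) < e" if e: "0 < e" for e
  proof -
    have "a \<in> A.cspn (V ` elts)" using ac by (simp only: C0star_carrier)
    then obtain b where "b \<in> A.spn (V ` elts)" "A.nm (a - b) < e"
      using A.cspan_approx[OF V_elts _ e] by blast
    then obtain S c where "finite S" "S \<subseteq> elts" "A.nm (a - lin S c) < e" using span_lin[of b elts] by blast
    thus ?thesis by (rule spectral_approx[OF a])
  qed
  thus "a \<in> A.cspn (V ` level l)" using ac by (simp add: A.cspan_iff[OF V_level])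
qed

lemma spectral_0: "spectral_subspace (C0star I) \<sigma> 0 = A.cspn (V ` I1)"
proof
  show "spectral_subspace (C0star I) \<sigma> 0 \<subseteq> A.cspn (V ` I1)"
    using spectral_subset[of 0] by (simp add: level_0)
  show "A.cspn (V ` I1) \<subseteq> spectral_subspace (C0star I) \<sigma> 0"
  proof
    fix a assume a: "a \<in> A.cspn (V ` I1)"
    have ac: "a \<in> A.carr" using a A.cspan_closed by blast
    have fix_span: "b \<in> {b \<in> A.carr. turn t b = b}" if "b \<in> A.spn (V ` I1)" for b t
    proof (rule A.span_induct_subset[OF that])
      show "V ` I1 \<subseteq> {b \<in> A.carr. turn t b = b}"
        using V_spectral[of _ 0] by (auto simp: spectral_iff level_0)
    qed (auto simp: A.null_closed A.plus_closed A.scale_closed[unfolded C0star_simps] turn_linear C0star_simps)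
    have "turn t a = a" for t
    proof -
      have "A.nm (turn t a - a) \<le> 0"
      proof (rule field_le_epsilon)
        fix e :: real assume e: "0 < e"
        obtain b where b: "b \<in> A.spn (V ` I1)" "A.nm (a - b) < e / 2"
          using A.cspan_approx[OF V_I1(1) a, of "e / 2"] e by auto
        have bc: "b \<in> A.carr" "turn t b = b" using fix_span[OF b(1)] by auto
        have "A.nm (turn t a - a) \<le> A.nm (turn t a - b) + A.nm (b - a)"
          by (intro A.nm_triangle_diff turn_closed ac bc)
        also have "A.nm (turn t a - b) = A.nm (a - b)" using turn_norm[of t "a - b"] bc(2) by (simp add: turn_linear)
        finally show "A.nm (turn t a - a) \<le> 0 + e" using b(2) A.nm_minus_commute[OF ac bc(1)] by simp
      qed
      hence "A.nm (turn t a - a) = 0"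
        using A.norm_nonneg[OF A.diff_closed[OF turn_closed[OF ac, of t] ac]] by simp
      thus ?thesis using A.nm_eq_zero[OF A.diff_closed[OF turn_closed[OF ac, of t] ac]] by simp
    qed
    thus "a \<in> spectral_subspace (C0star I) \<sigma> 0" using ac by (simp add: spectral_iff)
  qed
qed

text \<open>For \<open>g\<close> and \<open>h\<close> of equal scale greater than 1, the product
  \<open>g \<cdot> iv h\<close> is fixed by \<open>g \<cdot> iv g\<close> and hence lies outside
  \<open>Ic\<close> by \<open>not_crystalI\<close>. Conversely \<open>not_crystalE\<close> factors
  an element outside \<open>Ic\<close> as such a product.\<close>

lemma crystal_ideal_eq: "crystal_ideal (C0star I) \<sigma> = A.cspn (V ` (I1 - Ic))"
proof -
  note cl = mult_closed inv_closed
  define X where "X = (\<Union>l\<in>{0<..}. {A.mul a (A.str b) | a b.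
     a \<in> spectral_subspace (C0star I) \<sigma> l \<and> b \<in> spectral_subspace (C0star I) \<sigma> l})"
  have sc: "a \<in> A.carr" if "a \<in> spectral_subspace (C0star I) \<sigma> l" for a l using that by (simp add: spectral_iff)
  have X: "X \<subseteq> A.carr" using sc by (auto simp: X_def intro!: A.closed)
  have V_inv: "V ` iv ` level l \<subseteq> A.carr" for l by (auto simp: level_def intro!: V_closed inv_closed)
  have "X \<subseteq> A.cspn (V ` (I1 - Ic))"
  proof
    fix x assume "x \<in> X"
    then obtain l a b where l: "0 < l" and x: "x = A.mul a (A.str b)"
      and ab: "a \<in> spectral_subspace (C0star I) \<sigma> l" "b \<in> spectral_subspace (C0star I) \<sigma> l" by (auto simp: X_def)
    have str_b: "A.str b \<in> A.cspn (V ` iv ` level l)"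
    proof (rule A.cspan_str[OF V_level V_inv])
      fix y assume "y \<in> V ` level l"
      then obtain h where "h \<in> level l" "y = V h" by blast
      hence "A.str y \<in> V ` iv ` level l" by (auto simp: level_def str_V)
      thus "A.str y \<in> A.cspn (V ` iv ` level l)" by (rule A.cspan_base[OF V_inv])
    qed (use ab spectral_subset in blast)
    have prods: "A.mul y z \<in> A.cspn (V ` (I1 - Ic))" if "y \<in> V ` level l" "z \<in> V ` iv ` level l" for y z
    proof -
      obtain g h where gh: "g \<in> level l" "h \<in> level l" "y = V g" "z = V (iv h)" using \<open>y \<in> _\<close> \<open>z \<in> _\<close> by blast
      have e: "g \<in> elts" "h \<in> elts" using gh by (auto simp: level_def)
      have "g \<cdot> iv h \<in> I1 - Ic"
      proof (cases "is_zero I (g \<cdot> iv h)")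
        case True thus ?thesis using e Ic_nonzero by (auto simp: I1_def cl)
      next
        case False
        have nz: "\<not> is_zero I g" "\<not> is_zero I h" using nonzero_factors[of g "iv h"] False e by (auto simp: cl is_zero_inv)
        have N: "ln (N g) = l" "ln (N h) = l" using gh nz by (auto simp: level_def)
        have eq: "N g = N h" using N N_pos[OF e(1) nz(1)] N_pos[OF e(2) nz(2)] by (metis exp_ln)
        have "1 < N g" using N(1) l ln_gt_zero_iff[OF N_pos[OF e(1) nz(1)]] by simp
        moreover have "g \<cdot> iv g \<cdot> (g \<cdot> iv h) = g \<cdot> iv h" using e by (simp add: cl mult_assoc[symmetric] mult_inv_mult)
        ultimately have "g \<cdot> iv h \<notin> Ic" using e by (intro not_crystalI[of _ g]) (auto simp: cl)
        moreover have "N (g \<cdot> iv h) = 1"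
          using e False nz eq N_pos[OF e(2) nz(2)] by (simp add: N_mult cl N_inv)
        ultimately show ?thesis using e by (simp add: I1_def cl)
      qed
      hence "V (g \<cdot> iv h) \<in> A.cspn (V ` (I1 - Ic))" by (intro A.cspan_base[OF V_I1(2)]) simp
      thus ?thesis using gh e by (simp add: mul_V cl)
    qed
    show "x \<in> A.cspn (V ` (I1 - Ic))"
      unfolding x by (rule A.cspan_mul[OF V_level V_inv V_I1(2) prods subsetD[OF spectral_subset ab(1)] str_b])
  qed
  moreover have "V ` (I1 - Ic) \<subseteq> A.cspn X"
  proof
    fix x assume "x \<in> V ` (I1 - Ic)"
    then obtain k where k: "k \<in> I1" "k \<notin> Ic" "x = V k" by blast
    have ke: "k \<in> elts" using k by (simp add: I1_elts)
    show "x \<in> A.cspn X"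
    proof (cases "is_zero I k")
      case True thus ?thesis using k A.cspan_zero[OF X] by (simp add: V_zero)
    next
      case False
      obtain h where h: "h \<in> elts" "\<not> is_zero I h" "1 < N h" "h \<cdot> iv h = k \<cdot> iv k" using not_crystalE[OF k(1) False k(2)] by blast
      \<comment> \<open>This gives \<open>k = h \<cdot> iv (iv k \<cdot> h)\<close>, a product of
        two factors of scale \<open>N h > 1\<close> with the second inverted, because
        \<open>N k = 1\<close>.\<close>
      have hk: "h \<cdot> (iv h \<cdot> k) = k" using h ke mult_inv_mult[OF ke] by (simp add: cl mult_assoc[symmetric])
      have nz: "\<not> is_zero I (iv h \<cdot> k)" using nonzero_factors(2)[of h "iv h \<cdot> k"] hk False h ke by (simp add: cl)
      have iv: "iv (iv k \<cdot> h) = iv h \<cdot> k" using h ke by (simp add: inv_mult cl inv_inv)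
      have nz': "\<not> is_zero I (iv k \<cdot> h)" using nz iv is_zero_inv[of "iv k \<cdot> h"] h ke by (simp add: cl)
      have "N (iv k \<cdot> h) = N h" using N_mult[OF _ h(1) nz'] N_inv[OF ke False] k False ke by (simp add: cl I1_def)
      hence "V (iv k \<cdot> h) \<in> spectral_subspace (C0star I) \<sigma> (ln (N h))"
        using h ke by (intro V_spectral) (simp add: level_def cl)
      moreover have "V h \<in> spectral_subspace (C0star I) \<sigma> (ln (N h))" using h by (intro V_spectral) (simp add: level_def)
      moreover have "x = A.mul (V h) (A.str (V (iv k \<cdot> h)))"
        using h ke hk k by (simp add: str_V mul_V iv cl)
      moreover have "0 < ln (N h)" using h by simp
      ultimately have "x \<in> X" unfolding X_def by (intro UN_I[of "ln (N h)"]) auto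
      thus ?thesis by (rule A.cspan_base[OF X])
    qed
  qed
  ultimately have "A.cspn X = A.cspn (V ` (I1 - Ic))"
    by (intro equalityI A.cspan_subset X V_I1(2))
  thus ?thesis by (simp add: crystal_ideal_def X_def)
qed

end


section \<open>Products and transport of C*-algebras\<close>

text \<open>The homomorphism will be a closed subspace of this product, so that the rules for closed
  spans also show that its graph is closed under products and adjoints.\<close>

definition cs_prod :: "'b cstar \<Rightarrow> 'c cstar \<Rightarrow> ('b \<times> 'c) cstar" where
  "cs_prod A B =
    \<lparr> cs_carrier = cs_carrier A \<times> cs_carrier B,
      cs_zero = (cs_zero A, cs_zero B),
      cs_add = (\<lambda>u v. (cs_add A (fst u) (fst v), cs_add B (snd u) (snd v))),
      cs_scale = (\<lambda>c u. (cs_scale A c (fst u), cs_scale B c (snd u))),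
      cs_mult = (\<lambda>u v. (cs_mult A (fst u) (fst v), cs_mult B (snd u) (snd v))),
      cs_star = (\<lambda>u. (cs_star A (fst u), cs_star B (snd u))),
      cs_norm = (\<lambda>u. max (cs_norm A (fst u)) (cs_norm B (snd u))) \<rparr>"

lemma cs_prod_simps:
  "cs_carrier (cs_prod A B) = cs_carrier A \<times> cs_carrier B"
  "cs_zero (cs_prod A B) = (cs_zero A, cs_zero B)"
  "cs_add (cs_prod A B) (a, b) (a', b') = (cs_add A a a', cs_add B b b')"
  "cs_scale (cs_prod A B) c (a, b) = (cs_scale A c a, cs_scale B c b)"
  "cs_mult (cs_prod A B) (a, b) (a', b') = (cs_mult A a a', cs_mult B b b')"
  "cs_star (cs_prod A B) (a, b) = (cs_star A a, cs_star B b)"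
  "cs_norm (cs_prod A B) (a, b) = max (cs_norm A a) (cs_norm B b)"
  by (simp_all add: cs_prod_def)

lemma cs_minus_prod: "cs_minus (cs_prod A B) (a, b) (a', b') = (cs_minus A a a', cs_minus B b b')"
  by (simp add: cs_minus_def cs_prod_simps)

lemma cstar_plus_prod:
  fixes A :: "'b::ab_group_add cstar" and B :: "'c::ab_group_add cstar"
  assumes "cstar_plus A" "cstar_plus B"
  shows "cstar_plus (cs_prod A B)"
proof -
  interpret A: cstar_plus A by fact
  interpret B: cstar_plus B by fact
  show ?thesis
  proof
    show "cs_add (cs_prod A B) = (+)" by (auto simp: fun_eq_iff cs_prod_simps A.add_eq B.add_eq)
  next
    fix u v assume "u \<in> cs_carrier (cs_prod A B)" "v \<in> cs_carrier (cs_prod A B)"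
    then obtain a b a' b' where u: "u = (a, b)" "a \<in> A.carr" "b \<in> B.carr" "v = (a', b')" "a' \<in> A.carr" "b' \<in> B.carr"
      by (auto simp: cs_prod_simps)
    show "cs_norm (cs_prod A B) (cs_add (cs_prod A B) u v) \<le> cs_norm (cs_prod A B) u + cs_norm (cs_prod A B) v"
      using A.norm_triangle[of a a'] B.norm_triangle[of b b'] u by (auto simp: cs_prod_simps max_def)
    show "cs_norm (cs_prod A B) (cs_mult (cs_prod A B) u v) \<le> cs_norm (cs_prod A B) u * cs_norm (cs_prod A B) v"
    proof -
      have "A.nm (A.mul a a') \<le> max (A.nm a) (B.nm b) * max (A.nm a') (B.nm b')"
        using A.norm_mult[of a a'] u A.norm_nonneg[of a] A.norm_nonneg[of a']
        by (intro order_trans[OF A.norm_mult] mult_mono) auto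
      moreover have "B.nm (B.mul b b') \<le> max (A.nm a) (B.nm b) * max (A.nm a') (B.nm b')"
        using u B.norm_nonneg[of b] B.norm_nonneg[of b'] A.norm_nonneg[of a]
        by (intro order_trans[OF B.norm_mult] mult_mono) auto
      ultimately show ?thesis using u by (simp add: cs_prod_simps)
    qed
  next
    fix u c assume "u \<in> cs_carrier (cs_prod A B)"
    then obtain a b where u: "u = (a, b)" "a \<in> A.carr" "b \<in> B.carr" by (auto simp: cs_prod_simps)
    show "cs_norm (cs_prod A B) (cs_scale (cs_prod A B) c u) = cmod c * cs_norm (cs_prod A B) u"
      using u by (simp add: cs_prod_simps A.norm_scale B.norm_scale max_mult_distrib_left)
    show "cs_norm (cs_prod A B) u = 0 \<longleftrightarrow> u = cs_zero (cs_prod A B)"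
      using u A.norm_nonneg[of a] B.norm_nonneg[of b] A.norm_eq_zero[of a] B.norm_eq_zero[of b]
      by (auto simp: cs_prod_simps max_def)
    show "0 \<le> cs_norm (cs_prod A B) u"
      using u A.norm_nonneg[of a] by (simp add: cs_prod_simps max.coboundedI1)
    show "cs_norm (cs_prod A B) (cs_mult (cs_prod A B) (cs_star (cs_prod A B) u) u) = (cs_norm (cs_prod A B) u)\<^sup>2"
    proof -
      have "max (x\<^sup>2) (y\<^sup>2) = (max x y)\<^sup>2" if "0 \<le> x" "0 \<le> y" for x y :: real
        using that by (auto simp: max_def abs_le_square_iff[symmetric])
      thus ?thesis using u A.norm_nonneg[of a] B.norm_nonneg[of b] by (simp add: cs_prod_simps A.cstar_identity B.cstar_identity)
    qed
  next
    fix X :: "nat \<Rightarrow> 'b \<times> 'c" assume X: "\<And>n. X n \<in> cs_carrier (cs_prod A B)"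
      and cauchy: "\<And>e. 0 < e \<Longrightarrow> \<exists>M. \<forall>m\<ge>M. \<forall>n\<ge>M. cs_norm (cs_prod A B) (cs_minus (cs_prod A B) (X m) (X n)) < e"
    have mem: "fst (X n) \<in> A.carr" "snd (X n) \<in> B.carr" for n
      using X[of n] by (auto simp: cs_prod_simps)
    have nmX: "cs_norm (cs_prod A B) (cs_minus (cs_prod A B) (X n) (a, b)) =
        max (A.nm (cs_minus A (fst (X n)) a)) (B.nm (cs_minus B (snd (X n)) b))" for n a b
      by (metis cs_minus_prod cs_prod_simps(7) prod.collapse)
    have "\<exists>M. \<forall>m\<ge>M. \<forall>n\<ge>M. A.nm (cs_minus A (fst (X m)) (fst (X n))) < e" if "0 < e" for e
      using cauchy[OF that] nmX[of _ "fst (X _)" "snd (X _)"] by (metis max_less_iff_conj prod.collapse)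
    then obtain a where a: "a \<in> A.carr" "(\<lambda>n. A.nm (cs_minus A (fst (X n)) a)) \<longlonglongrightarrow> 0"
      using A.complete[of "\<lambda>n. fst (X n)"] mem by blast
    have "\<exists>M. \<forall>m\<ge>M. \<forall>n\<ge>M. B.nm (cs_minus B (snd (X m)) (snd (X n))) < e" if "0 < e" for e
      using cauchy[OF that] nmX[of _ "fst (X _)" "snd (X _)"] by (metis max_less_iff_conj prod.collapse)
    then obtain b where b: "b \<in> B.carr" "(\<lambda>n. B.nm (cs_minus B (snd (X n)) b)) \<longlonglongrightarrow> 0"
      using B.complete[of "\<lambda>n. snd (X n)"] mem by blast
    show "\<exists>u\<in>cs_carrier (cs_prod A B). (\<lambda>n. cs_norm (cs_prod A B) (cs_minus (cs_prod A B) (X n) u)) \<longlonglongrightarrow> 0"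
      using a b tendsto_max[OF a(2) b(2)] by (intro bexI[of _ "(a, b)"]) (auto simp: cs_prod_simps nmX)
  qed (auto simp: cs_prod_simps cs_minus_prod A.zero_closed B.zero_closed A.add_closed B.add_closed A.scale_closed B.scale_closed
      A.mult_closed B.mult_closed A.star_closed B.star_closed A.add_assoc B.add_assoc A.add_zero B.add_zero A.minus_self B.minus_self
      A.scale_one B.scale_one A.scale_scale B.scale_scale A.scale_add_left B.scale_add_left A.scale_add_right B.scale_add_right
      A.mult_assoc B.mult_assoc A.mult_add_left B.mult_add_left A.mult_add_right B.mult_add_right A.mult_scale_left B.mult_scale_left
      A.mult_scale_right B.mult_scale_right A.star_star B.star_star A.star_add B.star_add A.star_scale B.star_scale A.star_mult B.star_mult
      intro: A.add_commute B.add_commute)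
qed

text \<open>The source is the algebra whose axioms are known. For this reason the final isomorphism
  runs from the algebra of the crystal to the quotient.\<close>

lemma cstar_transport:
  assumes B: "cstar_algebra B" and bij: "bij_betw \<Phi> (cs_carrier B) (cs_carrier Q)"
    and zero: "cs_zero Q = \<Phi> (cs_zero B)"
    and add: "\<And>a b. \<lbrakk>a \<in> cs_carrier B; b \<in> cs_carrier B\<rbrakk> \<Longrightarrow> cs_add Q (\<Phi> a) (\<Phi> b) = \<Phi> (cs_add B a b)"
    and scale: "\<And>a c. a \<in> cs_carrier B \<Longrightarrow> cs_scale Q c (\<Phi> a) = \<Phi> (cs_scale B c a)"
    and mult: "\<And>a b. \<lbrakk>a \<in> cs_carrier B; b \<in> cs_carrier B\<rbrakk> \<Longrightarrow> cs_mult Q (\<Phi> a) (\<Phi> b) = \<Phi> (cs_mult B a b)"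
    and star: "\<And>a. a \<in> cs_carrier B \<Longrightarrow> cs_star Q (\<Phi> a) = \<Phi> (cs_star B a)"
    and norm: "\<And>a. a \<in> cs_carrier B \<Longrightarrow> cs_norm Q (\<Phi> a) = cs_norm B a"
  shows "cstar_iso B Q \<Phi>"
proof -
  interpret B: cstar_algebra B by (rule B)
  have ex: "\<exists>a. a \<in> cs_carrier B \<and> x = \<Phi> a" if "x \<in> cs_carrier Q" for x
    using bij that by (auto simp: bij_betw_def)
  have mem: "\<Phi> a \<in> cs_carrier Q" if "a \<in> cs_carrier B" for a
    using bij that by (auto simp: bij_betw_def)
  have inj: "\<Phi> a = \<Phi> b \<longleftrightarrow> a = b" if "a \<in> cs_carrier B" "b \<in> cs_carrier B" for a b
    using bij that by (auto simp: bij_betw_def inj_on_def)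
  note Bcl = B.zero_closed B.add_closed B.scale_closed B.mult_closed B.star_closed
  have minus: "cs_minus Q (\<Phi> a) (\<Phi> b) = \<Phi> (cs_minus B a b)" "cs_minus B a b \<in> cs_carrier B"
    if "a \<in> cs_carrier B" "b \<in> cs_carrier B" for a b
    using that by (simp_all add: cs_minus_def add scale Bcl)
  note hom = zero add scale mult star norm minus mem Bcl
  have "cstar_algebra Q"
  proof
    show "cs_zero Q \<in> cs_carrier Q" by (simp add: hom)
  next
    fix x y z c s assume "x \<in> cs_carrier Q"
    then obtain a where a: "a \<in> cs_carrier B" "x = \<Phi> a" using ex by blast
    show "cs_scale Q c x \<in> cs_carrier Q" "cs_star Q x \<in> cs_carrier Q" "cs_add Q (cs_zero Q) x = x"
      "cs_minus Q x x = cs_zero Q" "cs_scale Q 1 x = x" "cs_scale Q c (cs_scale Q s x) = cs_scale Q (c * s) x"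
      "cs_scale Q (c + s) x = cs_add Q (cs_scale Q c x) (cs_scale Q s x)" "cs_star Q (cs_star Q x) = x"
      "cs_star Q (cs_scale Q c x) = cs_scale Q (cnj c) (cs_star Q x)" "0 \<le> cs_norm Q x"
      "cs_norm Q x = 0 \<longleftrightarrow> x = cs_zero Q" "cs_norm Q (cs_scale Q c x) = cmod c * cs_norm Q x"
      "cs_norm Q (cs_mult Q (cs_star Q x) x) = (cs_norm Q x)\<^sup>2"
      using a by (simp_all add: hom inj B.add_zero B.minus_self B.scale_one B.scale_scale B.scale_add_left B.star_star
          B.star_scale B.norm_nonneg B.norm_eq_zero B.norm_scale B.cstar_identity)
    assume "y \<in> cs_carrier Q"
    then obtain b where b: "b \<in> cs_carrier B" "y = \<Phi> b" using ex by blast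
    show "cs_add Q x y \<in> cs_carrier Q" "cs_mult Q x y \<in> cs_carrier Q"
      "cs_scale Q c (cs_add Q x y) = cs_add Q (cs_scale Q c x) (cs_scale Q c y)"
      "cs_mult Q (cs_scale Q c x) y = cs_scale Q c (cs_mult Q x y)" "cs_mult Q x (cs_scale Q c y) = cs_scale Q c (cs_mult Q x y)"
      "cs_star Q (cs_add Q x y) = cs_add Q (cs_star Q x) (cs_star Q y)"
      "cs_star Q (cs_mult Q x y) = cs_mult Q (cs_star Q y) (cs_star Q x)"
      "cs_norm Q (cs_add Q x y) \<le> cs_norm Q x + cs_norm Q y" "cs_norm Q (cs_mult Q x y) \<le> cs_norm Q x * cs_norm Q y"
      using a b by (simp_all add: hom B.scale_add_right B.mult_scale_left B.mult_scale_right B.star_add B.star_mult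
          B.norm_triangle B.norm_mult)
    show "cs_add Q x y = cs_add Q y x" using a b B.add_commute[of a b] by (simp add: hom)
    assume "z \<in> cs_carrier Q"
    then obtain d where d: "d \<in> cs_carrier B" "z = \<Phi> d" using ex by blast
    show "cs_add Q (cs_add Q x y) z = cs_add Q x (cs_add Q y z)" "cs_mult Q (cs_mult Q x y) z = cs_mult Q x (cs_mult Q y z)"
      "cs_mult Q (cs_add Q x y) z = cs_add Q (cs_mult Q x z) (cs_mult Q y z)"
      "cs_mult Q z (cs_add Q x y) = cs_add Q (cs_mult Q z x) (cs_mult Q z y)"
      using a b d by (simp_all add: hom B.add_assoc B.mult_assoc B.mult_add_left B.mult_add_right)
  next
    fix X :: "nat \<Rightarrow> _" assume X: "\<And>n. X n \<in> cs_carrier Q"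
      and cauchy: "\<And>e. 0 < e \<Longrightarrow> \<exists>M. \<forall>m\<ge>M. \<forall>n\<ge>M. cs_norm Q (cs_minus Q (X m) (X n)) < e"
    have "\<forall>n. \<exists>b. b \<in> cs_carrier B \<and> X n = \<Phi> b" using ex[OF X] by blast
    then obtain Y where Y: "\<And>n. Y n \<in> cs_carrier B" "\<And>n. X n = \<Phi> (Y n)" by metis
    have "\<exists>b\<in>cs_carrier B. (\<lambda>n. cs_norm B (cs_minus B (Y n) b)) \<longlonglongrightarrow> 0"
      by (rule B.complete) (use Y cauchy in \<open>simp_all add: hom\<close>)
    then obtain b where "b \<in> cs_carrier B" "(\<lambda>n. cs_norm B (cs_minus B (Y n) b)) \<longlonglongrightarrow> 0" by blast
    thus "\<exists>x\<in>cs_carrier Q. (\<lambda>n. cs_norm Q (cs_minus Q (X n) x)) \<longlonglongrightarrow> 0"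
      by (intro bexI[of _ "\<Phi> b"]) (simp_all add: Y hom)
  qed
  thus ?thesis using B bij by (simp add: cstar_iso_def hom)
qed


section \<open>The isomorphism\<close>

context scaled_semigroup
begin

abbreviation CC where "CC \<equiv> C0star Cr"

text \<open>The image of \<open>V g\<close> under the homomorphism. \<open>V'_mult\<close> and
  \<open>V'_star\<close> say that it respects products and adjoints on \<open>I1\<close>; for
  products this is the ideal property of \<open>I1 - Ic\<close>.\<close>

definition V' :: "'a \<Rightarrow> ('a option, 'a option) rep \<Rightarrow> 'a option opr" where
  "V' g = (if g \<in> Ic then C.V (Some g) else 0)"

lemma V'_closed: "V' g \<in> C.A.carr"
  by (simp add: V'_def C.V_closed C.A.null_closed)

lemma V'_mult: assumes g: "g \<in> I1" and h: "h \<in> I1" shows "C.A.mul (V' g) (V' h) = V' (g \<cdot> h)"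
proof (cases "g \<in> Ic \<and> h \<in> Ic")
  case True
  have "C.V None = 0" by (rule C.V_zero) (simp add: crystal_zero)
  thus ?thesis using True by (simp add: V'_def C.mul_V crystal_simps)
next
  case False
  hence "g \<cdot> h \<notin> Ic" using Ic_factors[OF g h] by blast
  thus ?thesis using False C.A.mul_zero V'_closed[of g] V'_closed[of h] by (auto simp: V'_def)
qed

lemma V'_star: "g \<in> elts \<Longrightarrow> C.A.str (V' g) = V' (iv g)"
  by (simp add: V'_def C.str_V Ic_inv_iff crystal_inv C.A.str_zero)

lemma clin_sum: assumes "finite S" shows "clin S c = (\<Sum>g\<in>S. fscale (c g) (V' g))"
proof -
  have "clin S c = (\<Sum>g\<in>S \<inter> Ic. fscale (c g) (C.V (Some g)))"
    by (simp add: clin_def C.lin_def sum.reindex)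
  also have "\<dots> = (\<Sum>g\<in>S. fscale (c g) (V' g))"
    using assms by (intro sum.mono_neutral_cong_left) (auto simp: V'_def)
  finally show ?thesis .
qed

sublocale P: cstar_plus "cs_prod (C0star I) CC"
  by (rule cstar_plus_prod) unfold_locales

definition gens :: "((('a, 'a) rep \<Rightarrow> 'a opr) \<times> (('a option, 'a option) rep \<Rightarrow> 'a option opr)) set" where
  "gens = (\<lambda>g. (V g, V' g)) ` I1"

lemma gens_closed: "gens \<subseteq> P.carr"
  by (auto simp: gens_def cs_prod_simps V_closed V'_closed I1_elts)

text \<open>The graph of the homomorphism from \<open>A\<^sub>0\<close> onto \<open>C\<^sub>0\<^sup>*(I\<^sub>c)\<close>.\<close>

definition graph :: "((('a, 'a) rep \<Rightarrow> 'a opr) \<times> (('a option, 'a option) rep \<Rightarrow> 'a option opr)) set" where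
  "graph = P.cspn gens"

lemma span_gens: "u \<in> P.spn gens \<Longrightarrow> \<exists>S c. finite S \<and> S \<subseteq> I1 \<and> u = (lin S c, clin S c)"
proof (induction rule: cs_span.induct)
  case zero
  show ?case by (intro exI[of _ "{}"]) (simp add: lin_def clin_sum cs_prod_simps C0star_simps C.C0star_simps)
next
  case (base x)
  then obtain g where "g \<in> I1" "x = (V g, V' g)" by (auto simp: gens_def)
  thus ?case by (intro exI[of _ "{g}"] exI[of _ "\<lambda>_. 1"]) (simp add: lin_def clin_sum)
next
  case (add u v)
  then obtain S c S' c' where S: "finite S" "S \<subseteq> I1" "u = (lin S c, clin S c)"
    "finite S'" "S' \<subseteq> I1" "v = (lin S' c', clin S' c')" by auto
  have 1: "lin S c = lin (S \<union> S') (\<lambda>g. if g \<in> S then c g else 0)" "lin S' c' = lin (S \<union> S') (\<lambda>g. if g \<in> S' then c' g else 0)"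
    using S by (auto intro!: lin_mono)
  have 2: "clin S c = clin (S \<union> S') (\<lambda>g. if g \<in> S then c g else 0)" "clin S' c' = clin (S \<union> S') (\<lambda>g. if g \<in> S' then c' g else 0)"
    using S by (auto simp: clin_sum intro!: sum.mono_neutral_cong_left)
  show ?case
    unfolding S(3,6) unfolding 1 2 cs_prod_simps using S
    by (intro exI[of _ "S \<union> S'"] exI[of _ "\<lambda>g. (if g \<in> S then c g else 0) + (if g \<in> S' then c' g else 0)"])
      (simp add: lin_def clin_sum C0star_simps C.C0star_simps fscale_add_left sum.distrib)
next
  case (scale u k)
  then obtain S c where "finite S" "S \<subseteq> I1" "u = (lin S c, clin S c)" by auto
  thus ?case
    by (intro exI[of _ S] exI[of _ "\<lambda>g. k * c g"])
      (simp add: lin_def clin_sum cs_prod_simps C0star_simps C.C0star_simps fscale_sum)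
qed

lemma ideal_span_gens: "j \<in> A.spn (V ` (I1 - Ic)) \<Longrightarrow> (j, 0) \<in> P.spn gens"
proof (induction rule: cs_span.induct)
  case zero
  show ?case using P.span_zero[of gens] by (simp add: A.zero_eq zero_prod_def)
next
  case (base x)
  then obtain g where "g \<in> I1" "g \<notin> Ic" "x = V g" by blast
  thus ?case by (intro cs_span.base) (auto simp: gens_def V'_def image_iff intro!: bexI[of _ g])
next
  case (add a b)
  thus ?case using P.span_add[of "(a, 0)" gens "(b, 0)"] by (simp add: A.add_eq)
next
  case (scale a c)
  thus ?case using cs_span.scale[of "(a, 0)" "cs_prod (C0star I) CC" gens c] by (simp add: cs_prod_simps C.C0star_simps)
qed

section \<open>From the span of the generators to the closed graph\<close>

lemma norm_span_le: "(x, y) \<in> P.spn gens \<Longrightarrow> C.A.nm y \<le> A.nm x"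
  using span_gens[of "(x, y)"] norm_clin_le by auto

lemma norm_span_ideal:
  "\<lbrakk>(x, y) \<in> P.spn gens; 0 < e\<rbrakk> \<Longrightarrow> \<exists>j \<in> A.spn (V ` (I1 - Ic)). A.nm (x + j) < C.A.nm y + e"
  using span_gens[of "(x, y)"] quotient_norm_le by auto

lemma graph_approx:
  assumes "(a, b) \<in> graph" "0 < e"
  shows "\<exists>x y. (x, y) \<in> P.spn gens \<and> A.nm (a - x) < e \<and> C.A.nm (b - y) < e"
proof -
  obtain u where u: "u \<in> P.spn gens" "P.nm ((a, b) - u) < e"
    using P.cspan_approx[OF gens_closed, of "(a, b)" e] assms by (auto simp: graph_def)
  moreover obtain x y where "u = (x, y)" by fastforce
  ultimately show ?thesis by (auto simp: cs_prod_simps)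
qed

lemma graphI:
  assumes "a \<in> A.carr" "b \<in> C.A.carr"
    and "\<And>e. 0 < e \<Longrightarrow> \<exists>x y. (x, y) \<in> P.spn gens \<and> A.nm (a - x) < e \<and> C.A.nm (b - y) < e"
  shows "(a, b) \<in> graph"
  unfolding graph_def P.cspan_iff[OF gens_closed]
proof (intro conjI allI impI)
  fix e :: real assume "0 < e"
  then obtain x y where "(x, y) \<in> P.spn gens" "A.nm (a - x) < e" "C.A.nm (b - y) < e" using assms(3) by blast
  thus "\<exists>u\<in>P.spn gens. P.nm ((a, b) - u) < e" by (intro bexI[of _ "(x, y)"]) (auto simp: cs_prod_simps)
qed (use assms in \<open>simp add: cs_prod_simps\<close>)

lemma graph_closed: "(a, b) \<in> graph \<Longrightarrow> a \<in> A.carr \<and> b \<in> C.A.carr"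
  using P.cspan_closed[of gens] by (auto simp: graph_def cs_prod_simps)

lemma span_closed: "(x, y) \<in> P.spn gens \<Longrightarrow> x \<in> A.carr \<and> y \<in> C.A.carr"
  using P.span_closed[OF gens_closed] by (auto simp: cs_prod_simps)

lemma span_graph: "u \<in> P.spn gens \<Longrightarrow> u \<in> graph"
  using P.span_subset_cspan[OF gens_closed] by (auto simp: graph_def)

lemma graph_mult:
  assumes "(a, b) \<in> graph" "(a', b') \<in> graph"
  shows "(A.mul a a', C.A.mul b b') \<in> graph"
proof -
  have "P.mul (a, b) (a', b') \<in> graph"
    unfolding graph_def
  proof (rule P.cspan_mul[OF gens_closed gens_closed gens_closed _ assms[unfolded graph_def]])
    fix x y assume "x \<in> gens" "y \<in> gens"
    then obtain g h where "g \<in> I1" "h \<in> I1" "x = (V g, V' g)" "y = (V h, V' h)" by (auto simp: gens_def)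
    hence "P.mul x y \<in> gens" by (auto simp: gens_def cs_prod_simps mul_V V'_mult I1_elts I1_mult)
    thus "P.mul x y \<in> P.cspn gens" by (rule P.cspan_base[OF gens_closed])
  qed
  thus ?thesis by (simp add: cs_prod_simps)
qed

lemma graph_star:
  assumes "(a, b) \<in> graph" shows "(A.str a, C.A.str b) \<in> graph"
proof -
  have "P.str (a, b) \<in> graph"
    unfolding graph_def
  proof (rule P.cspan_str[OF gens_closed gens_closed _ assms[unfolded graph_def]])
    fix x assume "x \<in> gens"
    then obtain g where "g \<in> I1" "x = (V g, V' g)" by (auto simp: gens_def)
    hence "P.str x \<in> gens" by (auto simp: gens_def cs_prod_simps str_V V'_star I1_elts I1_inv)
    thus "P.str x \<in> P.cspn gens" by (rule P.cspan_base[OF gens_closed])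
  qed
  thus ?thesis by (simp add: cs_prod_simps)
qed

lemma graph_add: "\<lbrakk>(a, b) \<in> graph; (a', b') \<in> graph\<rbrakk> \<Longrightarrow> (a + a', b + b') \<in> graph"
  using P.cspan_add[OF gens_closed, of "(a, b)" "(a', b')"] by (simp add: graph_def)

lemma graph_scale: "(a, b) \<in> graph \<Longrightarrow> (A.scl c a, C.A.scl c b) \<in> graph"
  using P.cspan_scale[OF gens_closed, of "(a, b)" c] by (simp add: graph_def cs_prod_simps)

lemma graph_diff: "\<lbrakk>(a, b) \<in> graph; (a', b') \<in> graph\<rbrakk> \<Longrightarrow> (a - a', b - b') \<in> graph"
  using graph_add[OF _ graph_scale[of a' b' "-1"], of a b] graph_closed[of a' b']
  by (simp add: A.scale_minus_one C.A.scale_minus_one)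

text \<open>Applied to differences, this makes the graph single-valued and the homomorphism
  contractive.\<close>

lemma graph_norm_le: assumes g: "(a, b) \<in> graph" shows "C.A.nm b \<le> A.nm a"
proof (rule field_le_epsilon)
  fix e :: real assume e: "0 < e"
  obtain x y where xy: "(x, y) \<in> P.spn gens" "A.nm (a - x) < e / 2" "C.A.nm (b - y) < e / 2"
    using graph_approx[OF g, of "e / 2"] e by auto
  have c: "a \<in> A.carr" "b \<in> C.A.carr" "x \<in> A.carr" "y \<in> C.A.carr" using graph_closed[OF g] span_closed[OF xy(1)] by auto
  have "C.A.nm b \<le> C.A.nm (b - y) + C.A.nm y" by (intro C.A.nm_diff_le c)
  also have "C.A.nm y \<le> A.nm x" by (rule norm_span_le[OF xy(1)])
  also have "A.nm x \<le> A.nm (x - a) + A.nm a" by (intro A.nm_diff_le c)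
  also have "A.nm (x - a) = A.nm (a - x)" by (intro A.nm_minus_commute c)
  finally show "C.A.nm b \<le> A.nm a + e" using xy by simp
qed

abbreviation Jc where "Jc \<equiv> A.cspn (V ` (I1 - Ic))"

text \<open>With \<open>graph_norm_le\<close> this identifies the norm of \<open>b\<close> with the
  quotient norm of any of its lifts.\<close>

lemma graph_norm_ideal:
  assumes g: "(a, b) \<in> graph" and e: "0 < e"
  shows "\<exists>j \<in> Jc. A.nm (a + j) < C.A.nm b + e"
proof -
  obtain x y where xy: "(x, y) \<in> P.spn gens" "A.nm (a - x) < e / 3" "C.A.nm (b - y) < e / 3"
    using graph_approx[OF g, of "e / 3"] e by auto
  obtain j where j: "j \<in> A.spn (V ` (I1 - Ic))" "A.nm (x + j) < C.A.nm y + e / 3"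
    using norm_span_ideal[OF xy(1), of "e / 3"] e by auto
  have c: "a \<in> A.carr" "b \<in> C.A.carr" "x \<in> A.carr" "y \<in> C.A.carr" "j \<in> A.carr"
    using graph_closed[OF g] span_closed[OF xy(1)] A.span_closed[OF V_I1(2)] j by auto
  have "A.nm (a + j) \<le> A.nm (a - x) + A.nm (x + j)"
    using A.nm_triangle[of "a - x" "x + j"] c by (simp add: A.closed)
  moreover have "C.A.nm y \<le> C.A.nm (y - b) + C.A.nm b" by (intro C.A.nm_diff_le c)
  moreover have "C.A.nm (y - b) = C.A.nm (b - y)" by (intro C.A.nm_minus_commute c)
  ultimately have "A.nm (a + j) < C.A.nm b + e" using xy j by linarith
  thus ?thesis using j A.span_subset_cspan[OF V_I1(2)] by blast
qed

lemma graph_ideal: assumes "j \<in> Jc" shows "(j, 0) \<in> graph"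
proof (rule graphI)
  show "j \<in> A.carr" using assms A.cspan_closed by blast
  fix e :: real assume e: "0 < e"
  obtain x where "x \<in> A.spn (V ` (I1 - Ic))" "A.nm (j - x) < e" using A.cspan_approx[OF V_I1(2) assms e] by blast
  thus "\<exists>x y. (x, y) \<in> P.spn gens \<and> A.nm (j - x) < e \<and> C.A.nm (0 - y) < e"
    using e by (intro exI[of _ x] exI[of _ 0]) (simp add: ideal_span_gens C.A.nm_zero)
qed (rule C.A.null_closed)

text \<open>The kernel of the homomorphism. An element over 0 has quotient norm 0 by
  \<open>graph_norm_ideal\<close>, hence is a limit of elements of \<open>Jc\<close>.\<close>

lemma graph_ideal_iff: "(a, 0) \<in> graph \<longleftrightarrow> a \<in> Jc"
proof
  assume g: "(a, 0) \<in> graph"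
  have ac: "a \<in> A.carr" using graph_closed[OF g] by simp
  show "a \<in> Jc"
  proof (rule A.cspan_limit[OF V_I1(2) ac])
    fix e :: real assume e: "0 < e"
    obtain j where j: "j \<in> Jc" "A.nm (a + j) < e" using graph_norm_ideal[OF g e] by (auto simp: C.A.nm_zero)
    have "j \<in> A.carr" using j(1) A.cspan_closed by blast
    hence "- j \<in> Jc" using A.cspan_scale[OF V_I1(2) j(1), of "-1"] by (simp add: A.scale_minus_one)
    thus "\<exists>b\<in>Jc. A.nm (a - b) < e" using j(2) by (intro bexI[of _ "- j"]) simp_all
  qed
qed (rule graph_ideal)

lemma graph_fst: assumes g: "(a, b) \<in> graph" shows "a \<in> A.cspn (V ` I1)"
proof (rule A.cspan_limit[OF V_I1(1)])
  show "a \<in> A.carr" using graph_closed[OF g] by simp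
  fix e :: real assume "0 < e"
  then obtain x y where xy: "(x, y) \<in> P.spn gens" "A.nm (a - x) < e" using graph_approx[OF g] by blast
  obtain S c where S: "S \<subseteq> I1" "x = lin S c" using span_gens[OF xy(1)] by auto
  have "x \<in> A.spn (V ` I1)"
    unfolding S(2) by (rule lin_in_span[OF S(1)])
  thus "\<exists>b\<in>A.cspn (V ` I1). A.nm (a - b) < e" using xy(2) A.span_subset_cspan[OF V_I1(1)] by blast
qed

lemma lin_in_span_gens: assumes "finite S" "S \<subseteq> I1" shows "(lin S c, clin S c) \<in> P.spn gens"
  using assms
proof (induction S rule: finite_induct)
  case empty
  show ?case using P.span_zero[of gens] by (simp add: lin_def clin_sum zero_prod_def)
next
  case (insert g S)
  have "(V g, V' g) \<in> P.spn gens" using insert by (intro cs_span.base) (auto simp: gens_def)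
  from cs_span.scale[OF this, of "c g"] have "(fscale (c g) (V g), fscale (c g) (V' g)) \<in> P.spn gens"
    by (simp add: cs_prod_simps C0star_simps C.C0star_simps)
  from P.span_add[OF this, of "(lin S c, clin S c)"] show ?case using insert by (simp add: lin_def clin_sum)
qed

lemma span_gens_diff: "\<lbrakk>(x, y) \<in> P.spn gens; (x', y') \<in> P.spn gens\<rbrakk> \<Longrightarrow> (x - x', y - y') \<in> P.spn gens"
  using P.span_diff[OF gens_closed, of "(x, y)" "(x', y')"] by simp

text \<open>Images of a sequence of approximants are Cauchy because the homomorphism is contractive
  on the span.\<close>

lemma graph_total: assumes a: "a \<in> A.cspn (V ` I1)" shows "\<exists>b. (a, b) \<in> graph"
proof -
  have ac: "a \<in> A.carr" using a A.cspan_closed by blast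
  have "\<exists>x y. (x, y) \<in> P.spn gens \<and> A.nm (a - x) < 1 / real (Suc n)" for n
  proof -
    obtain x where "x \<in> A.spn (V ` I1)" "A.nm (a - x) < 1 / real (Suc n)"
      using A.cspan_approx[OF V_I1(1) a, of "1 / real (Suc n)"] by auto
    thus ?thesis using span_lin[of x I1] lin_in_span_gens by blast
  qed
  then obtain x y where xy: "\<And>n. (x n, y n) \<in> P.spn gens" and ax: "\<And>n. A.nm (a - x n) < 1 / real (Suc n)" by metis
  have c: "x n \<in> A.carr" "y n \<in> C.A.carr" for n using span_closed[OF xy[of n]] by auto
  have small: "\<exists>M. \<forall>n\<ge>M. A.nm (a - x n) < e" if e: "0 < e" for e
  proof -
    obtain M where "1 / e < real M" using reals_Archimedean2 by blast
    hence M: "1 / real (Suc M) < e" using e by (simp add: field_simps)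
    have "A.nm (a - x n) < e" if "M \<le> n" for n
    proof -
      have "1 / real (Suc n) \<le> 1 / real (Suc M)" using that by (simp add: frac_le)
      thus ?thesis using ax[of n] M by simp
    qed
    thus ?thesis by blast
  qed
  have "\<exists>M. \<forall>m\<ge>M. \<forall>n\<ge>M. C.A.nm (cs_minus CC (y m) (y n)) < e" if e: "0 < e" for e
  proof -
    obtain M where M: "\<And>n. M \<le> n \<Longrightarrow> A.nm (a - x n) < e / 2" using small[of "e / 2"] e by auto
    have "C.A.nm (cs_minus CC (y m) (y n)) < e" if "M \<le> m" "M \<le> n" for m n
    proof -
      have "C.A.nm (y m - y n) \<le> A.nm (x m - x n)" by (rule norm_span_le[OF span_gens_diff[OF xy xy]])
      also have "\<dots> \<le> A.nm (x m - a) + A.nm (a - x n)" by (intro A.nm_triangle_diff c ac)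
      also have "A.nm (x m - a) = A.nm (a - x m)" by (intro A.nm_minus_commute c ac)
      finally show ?thesis using M[OF that(1)] M[OF that(2)] by (simp add: C.A.minus_eq c)
    qed
    thus ?thesis by blast
  qed
  then obtain b where b: "b \<in> C.A.carr" "(\<lambda>n. C.A.nm (cs_minus CC (y n) b)) \<longlonglongrightarrow> 0"
    using C.A.complete[of y] c by blast
  have "(a, b) \<in> graph"
  proof (rule graphI[OF ac b(1)])
    fix e :: real assume e: "0 < e"
    obtain M where M: "\<And>n. M \<le> n \<Longrightarrow> A.nm (a - x n) < e" using small[OF e] by blast
    obtain K where "\<forall>n\<ge>K. norm (C.A.nm (cs_minus CC (y n) b) - 0) < e" using LIMSEQ_D[OF b(2) e] by blast
    hence K: "C.A.nm (y n - b) < e" if "K \<le> n" for n using that by (auto simp: C.A.minus_eq b)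
    show "\<exists>x y. (x, y) \<in> P.spn gens \<and> A.nm (a - x) < e \<and> C.A.nm (b - y) < e"
      using xy[of "max M K"] M[of "max M K"] K[of "max M K"] C.A.nm_minus_commute[OF b(1) c(2), of "max M K"]
      by (intro exI[of _ "x (max M K)"] exI[of _ "y (max M K)"]) simp
  qed
  thus ?thesis by blast
qed

lemma crystal_span_gens: assumes "y \<in> C.A.spn (C.V ` insert None (Some ` Ic))" shows "\<exists>x. (x, y) \<in> P.spn gens"
proof -
  have "\<exists>S c. finite S \<and> S \<subseteq> insert None (Some ` Ic) \<and> y = C.lin S c" by (rule C.span_lin[OF assms])
  then obtain S c where S: "finite S" "S \<subseteq> insert None (Some ` Ic)" "y = C.lin S c" by blast
  let ?T = "{g. Some g \<in> S}"
  have fin: "finite ?T" using finite_vimageI[OF S(1), of Some] by (simp add: vimage_def)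
  have T: "?T \<subseteq> Ic" using S(2) by auto
  have V0: "C.V None = 0" by (rule C.V_zero) (simp add: crystal_zero)
  have "C.lin S c = C.lin (Some ` ?T) c"
    unfolding C.lin_def
  proof (rule sum.mono_neutral_right[OF S(1)])
    show "\<forall>u\<in>S - Some ` ?T. fscale (c u) (C.V u) = 0"
    proof
      fix u assume "u \<in> S - Some ` ?T"
      thus "fscale (c u) (C.V u) = 0" using V0 by (cases u) auto
    qed
  qed auto
  also have "\<dots> = clin ?T (\<lambda>g. c (Some g))"
    using T by (simp add: clin_def C.lin_def sum.reindex Int_absorb2)
  finally have "(lin ?T (\<lambda>g. c (Some g)), y) \<in> P.spn gens"
    using lin_in_span_gens[OF fin, of "\<lambda>g. c (Some g)"] T Ic_I1 S(3) by auto
  thus ?thesis by blast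
qed

lemma crystal_approx: assumes b: "b \<in> C.A.carr" and e: "0 < e" shows "\<exists>x y. (x, y) \<in> P.spn gens \<and> C.A.nm (b - y) < e"
proof -
  have "C.A.carr = C.A.cspn (C.V ` insert None (Some ` Ic))" by (rule C.C0star_carrier)
  hence "\<exists>y \<in> C.A.spn (C.V ` insert None (Some ` Ic)). C.A.nm (b - y) < e"
    using b e by (intro C.A.cspan_approx C.V_subset_A) auto
  thus ?thesis using crystal_span_gens by blast
qed

text \<open>Surjectivity: approximants of \<open>b\<close> are lifted successively, each correction being chosen modulo
  the ideal so that its norm is controlled in \<open>A\<close> and not only in \<open>C\<^sub>0\<^sup>*(I\<^sub>c)\<close>.\<close>

lemma graph_surj: assumes b: "b \<in> C.A.carr" shows "\<exists>a. (a, b) \<in> graph"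
proof -
  \<comment> \<open>Images of consecutive approximants differ by less than
    \<open>(1/2) ^ n + (1/2) ^ Suc n\<close>; the constant 2 leaves room for the error made in
    lifting the difference.\<close>
  define R where "R n u v \<longleftrightarrow> A.nm (fst v - fst u) < 2 * (1/2) ^ n" for n :: nat and
    u v :: "(('a, 'a) rep \<Rightarrow> 'a opr) \<times> (('a option, 'a option) rep \<Rightarrow> 'a option opr)"
  define Q where "Q n u \<longleftrightarrow> u \<in> P.spn gens \<and> C.A.nm (b - snd u) < (1/2) ^ n" for n :: nat and u
  have "\<exists>u. \<forall>n. Q n (u n) \<and> R n (u n) (u (Suc n))"
  proof (rule dependent_nat_choice)
    show "\<exists>u. Q 0 u" using crystal_approx[OF b, of "(1/2) ^ 0"] by (auto simp: Q_def)
    fix u n assume u: "Q n u"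
    obtain z w where zw: "u = (z, w)" by (cases u)
    have zws: "(z, w) \<in> P.spn gens" "C.A.nm (b - w) < (1/2) ^ n" using u by (auto simp: Q_def zw)
    obtain x y where xy: "(x, y) \<in> P.spn gens" "C.A.nm (b - y) < (1/2) ^ Suc n"
      using crystal_approx[OF b, of "(1/2) ^ Suc n"] by auto
    have c: "w \<in> C.A.carr" "y \<in> C.A.carr" using span_closed zws(1) xy(1) by auto
    have "C.A.nm (y - w) \<le> C.A.nm (y - b) + C.A.nm (b - w)" by (intro C.A.nm_triangle_diff c b)
    also have "C.A.nm (y - b) = C.A.nm (b - y)" by (intro C.A.nm_minus_commute c b)
    finally have yw: "C.A.nm (y - w) < 2 * (1/2) ^ n"
      using xy(2) zws(2) zero_less_power[of "1/2 :: real" n, OF half_gt_zero[OF zero_less_one]] unfolding power_Suc by linarith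
    \<comment> \<open>The error allowed is exactly the slack left by \<open>yw\<close>, so the
      lifted difference obeys the bound in \<open>R\<close>.\<close>
    obtain j where j: "j \<in> A.spn (V ` (I1 - Ic))" "A.nm ((x - z) + j) < C.A.nm (y - w) + (2 * (1/2) ^ n - C.A.nm (y - w))"
      using norm_span_ideal[OF span_gens_diff[OF xy(1) zws(1)], of "2 * (1/2) ^ n - C.A.nm (y - w)"] yw by auto
    have "(x + j, y) \<in> P.spn gens" using P.span_add[OF xy(1) ideal_span_gens[OF j(1)]] by simp
    moreover have eq: "x + j - z = (x - z) + j" by simp
    have "A.nm (x + j - z) < 2 * (1/2) ^ n" unfolding eq using j(2) by simp
    ultimately show "\<exists>v. Q (Suc n) v \<and> R n u v"
      using xy(2) by (intro exI[of _ "(x + j, y)"]) (simp add: Q_def R_def zw)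
  qed
  then obtain u where u: "\<And>n. Q n (u n)" "\<And>n. R n (u n) (u (Suc n))" by blast
  define x where "x n = fst (u n)" for n
  define y where "y n = snd (u n)" for n
  have xy: "(x n, y n) \<in> P.spn gens" "C.A.nm (b - y n) < (1/2) ^ n" for n using u(1)[of n] by (auto simp: Q_def x_def y_def)
  have step: "A.nm (x (Suc n) - x n) < 2 * (1/2) ^ n" for n using u(2)[of n] by (simp add: R_def x_def)
  have c: "x n \<in> A.carr" for n using span_closed[OF xy(1)[of n]] by simp
  \<comment> \<open>The geometric sum in closed form; the subtracted term lets the induction absorb
    the next step of size \<open>2 * (1/2) ^ (n + k)\<close>.\<close>
  have far: "A.nm (x (n + k) - x n) \<le> 4 * (1/2) ^ n - 4 * (1/2) ^ (n + k)" for n k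
  proof (induction k)
    case 0 show ?case by (simp add: A.nm_zero)
  next
    case (Suc k)
    have "A.nm (x (n + Suc k) - x n) \<le> A.nm (x (n + Suc k) - x (n + k)) + A.nm (x (n + k) - x n)"
      by (intro A.nm_triangle_diff c)
    thus ?case using Suc step[of "n + k"] by simp
  qed
  have pw: "\<exists>M. 4 * (1/2 :: real) ^ M < e" if "0 < e" for e
    using real_arch_pow_inv[of "e / 4" "1/2"] that by (auto simp: field_simps)
  have far': "A.nm (x m - x n) < e" if M: "4 * (1/2 :: real) ^ M < e" and mn: "M \<le> n" "n \<le> m" for M e m n
  proof -
    have "0 \<le> (1/2 :: real) ^ m" by simp
    hence "A.nm (x m - x n) \<le> 4 * (1/2) ^ n" using far[of n "m - n"] mn unfolding le_add_diff_inverse[OF mn(2)] by linarith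
    also have "\<dots> \<le> 4 * (1/2) ^ M" using mn by (simp add: power_decreasing)
    finally show ?thesis using M by simp
  qed
  have "\<exists>M. \<forall>m\<ge>M. \<forall>n\<ge>M. A.nm (cs_minus (C0star I) (x m) (x n)) < e" if e: "0 < e" for e
  proof -
    obtain M where M: "4 * (1/2 :: real) ^ M < e" using pw[OF e] by blast
    have "A.nm (x m - x n) < e" if "M \<le> m" "M \<le> n" for m n
      using far'[OF M, of n m] far'[OF M, of m n] that A.nm_minus_commute[OF c c, of m n] by (cases "n \<le> m") auto
    thus ?thesis by (auto simp: A.minus_eq c)
  qed
  then obtain a where a: "a \<in> A.carr" "(\<lambda>n. A.nm (cs_minus (C0star I) (x n) a)) \<longlonglongrightarrow> 0"
    using A.complete[of x] c by blast
  have "(a, b) \<in> graph"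
  proof (rule graphI[OF a(1) b])
    fix e :: real assume e: "0 < e"
    obtain K where "\<forall>n\<ge>K. norm (A.nm (cs_minus (C0star I) (x n) a) - 0) < e" using LIMSEQ_D[OF a(2) e] by blast
    hence K: "A.nm (x n - a) < e" if "K \<le> n" for n using that by (auto simp: A.minus_eq a)
    obtain M where M: "(1/2 :: real) ^ M < e" using real_arch_pow_inv[OF e, of "1/2"] by auto
    have "(1/2 :: real) ^ max K M \<le> (1/2) ^ M" by (rule power_decreasing) simp_all
    from less_trans[OF less_le_trans[OF xy(2) this] M] have "C.A.nm (b - y (max K M)) < e" .
    thus "\<exists>x y. (x, y) \<in> P.spn gens \<and> A.nm (a - x) < e \<and> C.A.nm (b - y) < e"
      using xy(1)[of "max K M"] K[of "max K M"] A.nm_minus_commute[OF a(1) c, of "max K M"]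
      by (intro exI[of _ "x (max K M)"] exI[of _ "y (max K M)"]) simp
  qed
  thus ?thesis by blast
qed

text \<open>The fibre of the homomorphism over \<open>b\<close>, that is, the inverse of the induced
  map on the quotient. Taking the whole fibre avoids the choice of a lift, and by
  \<open>crystal_iso_coset\<close> it is a coset.\<close>

definition crystal_iso :: "(('a option, 'a option) rep \<Rightarrow> 'a option opr) \<Rightarrow> (('a, 'a) rep \<Rightarrow> 'a opr) set" where
  "crystal_iso b = {a. (a, b) \<in> graph}"

lemma crystal_iso_coset: assumes g: "(a, b) \<in> graph" shows "crystal_iso b = cs_coset (C0star I) Jc a"
proof (intro equalityI subsetI)
  fix x assume "x \<in> crystal_iso b"
  hence "x - a \<in> Jc" using graph_diff[of x b a b] g by (simp add: crystal_iso_def graph_ideal_iff)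
  thus "x \<in> cs_coset (C0star I) Jc a" by (auto simp: cs_coset_def A.add_eq image_iff intro!: bexI[of _ "x - a"])
next
  fix x assume "x \<in> cs_coset (C0star I) Jc a"
  then obtain j where "j \<in> Jc" "x = a + j" by (auto simp: cs_coset_def A.add_eq)
  thus "x \<in> crystal_iso b" using graph_add[OF g graph_ideal] by (simp add: crystal_iso_def)
qed

text \<open>The operations of the quotient are unions over representatives. They equal the common
  value because the fibre is nonempty, which is surjectivity.\<close>

lemma UN_crystal_iso:
  assumes "b \<in> C.A.carr" "\<And>x. x \<in> crystal_iso b \<Longrightarrow> F x = Y"
  shows "(\<Union>x\<in>crystal_iso b. F x) = Y"
proof -
  obtain a where "a \<in> crystal_iso b" using graph_surj[OF assms(1)] by (auto simp: crystal_iso_def)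
  thus ?thesis using assms(2) by blast
qed

theorem cstar_iso_crystal: "cstar_iso CC (cstar_crystal (C0star I) \<sigma>) crystal_iso"
proof (rule cstar_transport)
  let ?A0 = "cs_restrict (C0star I) (A.cspn (V ` I1))"
  have Q: "cstar_crystal (C0star I) \<sigma> = cs_quotient ?A0 Jc"
    by (simp add: cstar_crystal_def spectral_0 crystal_ideal_eq)
  have coset: "cs_coset ?A0 Jc = cs_coset (C0star I) Jc" by (simp add: cs_coset_def fun_eq_iff)
  show "cstar_algebra CC" by unfold_locales
  show "bij_betw crystal_iso C.A.carr (cs_carrier (cstar_crystal (C0star I) \<sigma>))"
    unfolding bij_betw_def
  proof (intro conjI inj_onI)
    fix b b' assume b: "b \<in> C.A.carr" and b': "b' \<in> C.A.carr" and eq: "crystal_iso b = crystal_iso b'"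
    obtain a where a: "(a, b) \<in> graph" using graph_surj[OF b] by blast
    hence "(a, b') \<in> graph" using eq by (auto simp: crystal_iso_def)
    hence "C.A.nm (b - b') \<le> 0" using graph_norm_le[OF graph_diff[OF a, of a b']] by (simp add: A.nm_zero)
    hence "C.A.nm (b - b') = 0" using C.A.norm_nonneg[OF C.A.diff_closed[OF b b']] by simp
    thus "b = b'" using C.A.nm_eq_zero[OF C.A.diff_closed[OF b b']] by simp
  next
    show "crystal_iso ` C.A.carr = cs_carrier (cstar_crystal (C0star I) \<sigma>)"
    proof (intro equalityI subsetI)
      fix X assume "X \<in> crystal_iso ` C.A.carr"
      then obtain b where "b \<in> C.A.carr" "X = crystal_iso b" by blast
      moreover then obtain a where "(a, b) \<in> graph" using graph_surj by blast
      ultimately show "X \<in> cs_carrier (cstar_crystal (C0star I) \<sigma>)"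
        using graph_fst crystal_iso_coset by (auto simp: Q cs_quotient_def coset)
    next
      fix X assume "X \<in> cs_carrier (cstar_crystal (C0star I) \<sigma>)"
      then obtain a where a: "a \<in> A.cspn (V ` I1)" "X = cs_coset (C0star I) Jc a" by (auto simp: Q cs_quotient_def coset)
      then obtain b where "(a, b) \<in> graph" using graph_total by blast
      hence "X = crystal_iso b" "b \<in> C.A.carr" using a(2) crystal_iso_coset graph_closed by simp_all
      thus "X \<in> crystal_iso ` C.A.carr" by (rule image_eqI)
    qed
  qed
  have "(0, 0) \<in> graph" using graph_ideal[OF A.cspan_zero[OF V_I1(2)]] .
  thus "cs_zero (cstar_crystal (C0star I) \<sigma>) = crystal_iso (cs_zero CC)"
    by (simp add: Q cs_quotient_def coset A.zero_eq C.A.zero_eq crystal_iso_coset)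
  fix b c assume b: "b \<in> C.A.carr"
  have cl: "C.A.scl c b \<in> C.A.carr" using b by (rule C.A.scale_closed)
  show "cs_scale (cstar_crystal (C0star I) \<sigma>) c (crystal_iso b) = crystal_iso (C.A.scl c b)"
    unfolding Q cs_quotient_def cstar.simps coset cs_restrict_simps
    by (rule UN_crystal_iso[OF b]) (auto simp: crystal_iso_def[of b] intro!: crystal_iso_coset[symmetric] graph_scale)
  show "cs_star (cstar_crystal (C0star I) \<sigma>) (crystal_iso b) = crystal_iso (C.A.str b)"
    unfolding Q cs_quotient_def cstar.simps coset cs_restrict_simps
    by (rule UN_crystal_iso[OF b]) (auto simp: crystal_iso_def[of b] intro!: crystal_iso_coset[symmetric] graph_star)
  show "cs_norm (cstar_crystal (C0star I) \<sigma>) (crystal_iso b) = C.A.nm b"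
  proof -
    obtain a where a: "(a, b) \<in> graph" using graph_surj[OF b] by blast
    \<comment> \<open>All norms in the fibre are at least that of \<open>b\<close> by contractivity,
      and translating one lift by the ideal comes arbitrarily close to it.\<close>
    have "Inf (A.nm ` crystal_iso b) = C.A.nm b"
    proof (rule cInf_eq_non_empty)
      show "A.nm ` crystal_iso b \<noteq> {}" using a by (auto simp: crystal_iso_def)
      show "C.A.nm b \<le> x" if "x \<in> A.nm ` crystal_iso b" for x using that graph_norm_le by (auto simp: crystal_iso_def)
      fix y assume y: "\<And>x. x \<in> A.nm ` crystal_iso b \<Longrightarrow> y \<le> x"
      show "y \<le> C.A.nm b"
      proof (rule field_le_epsilon)
        fix e :: real assume "0 < e"
        then obtain j where j: "j \<in> Jc" "A.nm (a + j) < C.A.nm b + e" using graph_norm_ideal[OF a] by blast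
        have "a + j \<in> crystal_iso b" using graph_add[OF a graph_ideal[OF j(1)]] by (simp add: crystal_iso_def)
        thus "y \<le> C.A.nm b + e" using y[of "A.nm (a + j)"] j(2) by auto
      qed
    qed
    thus ?thesis by (simp add: Q cs_quotient_def)
  qed
  fix b' assume b': "b' \<in> C.A.carr"
  show "cs_add (cstar_crystal (C0star I) \<sigma>) (crystal_iso b) (crystal_iso b') = crystal_iso (cs_add CC b b')"
    unfolding Q cs_quotient_def cstar.simps coset cs_restrict_simps A.add_eq C.A.add_eq
    by (rule UN_crystal_iso[OF b], rule UN_crystal_iso[OF b']) (auto simp: crystal_iso_def[of b] crystal_iso_def[of b'] intro!: crystal_iso_coset[symmetric] graph_add)
  show "cs_mult (cstar_crystal (C0star I) \<sigma>) (crystal_iso b) (crystal_iso b') = crystal_iso (C.A.mul b b')"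
    unfolding Q cs_quotient_def cstar.simps coset cs_restrict_simps
    by (rule UN_crystal_iso[OF b], rule UN_crystal_iso[OF b']) (auto simp: crystal_iso_def[of b] crystal_iso_def[of b'] intro!: crystal_iso_coset[symmetric] graph_mult)
qed

lemma crystal_iso_gen:
  assumes "g \<in> Ic"
  shows "crystal_iso (univ_gen Cr (Some g)) = cs_coset (C0star I) (crystal_ideal (C0star I) \<sigma>) (V g)"
proof -
  have "(V g, C.V (Some g)) \<in> gens" using assms by (auto simp: gens_def V'_def Ic_I1 image_iff intro!: bexI[of _ g])
  hence "(V g, C.V (Some g)) \<in> graph" by (intro span_graph cs_span.base)
  thus ?thesis by (simp add: crystal_iso_coset crystal_ideal_eq)
qed

end

theorem corollary5p5:
  fixes I :: "'a sgrp" and N :: "'a \<Rightarrow> real"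
  assumes "inverse_semigroup I"
    and "is_scale I N"
  shows "\<exists>\<Phi>. cstar_iso (C0star (sg_crystal I N)) (cstar_crystal (C0star I) (scale_dynamics I N)) \<Phi> \<and>
    (\<forall>g \<in> crystal_nonzero I N. \<Phi> (univ_gen (sg_crystal I N) (Some g)) =
       cs_coset (C0star I) (crystal_ideal (C0star I) (scale_dynamics I N)) (univ_gen I g))"
proof -
  interpret scaled_semigroup I N
    using assms by (simp add: scaled_semigroup_def scaled_semigroup_axioms_def)
  show ?thesis using cstar_iso_crystal crystal_iso_gen by blast
qed

end
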